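(* Let $Y_n$ be the number of key exchanges used by Hoare's Quickselect algorithm when acting on a uniformly random permutation of size $n$ and selecting an independent rank uniformly distributed on $\{1,\ldots,n\}$. Then, as $n\to\infty$, $$\frac{Y_n}{n}\stackrel{d}{\longrightarrow}X,$$ where the distribution of $X$ is the unique solution (among probability distributions on $\mathbb{R}$) of the recursive distributional equation $$X\stackrel{d}{=}\sqrt{U}\,X+\sqrt{U}(1-\sqrt{U}),$$ in which $X$ and $U$ on the right-hand side are independent and $U$ is uniformly distributed on $[0,1]$. Moreover, $\mathrm{Var}(Y_n)\sim\frac{1}{60}n^2$ as $n\to\infty$.
   Context: Partitioning procedure (Hoare's version as in Cormen, Leiserson and Rivest). Input: a list $A[1..n]$ of $n\geqslant 2$ distinct elements of an ordered set. Set $p:=A[1]$ (the pivot), $i:=0$, $j:=n+1$. Repeat: decrease $j$ in steps of $1$ (at least one step) until $A[j]\leqslant p$; increase $i$ in steps of $1$ (at least one step) until $A[i]\geqslant p$; if $i<j$, exchange $A[i]$ and $A[j]$ (this counts as one key exchange) and continue; otherwise stop and return $I_n:=j$. The left sub-list is $A[1..I_n]$ (size $I_n$), the right sub-list is $A[I_n+1..n]$ (size $n-I_n$). Quickselect with rank $r\in\{1,\ldots,n\}$: if $n=1$, stop (no exchanges). If $n\geqslant2$, apply the partitioning procedure; if $r\leqslant I_n$, recurse on the left sub-list with rank $r$; otherwise recurse on the right sub-list with rank $r-I_n$. $Y_n$ is the total number of key exchanges over all calls to the partitioning procedure, when the input list is a uniformly random permutation of $n$ distinct elements and the rank $R_n$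 is uniformly distributed on $\{1,\ldots,n\}$ and independent of the permutation. The symbol $\stackrel{d}{=}$ denotes equality in distribution, $\stackrel{d}{\to}$ convergence in distribution, and $a_n\sim b_n$ means $a_n/b_n\to1$. *)

theory Defs
  imports
    "HOL-Probability.Probability"
    "HOL-Combinatorics.Multiset_Permutations"
    "HOL-Library.Landau_Symbols"
begin

text \<open>
  Lists are indexed from 1 as in the textbook procedure: the key \<open>A[k]\<close> is \<^term>\<open>A ! (k - 1)\<close>.
  Both scans move by at least one step. The tests \<open>j = 0\<close> and \<open>i + 1 > length A\<close> only make the
  functions total: in a run of the procedure some key of the list always stops the scan.
\<close>

fun scan_down :: "'a::linorder \<Rightarrow> 'a list \<Rightarrow> nat \<Rightarrow> nat" where
  "scan_down p A 0 = 0"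
| "scan_down p A (Suc j) = (if j = 0 \<or> A ! (j - 1) \<le> p then j else scan_down p A j)"

function scan_up :: "'a::linorder \<Rightarrow> 'a list \<Rightarrow> nat \<Rightarrow> nat" where
  "scan_up p A i = (if i + 1 > length A \<or> A ! i \<ge> p then i + 1 else scan_up p A (i + 1))"
  by auto
termination by (relation "Wellfounded.measure (\<lambda>(p, A, i). length A - i)") auto

declare scan_up.simps [simp del]

lemma scan_down_le: "scan_down p A j \<le> j - 1"
  by (induction p A j rule: scan_down.induct) auto

lemma scan_up_gt: "i < scan_up p A i"
  by (induction p A i rule: scan_up.induct) (subst scan_up.simps, fastforce)

text \<open>The result consists of the rearranged list, the returned index, and the number of exchanges.\<close>

function hoare_loop :: "'a::linorder \<Rightarrow> 'a list \<Rightarrow> nat \<Rightarrow> nat \<Rightarrow> 'a list \<times> nat \<times> nat" where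
  "hoare_loop p A i j =
     (let j' = scan_down p A j;
          i' = scan_up p A i
      in if i' < j'
         then let (B, m, k) = hoare_loop p (A[i' - 1 := A ! (j' - 1), j' - 1 := A ! (i' - 1)]) i' j'
              in (B, m, Suc k)
         else (A, j', 0))"
  by auto
termination
proof (relation "Wellfounded.measure (\<lambda>(p, A, i, j). j)")
  fix p :: 'a and A :: "'a list" and i j j' i'
  assume "j' = scan_down p A j" "i' < j'"
  with scan_down_le[of p A j] show "((p, A[i' - 1 := A ! (j' - 1), j' - 1 := A ! (i' - 1)], i', j'), p, A, i, j)
    \<in> Wellfounded.measure (\<lambda>(p, A, i, j). j)" by auto
qed auto

declare hoare_loop.simps [simp del]

definition hoare_partition :: "'a::linorder list \<Rightarrow> 'a list \<times> nat \<times> nat" where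
  "hoare_partition A = hoare_loop (A ! 0) A 0 (length A + 1)"

lemma length_hoare_loop: "hoare_loop p A i j = (B, m, k) \<Longrightarrow> length B = length A"
proof (induction p A i j arbitrary: B m k rule: hoare_loop.induct)
  case (1 p A i j)
  show ?case
  proof (cases "scan_up p A i < scan_down p A j")
    case True
    then show ?thesis
      using "1.prems" "1.IH"[OF refl refl True]
      by (subst (asm) hoare_loop.simps) (auto simp: Let_def split: prod.splits)
  next
    case False
    then show ?thesis
      using "1.prems" by (subst (asm) hoare_loop.simps) (auto simp: Let_def)
  qed
qed

lemma scan_down_ge_1: "A ! 0 \<le> p \<Longrightarrow> j \<ge> 2 \<Longrightarrow> scan_down p A j \<ge> 1"
proof (induction p A j rule: scan_down.induct)
  case (2 p A j)
  then show ?case by (cases "j = 1") auto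
qed auto

lemma hoare_loop_bounds:
  "hoare_loop p A i j = (B, m, k) \<Longrightarrow> A ! 0 \<le> p \<Longrightarrow> i \<ge> 1 \<Longrightarrow> j \<ge> 2 \<Longrightarrow> 1 \<le> m \<and> m < j"
proof (induction p A i j arbitrary: B m k rule: hoare_loop.induct)
  case (1 p A i j)
  define i' where "i' = scan_up p A i"
  define j' where "j' = scan_down p A j"
  have i': "i' \<ge> 2" using scan_up_gt[of i p A] "1.prems" by (simp add: i'_def)
  have j': "j' \<ge> 1" "j' < j"
    using scan_down_ge_1[of A p j] scan_down_le[of p A j] "1.prems" by (auto simp: j'_def)
  show ?case
  proof (cases "i' < j'")
    case True
    obtain B' m' k' where rec:
      "hoare_loop p (A[i' - 1 := A ! (j' - 1), j' - 1 := A ! (i' - 1)]) i' j' = (B', m', k')"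
      by (metis prod_cases3)
    have "m' = m" using "1.prems"(1) True rec
      by (subst (asm) hoare_loop.simps) (auto simp: Let_def i'_def j'_def)
    moreover have "1 \<le> m' \<and> m' < j'"
      using "1.IH"[OF j'_def i'_def True rec] i' True "1.prems" by auto
    ultimately show ?thesis using j' by auto
  next
    case False
    then have "m = j'"
      using "1.prems"(1) by (subst (asm) hoare_loop.simps) (auto simp: Let_def i'_def j'_def)
    then show ?thesis using j' by auto
  qed
qed

lemma hoare_partition_bounds:
  assumes "hoare_partition A = (B, m, k)" "length A \<ge> 2"
  shows "length B = length A" "1 \<le> m" "m < length A"
proof -
  let ?p = "A ! 0"
  define j' where "j' = scan_down ?p A (length A + 1)"
  have L: "hoare_loop ?p A 0 (length A + 1) = (B, m, k)"
    using assms(1) by (simp add: hoare_partition_def)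
  show "length B = length A" using length_hoare_loop[OF L] .
  have i1: "scan_up ?p A 0 = 1"
    using assms(2) by (subst scan_up.simps) auto
  have j': "1 \<le> j'" "j' \<le> length A"
    using scan_down_ge_1[of A ?p "length A + 1"] scan_down_le[of ?p A "length A + 1"] assms(2)
    by (auto simp: j'_def)
  have "1 \<le> m \<and> m < length A"
  proof (cases "1 < j'")
    case True
    let ?A = "A[0 := A ! (j' - 1), j' - 1 := ?p]"
    obtain B' m' k' where rec: "hoare_loop ?p ?A 1 j' = (B', m', k')"
      by (metis prod_cases3)
    have m: "m' = m"
      using L True rec by (subst (asm) hoare_loop.simps) (auto simp: Let_def i1 j'_def)
    have stop: "scan_down ?p A j > 1 \<Longrightarrow> A ! (scan_down ?p A j - 1) \<le> ?p" for j
      by (induction ?p A j rule: scan_down.induct) (auto split: if_splits)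
    have "0 < length A" using assms(2) by linarith
    then have "?A ! 0 = A ! (j' - 1)" using True by (simp add: nth_list_update)
    also have "\<dots> \<le> ?p" using True stop[of "length A + 1"] by (simp only: j'_def)
    finally have "?A ! 0 \<le> ?p" .
    from hoare_loop_bounds[OF rec this] True m j' show ?thesis by auto
  next
    case False
    then have "m = j'"
      using L by (subst (asm) hoare_loop.simps) (auto simp: Let_def i1 j'_def)
    then show ?thesis using False j' assms(2) by auto
  qed
  then show "1 \<le> m" "m < length A" by auto
qed

text \<open>The total number of key exchanges made by Quickselect on the list \<open>A\<close> with rank \<open>r\<close>.\<close>

function quickselect_exchanges :: "'a::linorder list \<Rightarrow> nat \<Rightarrow> nat" where
  "quickselect_exchanges A r =
     (if length A \<le> 1 then 0
      else let (B, m, k) = hoare_partition A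
           in k + (if r \<le> m then quickselect_exchanges (take m B) r
                   else quickselect_exchanges (drop m B) (r - m)))"
  by auto
termination
proof (relation "Wellfounded.measure (\<lambda>(A, r). length A)", goal_cases)
  case (2 A r x B y m k)
  then show ?case using hoare_partition_bounds[of A B m k] by auto
next
  case (3 A r x B y m k)
  then show ?case using hoare_partition_bounds[of A B m k] by auto
qed auto

declare quickselect_exchanges.simps [simp del]

definition quickselect_input :: "nat \<Rightarrow> (nat list \<times> nat) pmf" where
  "quickselect_input n = pair_pmf (pmf_of_set (permutations_of_set {1..n})) (pmf_of_set {1..n})"

text \<open>The variable \<open>Y\<^sub>n\<close> is the following function on the probability space \<^term>\<open>quickselect_input n\<close>.\<close>

definition Y :: "nat list \<times> nat \<Rightarrow> real" where
  "Y = (\<lambda>(A, r). real (quickselect_exchanges A r))"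

text \<open>\<open>M\<close> is the distribution of \<open>X\<close>; independence of \<open>X\<close> and \<open>U\<close> is expressed by the product measure.\<close>

definition solves_RDE :: "real measure \<Rightarrow> bool" where
  "solves_RDE M \<longleftrightarrow>
     real_distribution M \<and>
     M = distr (M \<Otimes>\<^sub>M uniform_measure lborel {0..1}) borel
           (\<lambda>(x, u). sqrt u * x + sqrt u * (1 - sqrt u))"

end

theory Submission
  imports Defs
begin

text \<open>
  The limit law is the law of the perpetuity \<open>\<Sum>k. V\<^sub>0 \<dots> V\<^sub>k\<^sub>-\<^sub>1 V\<^sub>k (1 - V\<^sub>k)\<close> with independent
  \<open>V\<^sub>k = sqrt U\<^sub>k\<close>; the perpetuity lies in the unit interval. Uniqueness among all distributions follows
  from a maximum argument for the difference of two characteristic functions.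

  The sub-lists are not uniformly random: after the first exchange the pivot, the minimum of the
  right sub-list, sits at a biased position. But lists in which the minimum has a prescribed position
  \<open>t\<close> and all other keys are in uniformly random order reproduce themselves: if \<open>t\<close> is not the first
  position, then given the pivot and the set of positions of the keys below it, both sub-lists are
  again of this kind. The pivot is uniform among the keys other than the minimum, so the relevant
  sub-list has the size-biased length that \<open>sqrt U\<close> describes in the limit, and the number of
  exchanges deviates from \<open>c (m - c) / m\<close>, where \<open>c\<close> keys are below the pivot, by \<open>O(sqrt m)\<close> in the
  mean. Induction on the length \<open>m\<close> then gives, for every 1-Lipschitz \<open>f\<close> and every \<open>t\<close>, that the
  expectations of \<open>f\<close> at the number of exchanges and of \<open>f\<close> at \<open>m X\<close> differ by \<open>O(sqrt m)\<close>.
  Dividing by \<open>m\<close> yields convergence in distribution and of the first two moments.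
\<close>

section \<open>The limit law\<close>

text \<open>The estimate bounds a Wasserstein distance in dual form, uniformly over 1-Lipschitz test
  functions. This suits the recursion: given the number k of exchanges of one call, the remaining
  calls enter through y -> f (k + y), which is again 1-Lipschitz, so no coupling has to be built. If
  v is the relative length of the sub-list containing the rank, size bias gives it the weight 2 v
  dv, the law of sqrt U, and the toll c (m - c) / m equals m v (1 - v) for either sub-list. The
  distance is kept unscaled, at m X, because a bound C sqrt c for shorter lists then averages to
  about (4/5) C sqrt m, where 4/5 is the integral of 2 v sqrt v; the remaining fifth pays for the
  fluctuation of the toll, of order sqrt m. The obstacle is a minimum in first position: such a call
  removes a single key and brings no contraction. But it leaves a uniformly random list, a mixture
  over all t in which t = 0 has only weight 1/n for length n, so that the trivial bound n suffices
  there and these cases do not chain.\<close>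

abbreviation unit_uniform :: "real measure" where
  "unit_uniform \<equiv> uniform_measure lborel {0..1}"

lemma prob_space_unit_uniform: "prob_space unit_uniform"
  by (rule prob_space_uniform_measure) auto

lemma AE_unit_uniform: "AE u in unit_uniform. u \<in> {0..1}"
  by (rule AE_uniform_measureI) auto

lemma integral_unit_uniform:
  fixes f :: "real \<Rightarrow> 'b::{banach, second_countable_topology}"
  assumes "f \<in> borel_measurable borel"
  shows "integral\<^sup>L unit_uniform f = (LBINT u:{0..1}. f u)"
proof -
  have "unit_uniform = density lborel (\<lambda>x. ennreal (indicator {0..1} x))"
    by (simp add: uniform_measure_def ennreal_indicator divide_ennreal_def)
  then show ?thesis
    using assms by (simp add: integral_density set_lebesgue_integral_def)
qed

text \<open>Clipping to the unit interval makes the series below converge for every sample point.\<close>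

definition clip :: "real \<Rightarrow> real" where
  "clip u = max 0 (min 1 u)"

lemma clip_bounds: "0 \<le> clip u" "clip u \<le> 1"
  by (auto simp: clip_def)

lemma clip_eq: "u \<in> {0..1} \<Longrightarrow> clip u = u"
  by (auto simp: clip_def)

definition perpetuity_term :: "(nat \<Rightarrow> real) \<Rightarrow> nat \<Rightarrow> real" where
  "perpetuity_term \<omega> k =
     (\<Prod>j<k. sqrt (clip (\<omega> j))) * (sqrt (clip (\<omega> k)) * (1 - sqrt (clip (\<omega> k))))"

definition perpetuity :: "(nat \<Rightarrow> real) \<Rightarrow> real" where
  "perpetuity \<omega> = (\<Sum>k. perpetuity_term \<omega> k)"

lemma perpetuity_term_nonneg: "0 \<le> perpetuity_term \<omega> k"
  unfolding perpetuity_term_def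
  by (intro mult_nonneg_nonneg prod_nonneg) (auto simp: clip_bounds)

text \<open>Since v (1 - v) \<le> 1 - v on the unit interval, the term with index k is at most the
  drop from the product of the first k factors to that of the first k + 1, and these drops
  telescope.\<close>

lemma sum_perpetuity_term_le:
  "(\<Sum>k<n. perpetuity_term \<omega> k) \<le> 1 - (\<Prod>j<n. sqrt (clip (\<omega> j)))"
proof (induction n)
  case (Suc n)
  let ?P = "\<Prod>j<n. sqrt (clip (\<omega> j))" and ?v = "sqrt (clip (\<omega> n))"
  have "0 \<le> ?P" by (intro prod_nonneg) (auto simp: clip_bounds)
  moreover have "0 \<le> ?v" "?v \<le> 1" by (auto simp: clip_bounds)
  ultimately have "?P * (?v * (1 - ?v)) \<le> ?P * (1 - ?v)"
    by (intro mult_left_mono) (auto intro: mult_left_le_one_le)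
  then show ?case using Suc by (simp add: perpetuity_term_def algebra_simps)
qed auto

lemma sum_perpetuity_term_le_1: "(\<Sum>k<n. perpetuity_term \<omega> k) \<le> 1"
proof -
  have "0 \<le> (\<Prod>j<n. sqrt (clip (\<omega> j)))" by (intro prod_nonneg) (auto simp: clip_bounds)
  then show ?thesis using sum_perpetuity_term_le[of \<omega> n] by linarith
qed

lemma summable_perpetuity_term: "summable (perpetuity_term \<omega>)"
  by (rule summableI_nonneg_bounded[where x = 1])
     (auto simp: perpetuity_term_nonneg sum_perpetuity_term_le_1)

lemma perpetuity_bounds: "0 \<le> perpetuity \<omega>" "perpetuity \<omega> \<le> 1"
  unfolding perpetuity_def
  by (auto intro!: suminf_nonneg suminf_le_const summable_perpetuity_term
      perpetuity_term_nonneg sum_perpetuity_term_le_1)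

lemma perpetuity_case_nat:
  "perpetuity (case_nat u \<omega>) =
     sqrt (clip u) * perpetuity \<omega> + sqrt (clip u) * (1 - sqrt (clip u))"
proof -
  have 0: "perpetuity_term (case_nat u \<omega>) 0 = sqrt (clip u) * (1 - sqrt (clip u))"
    by (simp add: perpetuity_term_def)
  have Suc: "perpetuity_term (case_nat u \<omega>) (Suc k) = sqrt (clip u) * perpetuity_term \<omega> k" for k
    by (simp add: perpetuity_term_def prod.lessThan_Suc_shift del: prod.lessThan_Suc)
  have "perpetuity (case_nat u \<omega>) = (\<Sum>k. perpetuity_term (case_nat u \<omega>) (Suc k)) + perpetuity_term (case_nat u \<omega>) 0"
    unfolding perpetuity_def by (subst suminf_split_head[OF summable_perpetuity_term]) simp
  also have "(\<Sum>k. perpetuity_term (case_nat u \<omega>) (Suc k)) = sqrt (clip u) * perpetuity \<omega>"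
    unfolding Suc perpetuity_def by (rule suminf_mult[OF summable_perpetuity_term])
  finally show ?thesis by (simp add: 0)
qed

definition limit_law :: "real measure" where
  "limit_law = distr (\<Pi>\<^sub>M i\<in>(UNIV::nat set). unit_uniform) borel perpetuity"

lemma sets_unit_uniform [measurable_cong]: "sets unit_uniform = sets borel"
  by simp

lemma measurable_clip [measurable]: "clip \<in> borel_measurable borel"
  unfolding clip_def by measurable

lemma measurable_perpetuity [measurable]:
  "perpetuity \<in> borel_measurable (\<Pi>\<^sub>M i\<in>(UNIV::nat set). unit_uniform)"
  unfolding perpetuity_def perpetuity_term_def by measurable

lemma real_distribution_limit_law: "real_distribution limit_law"
proof -
  interpret U: prob_space unit_uniform by (rule prob_space_unit_uniform)
  interpret S: sequence_space unit_uniform ..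
  show ?thesis unfolding limit_law_def by (rule S.real_distribution_distr) measurable
qed

lemma AE_limit_law: "AE x in limit_law. 0 \<le> x \<and> x \<le> 1"
  unfolding limit_law_def by (subst AE_distr_iff) (auto simp: perpetuity_bounds)

text \<open>Prepending an independent coordinate preserves the product measure on sequences
  (\<open>S.PiM_iter\<close>), and \<open>perpetuity_case_nat\<close> turns this shift into the
  affine map of the equation. Clipping is almost surely the identity.\<close>

lemma solves_RDE_limit_law: "solves_RDE limit_law"
proof -
  interpret U: prob_space unit_uniform by (rule prob_space_unit_uniform)
  interpret S: sequence_space unit_uniform ..
  interpret L: real_distribution limit_law by (rule real_distribution_limit_law)
  interpret LU: pair_prob_space limit_law unit_uniform ..
  interpret SU: pair_prob_space S.S unit_uniform ..
  let ?g = "\<lambda>(x, u). sqrt u * x + sqrt u * (1 - sqrt u)"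
  let ?h = "\<lambda>(x, u). sqrt (clip u) * x + sqrt (clip u) * (1 - sqrt (clip u))"
  have "{z \<in> space (limit_law \<Otimes>\<^sub>M unit_uniform). snd z \<in> {0..1}} \<in> sets (limit_law \<Otimes>\<^sub>M unit_uniform)"
    by measurable
  then have AE: "AE z in limit_law \<Otimes>\<^sub>M unit_uniform. snd z \<in> {0..1}"
    using AE_unit_uniform by (intro LU.AE_pair_measure) auto
  have law: "limit_law \<Otimes>\<^sub>M unit_uniform =
      distr (S.S \<Otimes>\<^sub>M unit_uniform) (borel \<Otimes>\<^sub>M unit_uniform) (\<lambda>(\<omega>, u). (perpetuity \<omega>, u))"
  proof -
    have "distr S.S borel perpetuity \<Otimes>\<^sub>M distr unit_uniform unit_uniform (\<lambda>u. u) =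
       distr (S.S \<Otimes>\<^sub>M unit_uniform) (borel \<Otimes>\<^sub>M unit_uniform) (\<lambda>(\<omega>, u). (perpetuity \<omega>, u))"
      by (rule pair_measure_distr) (auto simp: distr_id U.sigma_finite_measure_axioms)
    then show ?thesis unfolding limit_law_def by (simp add: distr_id)
  qed
  have "distr (limit_law \<Otimes>\<^sub>M unit_uniform) borel ?g = distr (limit_law \<Otimes>\<^sub>M unit_uniform) borel ?h"
  proof (rule distr_cong_AE)
    show "AE x in limit_law \<Otimes>\<^sub>M unit_uniform. ?g x = ?h x"
      using AE by eventually_elim (auto simp: clip_eq)
  qed auto
  also have "distr (limit_law \<Otimes>\<^sub>M unit_uniform) borel ?h = distr (S.S \<Otimes>\<^sub>M unit_uniform) borel
      (?h \<circ> (\<lambda>(\<omega>, u). (perpetuity \<omega>, u)))"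
    unfolding law by (rule distr_distr) measurable
  also have "\<dots> = distr (S.S \<Otimes>\<^sub>M unit_uniform) borel (\<lambda>(\<omega>, u). perpetuity (case_nat u \<omega>))"
    by (simp add: comp_def split_beta' perpetuity_case_nat)
  also have "\<dots> = distr (distr (unit_uniform \<Otimes>\<^sub>M S.S) (S.S \<Otimes>\<^sub>M unit_uniform) (\<lambda>(x, y). (y, x)))
      borel (\<lambda>(\<omega>, u). perpetuity (case_nat u \<omega>))"
    using SU.distr_pair_swap by simp
  also have "\<dots> = distr (unit_uniform \<Otimes>\<^sub>M S.S) borel (\<lambda>(u, \<omega>). perpetuity (case_nat u \<omega>))"
    by (subst distr_distr) (auto simp: comp_def split_beta')
  also have "\<dots> = distr (distr (unit_uniform \<Otimes>\<^sub>M S.S) S.S (\<lambda>(s, \<omega>). case_nat s \<omega>)) borel perpetuity"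
    by (subst distr_distr) (auto simp: comp_def split_beta')
  also have "\<dots> = limit_law"
    unfolding S.PiM_iter limit_law_def ..
  finally show ?thesis
    unfolding solves_RDE_def using real_distribution_limit_law by simp
qed

section \<open>Uniqueness of the solution\<close>

text \<open>Conditioning on \<open>u\<close> splits off the translation as a factor of modulus one,
  which disappears when absolute values are taken in the uniqueness proof.\<close>

lemma char_solves_RDE:
  assumes "solves_RDE \<nu>"
  shows "char \<nu> t = (\<integral>u. iexp (t * (sqrt u * (1 - sqrt u))) * char \<nu> (t * sqrt u) \<partial>unit_uniform)"
proof -
  interpret U: prob_space unit_uniform by (rule prob_space_unit_uniform)
  interpret N: real_distribution \<nu> using assms by (simp add: solves_RDE_def)
  interpret NU: pair_prob_space \<nu> unit_uniform ..
  let ?g = "\<lambda>(x, u). sqrt u * x + sqrt u * (1 - sqrt u)"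
  have "char \<nu> t = char (distr (\<nu> \<Otimes>\<^sub>M unit_uniform) borel ?g) t"
    using assms by (simp add: solves_RDE_def)
  also have "\<dots> = (\<integral>z. iexp (t * ?g z) \<partial>(\<nu> \<Otimes>\<^sub>M unit_uniform))"
    unfolding char_def by (subst integral_distr) auto
  also have "\<dots> = (\<integral>u. (\<integral>x. iexp (t * (sqrt u * x + sqrt u * (1 - sqrt u))) \<partial>\<nu>) \<partial>unit_uniform)"
  proof -
    have "integrable (\<nu> \<Otimes>\<^sub>M unit_uniform) (\<lambda>(x, u). iexp (t * (sqrt u * x + sqrt u * (1 - sqrt u))))"
      by (rule NU.integrable_const_bound[where B = 1]) (auto simp: split_beta' simp del: of_real_mult of_real_add of_real_diff)
    from NU.integral_snd[OF this] show ?thesis by (simp add: split_beta')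
  qed
  also have "\<dots> = (\<integral>u. iexp (t * (sqrt u * (1 - sqrt u))) * char \<nu> (t * sqrt u) \<partial>unit_uniform)"
    unfolding char_def
    by (subst integral_mult_right_zero[symmetric])
       (simp add: exp_add[symmetric] algebra_simps)
  finally show ?thesis .
qed

text \<open>At a point of a compact interval where the difference \<open>\<Delta>\<close> of two characteristic functions
  is largest, the equation represents it by an average of \<open>\<Delta>\<close> that includes values near
  \<open>\<Delta> 0 = 0\<close>.\<close>

lemma solves_RDE_unique:
  assumes "solves_RDE \<mu>" "solves_RDE \<nu>"
  shows "\<mu> = \<nu>"
proof (rule Levy_uniqueness)
  interpret U: prob_space unit_uniform by (rule prob_space_unit_uniform)
  interpret M: real_distribution \<mu> using assms by (simp add: solves_RDE_def)
  interpret N: real_distribution \<nu> using assms by (simp add: solves_RDE_def)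
  show "real_distribution \<mu>" "real_distribution \<nu>" by unfold_locales
  define h where "h t = cmod (char \<mu> t - char \<nu> t)" for t
  have cont: "isCont h t" for t
    unfolding h_def by (intro continuous_intros M.isCont_char N.isCont_char)
  have meas [measurable]: "h \<in> borel_measurable borel"
    unfolding h_def by measurable
  have h2: "h t \<le> 2" for t
    unfolding h_def using norm_triangle_ineq4[of "char \<mu> t" "char \<nu> t"]
      M.cmod_char_le_1[of t] N.cmod_char_le_1[of t] by linarith
  have h0: "h 0 = 0" by (simp add: h_def M.char_zero N.char_zero)
  have hpos: "0 \<le> h t" for t by (simp add: h_def)
  have int_h: "integrable unit_uniform (\<lambda>u. h (t * sqrt u))" for t
    by (rule U.integrable_const_bound[where B = 2]) (auto simp: hpos h2)
  have avg: "h t \<le> (\<integral>u. h (t * sqrt u) \<partial>unit_uniform)" for t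
  proof -
    have int: "integrable unit_uniform (\<lambda>u. iexp (t * (sqrt u * (1 - sqrt u))) * char M (t * sqrt u))"
      if "real_distribution M" for M
    proof (rule U.integrable_const_bound[where B = 1])
      show "AE u in unit_uniform. cmod (iexp (t * (sqrt u * (1 - sqrt u))) * char M (t * sqrt u)) \<le> 1"
        using real_distribution.cmod_char_le_1[OF that] by (simp add: norm_mult del: of_real_mult of_real_diff)
      have [measurable]: "char M \<in> borel_measurable borel"
        by (rule real_distribution.char_measurable[OF that])
      show "(\<lambda>u. iexp (t * (sqrt u * (1 - sqrt u))) * char M (t * sqrt u)) \<in> borel_measurable unit_uniform"
        by measurable
    qed
    have "char \<mu> t - char \<nu> t =
        (\<integral>u. iexp (t * (sqrt u * (1 - sqrt u))) * (char \<mu> (t * sqrt u) - char \<nu> (t * sqrt u)) \<partial>unit_uniform)"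
      unfolding char_solves_RDE[OF assms(1), of t] char_solves_RDE[OF assms(2), of t]
      by (subst Bochner_Integration.integral_diff[symmetric])
         (use int M.real_distribution_axioms N.real_distribution_axioms in
           \<open>simp_all only: right_diff_distrib\<close>)
    then have "h t \<le> (\<integral>u. cmod (iexp (t * (sqrt u * (1 - sqrt u))) * (char \<mu> (t * sqrt u) - char \<nu> (t * sqrt u))) \<partial>unit_uniform)"
      unfolding h_def by (simp only:) (rule integral_norm_bound)
    then show ?thesis by (simp add: norm_mult h_def del: of_real_mult of_real_diff)
  qed
  have "h t = 0" for t
  proof -
    obtain s where s: "s \<in> {-\<bar>t\<bar>..\<bar>t\<bar>}" "\<And>s'. s' \<in> {-\<bar>t\<bar>..\<bar>t\<bar>} \<Longrightarrow> h s' \<le> h s"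
      using continuous_attains_sup[of "{-\<bar>t\<bar>..\<bar>t\<bar>}" h] cont
      by (auto simp: continuous_at_imp_continuous_on)
    have "h s \<le> 0"
    proof (rule ccontr)
      assume "\<not> h s \<le> 0"
      then have pos: "0 < h s" by simp
      define F where "F u = h (s * sqrt u)" for u
      have "isCont F 0" unfolding F_def by (intro isCont_o2[OF _ cont] continuous_intros)
      then obtain d where d: "d > 0" "\<And>u. \<bar>u\<bar> < d \<Longrightarrow> \<bar>F u - F 0\<bar> < h s / 2"
        using pos unfolding continuous_at_eps_delta dist_real_def
        by (metis diff_zero half_gt_zero)
      \<comment> \<open>Halving \<open>d\<close> keeps the closed interval inside the open one; the
        cap at 1 gives \<open>{0..e}\<close> uniform measure exactly \<open>e\<close>.\<close>
      define e where "e = min (d / 2) 1"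
      have e: "0 < e" "e < d" "e \<le> 1" using d(1) by (auto simp: e_def)
      have small: "F u \<le> h s / 2" if "u \<in> {0..e}" for u
        using d(2)[of u] that e by (auto simp: F_def h0)
      have le: "F u \<le> h s" if "u \<in> {0..1}" for u
      proof -
        have "\<bar>s * sqrt u\<bar> \<le> \<bar>t\<bar> * 1"
          unfolding abs_mult using that s(1) by (intro mult_mono) auto
        then show ?thesis unfolding F_def by (intro s(2)) auto
      qed
      have "h s \<le> (\<integral>u. F u \<partial>unit_uniform)"
        using avg[of s] by (simp add: F_def)
      also have "\<dots> \<le> (\<integral>u. h s - h s / 2 * indicator {0..e} u \<partial>unit_uniform)"
      proof (rule integral_mono_AE)
        show "integrable unit_uniform F" unfolding F_def by (rule int_h)
        show "integrable unit_uniform (\<lambda>u. h s - h s / 2 * indicator {0..e} u)"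
          by (auto intro!: integrable_mult_right simp: U.emeasure_eq_measure)
        show "AE u in unit_uniform. F u \<le> h s - h s / 2 * indicator {0..e} u"
          using AE_unit_uniform
        proof eventually_elim
          case (elim u)
          then show ?case using small[of u] le[of u] by (auto simp: indicator_def)
        qed
      qed
      also have "\<dots> = h s - h s / 2 * measure unit_uniform {0..e}"
        by (subst Bochner_Integration.integral_diff)
           (auto simp: U.prob_space U.emeasure_eq_measure)
      also have "measure unit_uniform {0..e} = e"
        using e by (subst measure_uniform_measure) (auto simp: min_def)
      finally show False using pos e(1) by (simp add: mult_le_0_iff)
    qed
    moreover have "h t \<le> h s" by (intro s(2)) auto
    ultimately show ?thesis using hpos[of t] by linarith
  qed
  then show "char \<mu> = char \<nu>" by (auto simp: h_def)
qed

section \<open>Integrals against the limit law\<close>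

lemma lip1D: "1-lipschitz_on UNIV f \<Longrightarrow> \<bar>f x - f y\<bar> \<le> \<bar>x - y\<bar>" for f :: "real \<Rightarrow> real"
  using lipschitz_onD[of 1 UNIV f x y] by (simp add: dist_real_def)

lemma lip1I: "(\<And>x y. \<bar>f x - f y\<bar> \<le> \<bar>x - y\<bar>) \<Longrightarrow> 1-lipschitz_on UNIV f" for f :: "real \<Rightarrow> real"
  by (intro lipschitz_onI) (auto simp: dist_real_def)

lemma lip1_measurable: "1-lipschitz_on UNIV f \<Longrightarrow> f \<in> borel_measurable borel" for f :: "real \<Rightarrow> real"
  by (intro borel_measurable_continuous_onI lipschitz_on_continuous_on)

lemma lip1_shift: "1-lipschitz_on UNIV f \<Longrightarrow> 1-lipschitz_on UNIV (\<lambda>y. f (a + y))" for f :: "real \<Rightarrow> real"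
  by (intro lip1I) (use lip1D[of f "a + _" "a + _"] in \<open>auto simp: algebra_simps\<close>)

lemma limit_law_integrable_bounded:
  fixes F :: "real \<Rightarrow> real"
  assumes "F \<in> borel_measurable borel" "\<And>x. 0 \<le> x \<Longrightarrow> x \<le> 1 \<Longrightarrow> \<bar>F x\<bar> \<le> K"
  shows "integrable limit_law F"
proof -
  interpret real_distribution limit_law by (rule real_distribution_limit_law)
  show ?thesis
  proof (rule integrable_const_bound[where B = K])
    show "AE x in limit_law. norm (F x) \<le> K" using AE_limit_law by eventually_elim (use assms in auto)
  qed (use assms in simp)
qed

lemma limit_law_integrable_lip1:
  fixes f :: "real \<Rightarrow> real"
  assumes "1-lipschitz_on UNIV f"
  shows "integrable limit_law (\<lambda>x. f (a * x + b))"
proof (rule limit_law_integrable_bounded)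
  note [measurable] = lip1_measurable[OF assms]
  show "(\<lambda>x. f (a * x + b)) \<in> borel_measurable borel" by measurable
  fix x :: real assume x: "0 \<le> x" "x \<le> 1"
  have "\<bar>f (a * x + b)\<bar> \<le> \<bar>f 0\<bar> + \<bar>a * x + b\<bar>" using lip1D[OF assms, of "a * x + b" 0] by auto
  also have "\<bar>a * x + b\<bar> \<le> \<bar>a\<bar> + \<bar>b\<bar>"
  proof -
    have "\<bar>a * x\<bar> \<le> \<bar>a\<bar>" using x by (simp add: abs_mult mult_left_le)
    then show ?thesis by linarith
  qed
  finally show "\<bar>f (a * x + b)\<bar> \<le> \<bar>f 0\<bar> + (\<bar>a\<bar> + \<bar>b\<bar>)" by simp
qed

lemma limit_law_integral_diff_le:
  fixes F G :: "real \<Rightarrow> real"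
  assumes "integrable limit_law F" "integrable limit_law G"
    and "\<And>x. 0 \<le> x \<Longrightarrow> x \<le> 1 \<Longrightarrow> \<bar>F x - G x\<bar> \<le> K"
  shows "\<bar>(\<integral>x. F x \<partial>limit_law) - (\<integral>x. G x \<partial>limit_law)\<bar> \<le> K"
proof -
  interpret real_distribution limit_law by (rule real_distribution_limit_law)
  have int: "integrable limit_law (\<lambda>x. F x - G x)" using assms by auto
  have "\<bar>(\<integral>x. F x \<partial>limit_law) - (\<integral>x. G x \<partial>limit_law)\<bar> = \<bar>\<integral>x. F x - G x \<partial>limit_law\<bar>"
    using assms by simp
  also have "\<dots> \<le> (\<integral>x. \<bar>F x - G x\<bar> \<partial>limit_law)"
    by (rule integral_abs_bound)
  also have "\<dots> \<le> (\<integral>x. K \<partial>limit_law)"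
  proof (rule integral_mono_AE)
    show "AE x in limit_law. \<bar>F x - G x\<bar> \<le> K"
      using AE_limit_law by eventually_elim (use assms(3) in auto)
  qed (use int in auto)
  also have "\<dots> = K" using prob_space by simp
  finally show ?thesis .
qed

lemma limit_law_integral_lip1_diff:
  fixes f :: "real \<Rightarrow> real"
  assumes "1-lipschitz_on UNIV f"
  shows "\<bar>(\<integral>x. f (a * x + b) \<partial>limit_law) - (\<integral>x. f (a' * x + b') \<partial>limit_law)\<bar> \<le> \<bar>a - a'\<bar> + \<bar>b - b'\<bar>"
proof (rule limit_law_integral_diff_le)
  fix x :: real assume x: "0 \<le> x" "x \<le> 1"
  have "\<bar>f (a * x + b) - f (a' * x + b')\<bar> \<le> \<bar>(a - a') * x + (b - b')\<bar>"
    using lip1D[OF assms, of "a * x + b" "a' * x + b'"] by (simp add: algebra_simps)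
  also have "\<dots> \<le> \<bar>(a - a') * x\<bar> + \<bar>b - b'\<bar>" by (rule abs_triangle_ineq)
  also have "\<bar>(a - a') * x\<bar> \<le> \<bar>a - a'\<bar>" using x by (simp add: abs_mult mult_left_le)
  finally show "\<bar>f (a * x + b) - f (a' * x + b')\<bar> \<le> \<bar>a - a'\<bar> + \<bar>b - b'\<bar>" by simp
qed (rule limit_law_integrable_lip1[OF assms])+

text \<open>Both \<open>y\<close> and almost every value of \<open>m * x\<close> lie between 0 and
  \<open>m\<close>. This crude bound serves the events whose probability is of order 1/m.\<close>

lemma limit_law_integral_lip1_near:
  fixes f :: "real \<Rightarrow> real"
  assumes "1-lipschitz_on UNIV f" "0 \<le> y" "y \<le> real m"
  shows "\<bar>f y - (\<integral>x. f (real m * x) \<partial>limit_law)\<bar> \<le> real m"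
proof -
  have "\<bar>(\<integral>x. f y \<partial>limit_law) - (\<integral>x. f (real m * x) \<partial>limit_law)\<bar> \<le> real m"
  proof (rule limit_law_integral_diff_le)
    show "integrable limit_law (\<lambda>x. f (real m * x))"
      using limit_law_integrable_lip1[OF assms(1), of "real m" 0] by simp
    show "integrable limit_law (\<lambda>x. f y)"
      by (rule limit_law_integrable_bounded[where K = "\<bar>f y\<bar>"]) auto
    fix x :: real assume x: "0 \<le> x" "x \<le> 1"
    then have "0 \<le> real m * x" "real m * x \<le> real m" by (auto simp: mult_left_le)
    then show "\<bar>f y - f (real m * x)\<bar> \<le> real m"
      using lip1D[OF assms(1), of y "real m * x"] assms(2,3) by linarith
  qed
  moreover have "(\<integral>x. f y \<partial>limit_law) = f y"
  proof -
    interpret real_distribution limit_law by (rule real_distribution_limit_law)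
    show ?thesis by (simp add: prob_space del: space_eq_univ)
  qed
  ultimately show ?thesis by metis
qed

text \<open>The value is at most v + v (1 - v) = 1 - (1 - v)^2, so the affine maps of the equation
  leave the unit interval invariant.\<close>

lemma convex_step_bounds:
  fixes x v :: real
  assumes "0 \<le> x" "x \<le> 1" "0 \<le> v" "v \<le> 1"
  shows "0 \<le> v * x + v * (1 - v)" "v * x + v * (1 - v) \<le> 1"
proof -
  show "0 \<le> v * x + v * (1 - v)" using assms by simp
  have "v * x \<le> v" using assms by (simp add: mult_left_le)
  moreover have "0 \<le> (1 - v)\<^sup>2" by simp
  ultimately show "v * x + v * (1 - v) \<le> 1" by (simp add: power2_eq_square algebra_simps)
qed

text \<open>A bound on the unit interval is enough for Fubini, because this interval carries
  \<open>limit_law\<close> and is invariant by \<open>convex_step_bounds\<close>.\<close>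

lemma limit_law_integral_RDE:
  fixes F :: "real \<Rightarrow> real"
  assumes [measurable]: "F \<in> borel_measurable borel"
    and bound: "\<And>x. 0 \<le> x \<Longrightarrow> x \<le> 1 \<Longrightarrow> \<bar>F x\<bar> \<le> K"
  shows "(\<integral>x. F x \<partial>limit_law) =
    (LBINT u:{0..1}. (\<integral>x. F (sqrt u * x + sqrt u * (1 - sqrt u)) \<partial>limit_law))"
proof -
  interpret U: prob_space unit_uniform by (rule prob_space_unit_uniform)
  interpret L: real_distribution limit_law by (rule real_distribution_limit_law)
  interpret LU: pair_prob_space limit_law unit_uniform ..
  let ?h = "\<lambda>(x, u). sqrt u * x + sqrt u * (1 - sqrt u)"
  have "(\<integral>x. F x \<partial>limit_law) = (\<integral>x. F x \<partial>distr (limit_law \<Otimes>\<^sub>M unit_uniform) borel ?h)"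
    using solves_RDE_limit_law by (simp add: solves_RDE_def)
  also have "\<dots> = (\<integral>z. F (?h z) \<partial>(limit_law \<Otimes>\<^sub>M unit_uniform))"
    by (subst integral_distr) auto
  also have "\<dots> = (\<integral>u. (\<integral>x. F (sqrt u * x + sqrt u * (1 - sqrt u)) \<partial>limit_law) \<partial>unit_uniform)"
  proof -
    have "integrable (limit_law \<Otimes>\<^sub>M unit_uniform) (\<lambda>(x, u). F (sqrt u * x + sqrt u * (1 - sqrt u)))"
    proof (rule LU.integrable_const_bound[where B = K])
      have "{z \<in> space (limit_law \<Otimes>\<^sub>M unit_uniform). 0 \<le> fst z \<and> fst z \<le> 1 \<and> snd z \<in> {0..1}}
          \<in> sets (limit_law \<Otimes>\<^sub>M unit_uniform)" by measurable
      then have "AE z in limit_law \<Otimes>\<^sub>M unit_uniform. 0 \<le> fst z \<and> fst z \<le> 1 \<and> snd z \<in> {0..1}"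
      proof (rule LU.AE_pair_measure)
        show "AE x in limit_law. AE u in unit_uniform.
            0 \<le> fst (x, u) \<and> fst (x, u) \<le> 1 \<and> snd (x, u) \<in> {0..1}"
          using AE_limit_law
        proof eventually_elim
          case (elim x)
          show ?case using AE_unit_uniform by eventually_elim (use elim in auto)
        qed
      qed
      then show "AE z in limit_law \<Otimes>\<^sub>M unit_uniform.
          norm ((\<lambda>(x, u). F (sqrt u * x + sqrt u * (1 - sqrt u))) z) \<le> K"
      proof eventually_elim
        case (elim z)
        then show ?case
          using bound convex_step_bounds[of "fst z" "sqrt (snd z)"] by (simp add: split_beta')
      qed
    qed measurable
    from LU.integral_snd[OF this] show ?thesis by (simp add: split_beta')
  qed
  also have "\<dots> = (LBINT u:{0..1}. (\<integral>x. F (sqrt u * x + sqrt u * (1 - sqrt u)) \<partial>limit_law))"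
    by (rule integral_unit_uniform) measurable
  finally show ?thesis .
qed

section \<open>Moments of the limit law\<close>

lemma LBINT_sqrt_power:
  "(LBINT u:{0..1}. sqrt u ^ n) = 2 / (real n + 2)"
  "set_integrable lborel {0..1} (\<lambda>u. sqrt u ^ n)"
proof -
  let ?A = "\<lambda>u. 2 / (real n + 2) * sqrt u ^ (n + 2)"
  show int: "set_integrable lborel {0..1} (\<lambda>u. sqrt u ^ n)"
    unfolding set_integrable_def
    by (intro borel_integrable_compact continuous_intros compact_Icc)
  \<comment> \<open>The interior form of the fundamental theorem is used because \<open>sqrt\<close>
    has no derivative at 0.\<close>
  have "((\<lambda>u. sqrt u ^ n) has_integral (?A 1 - ?A 0)) {0..1}"
  proof (rule fundamental_theorem_of_calculus_interior)
    fix u :: real assume u: "u \<in> {0<..<1}"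
    have "(?A has_real_derivative 2 / (real n + 2) *
        (of_nat (n + 2) * (inverse (sqrt u) / 2 * sqrt u ^ (n + 2 - Suc 0)))) (at u)"
      using u by (intro DERIV_cmult DERIV_power DERIV_real_sqrt) auto
    also have "2 / (real n + 2) * (of_nat (n + 2) * (inverse (sqrt u) / 2 * sqrt u ^ (n + 2 - Suc 0))) = sqrt u ^ n"
      using u by (simp add: field_simps)
    finally show "(?A has_vector_derivative sqrt u ^ n) (at u)"
      by (simp add: has_real_derivative_iff_has_vector_derivative)
  qed (auto intro!: continuous_intros)
  then have "integral {0..1} (\<lambda>u. sqrt u ^ n) = 2 / (real n + 2)"
    by (simp add: integral_unique)
  then show "(LBINT u:{0..1}. sqrt u ^ n) = 2 / (real n + 2)"
    using set_borel_integral_eq_integral(2)[OF int] by simp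
qed

lemma limit_law_integrable_power: "integrable limit_law (\<lambda>x. x ^ n)"
  by (rule limit_law_integrable_bounded[where K = 1]) (auto simp: power_le_one)

lemma limit_law_mean: "(\<integral>x. x \<partial>limit_law) = 1 / 2"
proof -
  interpret L: real_distribution limit_law by (rule real_distribution_limit_law)
  let ?E = "\<integral>x. x \<partial>limit_law"
  have int: "integrable limit_law (\<lambda>x. x)" using limit_law_integrable_power[of 1] by simp
  have eq: "?E * sqrt u + sqrt u - sqrt u ^ 2 =
      (\<integral>x. sqrt u * x + sqrt u * (1 - sqrt u) \<partial>limit_law)" for u
  proof -
    have "(\<integral>x. sqrt u * x + sqrt u * (1 - sqrt u) \<partial>limit_law) = sqrt u * ?E + sqrt u * (1 - sqrt u)"
      using int by (simp add: L.prob_space del: L.space_eq_univ)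
    then show ?thesis by (simp add: power2_eq_square right_diff_distrib mult.commute)
  qed
  have "?E = (LBINT u:{0..1}. (\<integral>x. sqrt u * x + sqrt u * (1 - sqrt u) \<partial>limit_law))"
    by (rule limit_law_integral_RDE[where F = "\<lambda>x. x" and K = 1]) auto
  also have "\<dots> = (LBINT u:{0..1}. ?E * sqrt u + sqrt u - sqrt u ^ 2)"
    by (simp only: eq)
  also have "\<dots> = ?E * (2 / 3) + 2 / 3 - 1 / 2"
  proof -
    have 1: "set_integrable lborel {0..1} sqrt" "(LBINT u:{0..1}. sqrt u) = 2 / 3"
      using LBINT_sqrt_power[of 1] by simp_all
    have 2: "set_integrable lborel {0..1} (\<lambda>u. (sqrt u)\<^sup>2)" "(LBINT u:{0..1}. (sqrt u)\<^sup>2) = 1 / 2"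
      using LBINT_sqrt_power[of 2] by (simp_all del: real_sqrt_pow2_iff real_sqrt_pow2)
    show ?thesis
      by (simp add: set_integral_diff set_integral_add 1 2 del: real_sqrt_pow2_iff real_sqrt_pow2)
  qed
  finally show ?thesis by simp
qed

text \<open>With mean 1/2, the square of the right-hand side has conditional mean (E + 2) V^2 - 3
  V^3 + V^4 given V = sqrt U, hence E = (E + 2) / 2 - 6/5 + 1/3. The resulting variance 4/15 - 1/4
  is the constant 1/60 of the theorem.\<close>

lemma limit_law_second_moment: "(\<integral>x. x\<^sup>2 \<partial>limit_law) = 4 / 15"
proof -
  interpret L: real_distribution limit_law by (rule real_distribution_limit_law)
  let ?E = "\<integral>x. x\<^sup>2 \<partial>limit_law"
  have int: "integrable limit_law (\<lambda>x. x)" "integrable limit_law (\<lambda>x. x\<^sup>2)"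
    using limit_law_integrable_power[of 1] limit_law_integrable_power[of 2] by simp_all
  have eq: "(?E + 2) * sqrt u ^ 2 - 3 * sqrt u ^ 3 + sqrt u ^ 4 =
      (\<integral>x. (sqrt u * x + sqrt u * (1 - sqrt u))\<^sup>2 \<partial>limit_law)" for u
  proof -
    have "(sqrt u * x + sqrt u * (1 - sqrt u))\<^sup>2 =
       sqrt u ^ 2 * x\<^sup>2 + 2 * (sqrt u ^ 2 * (1 - sqrt u)) * x + sqrt u ^ 2 * (1 - sqrt u)\<^sup>2" for x
      by (simp only: power2_eq_square) algebra
    then have "(\<integral>x. (sqrt u * x + sqrt u * (1 - sqrt u))\<^sup>2 \<partial>limit_law) =
       sqrt u ^ 2 * ?E + 2 * (sqrt u ^ 2 * (1 - sqrt u)) * (1 / 2) + sqrt u ^ 2 * (1 - sqrt u)\<^sup>2"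
      using int by (simp add: limit_law_mean L.prob_space del: L.space_eq_univ real_sqrt_pow2_iff real_sqrt_pow2)
    moreover have "s\<^sup>2 * e + 2 * (s\<^sup>2 * (1 - s)) * (1 / 2) + s\<^sup>2 * (1 - s)\<^sup>2 =
        (e + 2) * s ^ 2 - 3 * s ^ 3 + s ^ 4" for s e :: real
      by (simp add: power2_eq_square power3_eq_cube power4_eq_xxxx algebra_simps)
    ultimately show ?thesis by metis
  qed
  have "?E = (LBINT u:{0..1}. (\<integral>x. (sqrt u * x + sqrt u * (1 - sqrt u))\<^sup>2 \<partial>limit_law))"
    by (rule limit_law_integral_RDE[where K = 1]) (auto simp: power_le_one)
  also have "\<dots> = (LBINT u:{0..1}. (?E + 2) * sqrt u ^ 2 - 3 * sqrt u ^ 3 + sqrt u ^ 4)"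
    by (simp only: eq)
  also have "\<dots> = (?E + 2) * (2 / (real 2 + 2)) - 3 * (2 / (real 3 + 2)) + 2 / (real 4 + 2)"
    using LBINT_sqrt_power(2)[of 2] LBINT_sqrt_power(2)[of 3] LBINT_sqrt_power(2)[of 4]
    by (simp add: set_integral_diff set_integral_add LBINT_sqrt_power(1)
       del: real_sqrt_pow2_iff real_sqrt_pow2)
  finally have "?E = (?E + 2) / 2 - 3 * (2 / 5) + 1 / 3" by simp
  moreover have "e = 4 / 15" if "e = (e + 2) / 2 - 3 * (2 / 5) + 1 / 3" for e :: real
    using that by (simp add: field_simps)
  ultimately show ?thesis by blast
qed

section \<open>Riemann sums with size-biased weights\<close>

text \<open>The quadratic partition of the unit interval turns \<open>\<integral> g (\<surd>u) du\<close> into a sum with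
  weights \<open>(2l - 1)/m\<^sup>2\<close>, close to the size-biased weights \<open>2c/(m(m - 1))\<close>.\<close>

lemma quadratic_riemann_sum:
  fixes g :: "real \<Rightarrow> real"
  assumes lip: "L-lipschitz_on {0..1} g" and m: "0 < m" and i: "i \<le> m"
  shows "\<bar>integral {0..(real i / real m)\<^sup>2} (\<lambda>u. g (sqrt u)) -
      (\<Sum>l=1..i. (2 * real l - 1) / (real m)\<^sup>2 * g (real l / real m))\<bar> \<le> (real i / real m)\<^sup>2 * (L / real m)"
  using i
proof (induction i)
  case (Suc i)
  let ?a = "(real i / real m)\<^sup>2" and ?b = "(real (Suc i) / real m)\<^sup>2" and ?c = "g (real (Suc i) / real m)"
  let ?G = "\<lambda>u. g (sqrt u)"
  have cont: "continuous_on {0..1} ?G"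
    by (rule continuous_on_compose2[OF lipschitz_on_continuous_on[OF lip]]) (auto intro!: continuous_intros)
  have ab: "0 \<le> ?a" "?a \<le> ?b" "?b \<le> 1"
    using Suc.prems m by (auto simp: power_mono divide_right_mono power_le_one)
  have width: "?b - ?a = (2 * real (Suc i) - 1) / (real m)\<^sup>2"
    by (simp add: power_divide diff_divide_distrib[symmetric] power2_eq_square algebra_simps)
  have int: "?G integrable_on {x..y}" if "0 \<le> x" "y \<le> 1" for x y
    by (rule integrable_continuous_real, rule continuous_on_subset[OF cont]) (use that in auto)
  have split: "integral {0..?b} ?G = integral {0..?a} ?G + integral {?a..?b} ?G"
    using ab int by (subst Henstock_Kurzweil_Integration.integral_combine) auto
  have "\<bar>integral {?a..?b} (\<lambda>u. ?G u - ?c)\<bar> \<le> L / real m * (?b - ?a)"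
    unfolding real_norm_def[symmetric]
  proof (rule integral_bound[OF ab(2)])
    show "continuous_on {?a..?b} (\<lambda>u. ?G u - ?c)"
      by (intro continuous_intros continuous_on_subset[OF cont]) (use ab in auto)
    fix u assume u: "u \<in> {?a..?b}"
    \<comment> \<open>The grid is quadratic so that \<open>sqrt u\<close> varies by at most 1/m on
      every cell, also near 0.\<close>
    have s: "real i / real m \<le> sqrt u" "sqrt u \<le> real (Suc i) / real m"
      using u ab(1) by (auto intro: real_le_rsqrt real_le_lsqrt)
    have "real (Suc i) / real m \<le> 1" using Suc.prems m by simp
    moreover have "0 \<le> u" "u \<le> 1" using u ab(1,3) unfolding atLeastAtMost_iff by linarith+
    ultimately have "norm (?G u - ?c) \<le> L * \<bar>sqrt u - real (Suc i) / real m\<bar>"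
      using lipschitz_onD[OF lip, of "sqrt u" "real (Suc i) / real m"]
      by (auto simp: dist_real_def)
    also have "\<bar>sqrt u - real (Suc i) / real m\<bar> \<le> 1 / real m"
      using s by (simp add: add_divide_distrib abs_if)
    finally show "norm (?G u - ?c) \<le> L / real m"
      using lipschitz_on_nonneg[OF lip] by (simp add: mult_left_mono)
  qed
  moreover have "integral {?a..?b} (\<lambda>u. ?G u - ?c) = integral {?a..?b} ?G - (?b - ?a) * ?c"
    using ab int by (subst Henstock_Kurzweil_Integration.integral_diff) auto
  moreover have "L / real m * (?b - ?a) = ?b * (L / real m) - ?a * (L / real m)"
    by (simp only: right_diff_distrib mult.commute)
  ultimately have "\<bar>integral {?a..?b} ?G - (2 * real (Suc i) - 1) / (real m)\<^sup>2 * ?c\<bar> \<le> ?b * (L / real m) - ?a * (L / real m)"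
    unfolding width[symmetric] by metis
  with Suc.IH Suc.prems show ?case
    unfolding split by simp
qed auto

text \<open>Both families of weights sum to 1, and the size-biased one is the larger at every c < m.
  Their total discrepancy is therefore twice the quadratic weight of the cell l = m, which has no
  size-biased counterpart; that weight (2 m - 1) / m^2 is at most 2/m.\<close>

lemma size_biased_riemann_sum:
  fixes g :: "real \<Rightarrow> real"
  assumes lip: "L-lipschitz_on {0..1} g" and m: "2 \<le> m"
    and K: "\<And>v. 0 \<le> v \<Longrightarrow> v \<le> 1 \<Longrightarrow> \<bar>g v\<bar> \<le> K"
  shows "\<bar>integral {0..1} (\<lambda>u. g (sqrt u)) -
      2 / (real m * (real m - 1)) * (\<Sum>c=1..<m. real c * g (real c / real m))\<bar> \<le> (L + 4 * K) / real m"
proof -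
  let ?g = "\<lambda>l. g (real l / real m)" and ?w = "\<lambda>l. (2 * real l - 1) / (real m)\<^sup>2"
  let ?v = "\<lambda>c. 2 * real c / (real m * (real m - 1))"
  have gK: "\<bar>?g l\<bar> \<le> K" if "l \<le> m" for l using that m by (intro K) auto
  have K0: "0 \<le> K" using gK[of 0] by linarith
  have wv: "?v c - ?w c = (2 * real c + real m - 1) / ((real m)\<^sup>2 * (real m - 1))" for c
    using m by (simp add: field_simps power2_eq_square)
  have wv_nonneg: "0 \<le> ?v c - ?w c" for c
    unfolding wv using m by simp
  have gauss: "(\<Sum>c=1..<m. 2 * real c + real m - 1) = (real m - 1) * (2 * real m - 1)"
  proof -
    have "(\<Sum>c=1..<n. 2 * real c) = real n * (real n - 1)" if "1 \<le> n" for n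
      using that by (induction n rule: dec_induct) (auto simp: algebra_simps)
    then have "(\<Sum>c=1..<m. 2 * real c + (real m - 1)) = real m * (real m - 1) + real (m - 1) * (real m - 1)"
      using m by (subst sum.distrib) simp
    then show ?thesis using m by (simp add: of_nat_diff algebra_simps)
  qed
  have "(\<Sum>l=1..m. ?w l * ?g l) = (\<Sum>l=1..<m. ?w l * ?g l) + ?w m * ?g m"
    using m by (subst sum.last_plus) (auto simp: atLeastLessThanSuc_atLeastAtMost[symmetric] add.commute)
  moreover have "2 / (real m * (real m - 1)) * (\<Sum>c=1..<m. real c * ?g c) = (\<Sum>c=1..<m. ?v c * ?g c)"
    by (simp add: sum_distrib_left mult.assoc)
  ultimately have "\<bar>(\<Sum>l=1..m. ?w l * ?g l) - 2 / (real m * (real m - 1)) * (\<Sum>c=1..<m. real c * ?g c)\<bar> =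
      \<bar>?w m * ?g m - (\<Sum>c=1..<m. (?v c - ?w c) * ?g c)\<bar>"
    by (simp add: sum_subtractf left_diff_distrib)
  also have "\<dots> \<le> \<bar>?w m * ?g m\<bar> + \<bar>\<Sum>c=1..<m. (?v c - ?w c) * ?g c\<bar>" by (rule abs_triangle_ineq4)
  also have "\<dots> \<le> ?w m * K + (\<Sum>c=1..<m. (?v c - ?w c) * K)"
  proof (intro add_mono order_trans[OF sum_abs] sum_mono)
    show "\<bar>?w m * ?g m\<bar> \<le> ?w m * K"
      using gK[of m] m by (simp add: abs_mult mult_left_mono divide_right_mono)
    show "\<bar>(?v c - ?w c) * ?g c\<bar> \<le> (?v c - ?w c) * K" if "c \<in> {1..<m}" for c
      using gK[of c] wv_nonneg[of c] that by (simp only: abs_mult abs_of_nonneg) (intro mult_left_mono, auto)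
  qed
  also have "(\<Sum>c=1..<m. (?v c - ?w c) * K) = ?w m * K"
    unfolding wv sum_distrib_right[symmetric] sum_divide_distrib[symmetric] gauss
    using m by (simp add: field_simps)
  also have "?w m * K + ?w m * K \<le> 4 * K / real m"
  proof -
    have "?w m \<le> 2 / real m" using m by (simp add: field_simps power2_eq_square)
    then have "?w m * K \<le> 2 / real m * K" by (rule mult_right_mono[OF _ K0])
    then have "?w m * K + ?w m * K \<le> 2 / real m * K + 2 / real m * K" by (intro add_mono)
    also have "\<dots> = 4 * K / real m" by (simp add: field_simps)
    finally show ?thesis .
  qed
  finally have "\<bar>(\<Sum>l=1..m. ?w l * ?g l) -
      2 / (real m * (real m - 1)) * (\<Sum>c=1..<m. real c * ?g c)\<bar> \<le> 4 * K / real m" .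
  moreover have "\<bar>integral {0..1} (\<lambda>u. g (sqrt u)) - (\<Sum>l=1..m. ?w l * ?g l)\<bar> \<le> L / real m"
    using quadratic_riemann_sum[OF lip, of m m] m by simp
  ultimately show ?thesis by (simp add: add_divide_distrib)
qed

text \<open>The conditional expectation in the distributional equation, scaled by \<open>m\<close>,
  given sqrt U = v: the limit counterpart of a call that leaves a sub-list of length m v.\<close>

definition limit_step :: "(real \<Rightarrow> real) \<Rightarrow> nat \<Rightarrow> real \<Rightarrow> real" where
  "limit_step f m v = (\<integral>x. f (real m * (v * x + v * (1 - v))) \<partial>limit_law)"

text \<open>As a function of v, \<open>limit_step f m\<close> is 2m-Lipschitz, and after subtraction
  of \<open>f 0\<close> it is bounded by m. The Riemann sum error (2m + 4m) / m is thus the same for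
  all m. The subtraction is harmless since the weights sum to 1; it makes the bound independent of
  the size of \<open>f 0\<close>.\<close>

lemma limit_law_size_biased_sum:
  assumes f: "1-lipschitz_on UNIV f" and m: "2 \<le> m"
  shows "\<bar>(\<integral>x. f (real m * x) \<partial>limit_law) -
      2 / (real m * (real m - 1)) * (\<Sum>c=1..<m. real c * limit_step f m (real c / real m))\<bar> \<le> 6"
proof -
  interpret L: real_distribution limit_law by (rule real_distribution_limit_law)
  note [measurable] = lip1_measurable[OF f]
  define g where "g v = limit_step f m v - f 0" for v
  have affine: "limit_step f m v = (\<integral>x. f ((real m * v) * x + real m * (v * (1 - v))) \<partial>limit_law)" for v
    unfolding limit_step_def by (simp add: algebra_simps)
  have int: "integrable limit_law (\<lambda>x. f (a * x + b))" for a b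
    by (rule limit_law_integrable_lip1[OF f])
  have lip: "(2 * real m)-lipschitz_on {0..1} g"
  proof (rule lipschitz_onI)
    fix v w :: real assume v: "v \<in> {0..1}" and w: "w \<in> {0..1}"
    have "\<bar>g v - g w\<bar> \<le> \<bar>real m * v - real m * w\<bar> + \<bar>real m * (v * (1 - v)) - real m * (w * (1 - w))\<bar>"
      unfolding g_def affine using limit_law_integral_lip1_diff[OF f] by simp
    also have "real m * (v * (1 - v)) - real m * (w * (1 - w)) = (real m * v - real m * w) * (1 - v - w)"
      by algebra
    also have "\<bar>(real m * v - real m * w) * (1 - v - w)\<bar> \<le> \<bar>real m * v - real m * w\<bar> * 1"
      unfolding abs_mult using v w by (intro mult_left_mono) auto
    also have "\<bar>real m * v - real m * w\<bar> = real m * \<bar>v - w\<bar>"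
      by (simp add: right_diff_distrib[symmetric] abs_mult)
    finally show "dist (g v) (g w) \<le> 2 * real m * dist v w" by (simp add: dist_real_def)
  qed simp
  have bound: "\<bar>g v\<bar> \<le> real m" if "0 \<le> v" "v \<le> 1" for v
  proof -
    have "\<bar>limit_step f m v - (\<integral>x. f 0 \<partial>limit_law)\<bar> \<le> real m"
      unfolding affine
    proof (rule limit_law_integral_diff_le)
      fix x :: real assume x: "0 \<le> x" "x \<le> 1"
      have "\<bar>f (real m * v * x + real m * (v * (1 - v))) - f 0\<bar> \<le> \<bar>real m * (v * x + v * (1 - v))\<bar>"
        using lip1D[OF f, of "real m * v * x + real m * (v * (1 - v))" 0] by (simp add: algebra_simps)
      also have "\<dots> = real m * (v * x + v * (1 - v))"
        using convex_step_bounds[OF x that] by (simp add: abs_mult)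
      also have "\<dots> \<le> real m"
        using convex_step_bounds[OF x that] by (simp add: mult_left_le)
      finally show "\<bar>f (real m * v * x + real m * (v * (1 - v))) - f 0\<bar> \<le> real m" .
    qed (use int in auto)
    then show ?thesis by (simp add: g_def L.prob_space del: L.space_eq_univ)
  qed
  have "(\<integral>x. f (real m * x) \<partial>limit_law) = (LBINT u:{0..1}. limit_step f m (sqrt u))"
    unfolding limit_step_def
  proof (rule limit_law_integral_RDE)
    fix x :: real assume x: "0 \<le> x" "x \<le> 1"
    then have "0 \<le> real m * x" "real m * x \<le> real m" by (auto simp: mult_left_le)
    then show "\<bar>f (real m * x)\<bar> \<le> \<bar>f 0\<bar> + real m" using lip1D[OF f, of "real m * x" 0] by linarith
  qed measurable
  also have "\<dots> = integral {0..1} (\<lambda>u. limit_step f m (sqrt u))"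
  proof (rule set_borel_integral_eq_integral)
    have "continuous_on {0..1} (\<lambda>u. g (sqrt u))"
      by (rule continuous_on_compose2[OF lipschitz_on_continuous_on[OF lip]]) (auto intro!: continuous_intros)
    then have "continuous_on {0..1} (\<lambda>u. g (sqrt u) + f 0)" by (intro continuous_intros)
    then show "set_integrable lborel {0..1} (\<lambda>u. limit_step f m (sqrt u))"
      unfolding set_integrable_def g_def by (intro borel_integrable_compact) auto
  qed
  also have "\<dots> = integral {0..1} (\<lambda>u. g (sqrt u)) + f 0"
  proof -
    have cont: "continuous_on {0..1} (\<lambda>u. g (sqrt u))"
      by (rule continuous_on_compose2[OF lipschitz_on_continuous_on[OF lip]]) (auto intro!: continuous_intros)
    have "integral {0..1} (\<lambda>u. g (sqrt u) + f 0) = integral {0..1} (\<lambda>u. g (sqrt u)) + integral {0..1::real} (\<lambda>u. f 0)"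
      using cont by (intro Henstock_Kurzweil_Integration.integral_add integrable_continuous_real) auto
    then show ?thesis by (simp add: g_def)
  qed
  finally have "(\<integral>x. f (real m * x) \<partial>limit_law) = integral {0..1} (\<lambda>u. g (sqrt u)) + f 0" .
  moreover have "2 / (real m * (real m - 1)) * (\<Sum>c=1..<m. real c * limit_step f m (real c / real m)) =
      2 / (real m * (real m - 1)) * (\<Sum>c=1..<m. real c * g (real c / real m)) + f 0"
  proof -
    have "(\<Sum>c=1..<n. real c) = real n * (real n - 1) / 2" if "1 \<le> n" for n
      using that by (induction n rule: dec_induct) (auto simp: field_simps)
    then have "(\<Sum>c=1..<m. real c * f 0) = real m * (real m - 1) / 2 * f 0"
      using m by (simp add: sum_distrib_right[symmetric])
    moreover have "(\<Sum>c=1..<m. real c * limit_step f m (real c / real m)) =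
        (\<Sum>c=1..<m. real c * g (real c / real m)) + (\<Sum>c=1..<m. real c * f 0)"
      by (simp add: g_def sum.distrib[symmetric] algebra_simps)
    ultimately show ?thesis using m by (simp add: field_simps)
  qed
  moreover have "(2 * real m + 4 * real m) / real m = 6" using m by simp
  ultimately show ?thesis
    using size_biased_riemann_sum[OF lip m bound] by simp
qed

section \<open>Partitioning\<close>

text \<open>The key at position \<open>l\<close> is a sentinel: it makes the scan stop at a genuine
  key that passes the test. Positions \<open>l\<close> and \<open>j\<close> count from 1 while
  \<open>q\<close> is a list index, hence the \<open>q + 1\<close>.\<close>

lemma scan_down_spec:
  assumes "l < j" "1 \<le> l" "A ! (l - 1) \<le> p"
  shows "l \<le> scan_down p A j \<and> A ! (scan_down p A j - 1) \<le> p \<and>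
         (\<forall>q. scan_down p A j \<le> q \<longrightarrow> q + 1 < j \<longrightarrow> p < A ! q)"
  using assms
proof (induction p A j rule: scan_down.induct)
  case (2 p A j)
  show ?case
  proof (cases "j = 0 \<or> A ! (j - 1) \<le> p")
    case True
    then show ?thesis using 2 by auto
  next
    case False
    then have "l \<noteq> j" using 2 by auto
    then have "l < j" using 2 by auto
    have eq: "scan_down p A (Suc j) = scan_down p A j" using False by auto
    have "p < A ! q" if "scan_down p A j \<le> q" "q + 1 < Suc j" for q
      using 2(1)[OF False \<open>l < j\<close> 2(3,4)] False that by (cases "q = j - 1") (auto simp: not_le)
    then show ?thesis using 2(1)[OF False \<open>l < j\<close> 2(3,4)] unfolding eq by simp
  qed
qed auto

lemma scan_up_spec:
  assumes "i < l" "l \<le> length A" "p \<le> A ! (l - 1)"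
  shows "scan_up p A i \<le> l \<and> p \<le> A ! (scan_up p A i - 1) \<and>
         (\<forall>q. i \<le> q \<longrightarrow> q + 1 < scan_up p A i \<longrightarrow> A ! q < p)"
  using assms
proof (induction p A i rule: scan_up.induct)
  case (1 p A i)
  show ?case
  proof (cases "i + 1 > length A \<or> A ! i \<ge> p")
    case True
    then show ?thesis using 1 by (auto simp: scan_up.simps[of p A i])
  next
    case False
    then have "l \<noteq> i + 1" using 1 by auto
    then have "i + 1 < l" using 1 by auto
    have eq: "scan_up p A i = scan_up p A (i + 1)" using False by (simp add: scan_up.simps[of p A i])
    have "A ! q < p" if "i \<le> q" "q + 1 < scan_up p A i" for q
      using 1(1)[OF False \<open>i + 1 < l\<close> 1(3,4)] False that unfolding eq
      by (cases "q = i") (auto simp: not_le)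
    then show ?thesis using 1(1)[OF False \<open>i + 1 < l\<close> 1(3,4)] unfolding eq by simp
  qed
qed

text \<open>The premises are the loop invariant as it stands after the first exchange: keys below
  the pivot before \<open>i\<close>, keys at least the pivot from index \<open>j - 1\<close> on, and
  the pivot itself not in between. Each further exchange then removes exactly one index from the set
  of misplaced large keys among the first \<open>c\<close> positions, which explains the formula for
  \<open>k\<close>.\<close>

lemma hoare_loop_spec:
  assumes "hoare_loop p A i j = (B, c, k)" "1 \<le> i" "i < j" "j \<le> length A"
    and "\<And>l. l < i \<Longrightarrow> A ! l < p"
    and "\<And>l. j - 1 \<le> l \<Longrightarrow> l < length A \<Longrightarrow> p \<le> A ! l"
    and "\<And>l. i \<le> l \<Longrightarrow> l < j - 1 \<Longrightarrow> A ! l \<noteq> p"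
  shows "mset B = mset A \<and> i \<le> c \<and> c < j \<and> (\<forall>l<c. B ! l < p) \<and>
         (\<forall>l. c \<le> l \<longrightarrow> l < length A \<longrightarrow> p \<le> B ! l) \<and> k = card {l. l < c \<and> p \<le> A ! l}"
  using assms
proof (induction p A i j arbitrary: B c k rule: hoare_loop.induct)
  case (1 p A i j)
  define j' where "j' = scan_down p A j"
  define i' where "i' = scan_up p A i"
  have "A ! (i - 1) \<le> p" using "1.prems"(2) "1.prems"(5)[of "i - 1"] by simp
  then have j': "i \<le> j'" "A ! (j' - 1) \<le> p" "\<And>q. j' \<le> q \<Longrightarrow> q + 1 < j \<Longrightarrow> p < A ! q"
    using scan_down_spec[of i j A p] "1.prems"(2,3) unfolding j'_def by auto
  have j'_less: "j' < j" using scan_down_le[of p A j] "1.prems"(2,3) unfolding j'_def by simp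
  have "p \<le> A ! (j - 1)" using "1.prems"(2,3,4) "1.prems"(6)[of "j - 1"] by simp
  then have i': "i' \<le> j" "p \<le> A ! (i' - 1)" "\<And>q. i \<le> q \<Longrightarrow> q + 1 < i' \<Longrightarrow> A ! q < p"
    using scan_up_spec[of i j A p] "1.prems"(3,4) unfolding i'_def by auto
  have i_less: "i < i'" using scan_up_gt[of i p A] unfolding i'_def by simp
  \<comment> \<open>Strictness excludes \<open>i' = j'\<close> and restores the strict half of the
    invariant after an exchange.\<close>
  have j'_small: "A ! (j' - 1) < p"
  proof (cases "j' = i")
    case True
    then show ?thesis using "1.prems"(2) "1.prems"(5)[of "j' - 1"] by simp
  next
    case False
    then have "A ! (j' - 1) \<noteq> p" using j'(1) j'_less by (intro "1.prems"(7)) auto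
    then show ?thesis using j'(2) by (simp add: less_le)
  qed
  have low: "A ! l < p" if "l + 1 < i'" for l
    using that "1.prems"(5)[of l] i'(3)[of l] by (cases "l < i") auto
  have high: "p \<le> A ! l" if "j' \<le> l" "l < length A" for l
    using that "1.prems"(6)[of l] j'(3)[of l] by (cases "l + 1 < j") auto
  show ?case
  proof (cases "i' < j'")
    case True
    define A' where "A' = A[i' - 1 := A ! (j' - 1), j' - 1 := A ! (i' - 1)]"
    obtain B' m' k' where rec: "hoare_loop p A' i' j' = (B', m', k')"
      by (metis prod_cases3)
    have "hoare_loop p A i j = (B', m', Suc k')"
      using True rec
      by (subst hoare_loop.simps) (simp add: Let_def i'_def[symmetric] j'_def[symmetric] A'_def)
    then have eq: "B = B'" "c = m'" "k = Suc k'" using "1.prems"(1) by auto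
    have bnd: "i' - 1 < length A" "j' - 1 < length A" "i' - 1 < j' - 1" "1 \<le> i'" "j' \<le> length A"
      using True i_less "1.prems"(4) j'_less by auto
    have nth: "A' ! l = (if l = j' - 1 then A ! (i' - 1) else if l = i' - 1 then A ! (j' - 1) else A ! l)" for l
      using bnd by (auto simp: A'_def nth_list_update)
    have lenA': "length A' = length A" by (simp add: A'_def)
    have IH: "mset B' = mset A' \<and> i' \<le> m' \<and> m' < j' \<and> (\<forall>l<m'. B' ! l < p) \<and>
         (\<forall>l. m' \<le> l \<longrightarrow> l < length A' \<longrightarrow> p \<le> B' ! l) \<and> k' = card {l. l < m' \<and> p \<le> A' ! l}"
    proof (rule "1.IH"[OF j'_def i'_def True rec[unfolded A'_def], folded A'_def])
      show "1 \<le> i'" using bnd by simp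
      show "i' < j'" by fact
      show "j' \<le> length A'" using bnd by (simp add: A'_def)
      show "A' ! l < p" if "l < i'" for l
        using that low[of l] j'_small bnd by (auto simp: nth)
      show "p \<le> A' ! l" if "j' - 1 \<le> l" "l < length A'" for l
        using that high[of l] i'(2) bnd by (auto simp: nth lenA')
      show "A' ! l \<noteq> p" if "i' \<le> l" "l < j' - 1" for l
        using that "1.prems"(7)[of l] i_less j'_less by (auto simp: nth)
    qed
    have "{l. l < m' \<and> p \<le> A ! l} = insert (i' - 1) {l. l < m' \<and> p \<le> A' ! l}"
      using IH i'(2) j'_small bnd by (auto simp: nth)
    moreover have "i' - 1 \<notin> {l. l < m' \<and> p \<le> A' ! l}"
      using j'_small bnd by (auto simp: nth)
    ultimately have "card {l. l < m' \<and> p \<le> A ! l} = Suc (card {l. l < m' \<and> p \<le> A' ! l})"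
      by simp
    moreover have "mset A' = mset A"
      unfolding A'_def by (rule mset_swap) (use bnd in auto)
    ultimately show ?thesis
      using IH i_less j'_less unfolding eq by (auto simp: A'_def)
  next
    case False
    then have "hoare_loop p A i j = (A, j', 0)"
      by (subst hoare_loop.simps) (simp add: Let_def i'_def[symmetric] j'_def[symmetric])
    then have eq: "B = A" "c = j'" "k = 0" using "1.prems"(1) by auto
    have "i' \<noteq> j'" using j'_small i'(2) by auto
    then have "j' < i'" using False by simp
    then have "\<forall>l<j'. A ! l < p" using low by auto
    then have "{l. l < j' \<and> p \<le> A ! l} = {}" by (auto dest: leD)
    then show ?thesis using \<open>\<forall>l<j'. A ! l < p\<close> j'(1) j'_less high unfolding eq by simp
  qed
qed

text \<open>A key below the pivot stops the downward scan to the right of position 1, while the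
  upward scan stops at the pivot. So a first exchange takes place; it moves the pivot to the right
  end of the remaining range and establishes the invariant of \<open>hoare_loop_spec\<close>. In the
  formula for \<open>k\<close> this exchange is the index 0.\<close>

lemma hoare_partition_spec:
  assumes "hoare_partition A = (B, c, k)" "distinct A" "x \<in> set A" "x < A ! 0"
  shows "mset B = mset A" "c = card {l. l < length A \<and> A ! l < A ! 0}"
    "\<And>l. l < c \<Longrightarrow> B ! l < A ! 0" "\<And>l. c \<le> l \<Longrightarrow> l < length A \<Longrightarrow> A ! 0 \<le> B ! l"
    "k = card {l. l < c \<and> A ! 0 \<le> A ! l}" "1 \<le> c" "c < length A"
proof -
  define p where "p = A ! 0"
  define n where "n = length A"
  obtain lx where lx: "lx < n" "A ! lx = x" using assms(3) by (auto simp: n_def in_set_conv_nth)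
  have lx0: "lx \<noteq> 0" using lx assms(4) by (metis less_irrefl)
  define j where "j = scan_down p A (Suc n)"
  have up: "scan_up p A 0 = 1" using lx(1) by (subst scan_up.simps) (simp add: p_def n_def)
  have j: "lx + 1 \<le> j" "A ! (j - 1) \<le> p" "\<And>q. j \<le> q \<Longrightarrow> q < n \<Longrightarrow> p < A ! q"
    using scan_down_spec[of "lx + 1" "Suc n" A p] lx lx0 assms(4) unfolding j_def p_def by auto
  have jn: "j \<le> n" using scan_down_le[of p A "Suc n"] unfolding j_def by simp
  have inj: "A ! l \<noteq> p" if "l < n" "l \<noteq> 0" for l
    using that assms(2) unfolding p_def n_def by (subst nth_eq_iff_index_eq) auto
  define A' where "A' = A[0 := A ! (j - 1), j - 1 := p]"
  have j1: "1 < j" using j(1) lx0 by simp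
  obtain B' m' k' where rec: "hoare_loop p A' 1 j = (B', m', k')" by (metis prod_cases3)
  have "hoare_partition A = hoare_loop p A 0 (n + 1)"
    by (simp add: hoare_partition_def p_def n_def)
  also have "\<dots> = (B', m', Suc k')"
    using j1 rec by (subst hoare_loop.simps) (simp add: Let_def up j_def[symmetric] A'_def p_def[symmetric] del: scan_down.simps)
  finally have eq: "B = B'" "c = m'" "k = Suc k'" using assms(1) by auto
  have nth: "A' ! l = (if l = j - 1 then p else if l = 0 then A ! (j - 1) else A ! l)" for l
  proof -
    have "A \<noteq> []" using j1 jn by (auto simp: n_def)
    then show ?thesis using j1 jn by (auto simp: A'_def nth_list_update n_def)
  qed
  have len: "length A' = n" by (simp add: A'_def n_def)
  have small: "A ! (j - 1) < p" proof -
    have "A ! (j - 1) \<noteq> p" using j1 jn by (intro inj) auto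
    then show ?thesis using j(2) by (simp add: less_le)
  qed
  have S: "mset B' = mset A' \<and> 1 \<le> m' \<and> m' < j \<and> (\<forall>l<m'. B' ! l < p) \<and>
         (\<forall>l. m' \<le> l \<longrightarrow> l < length A' \<longrightarrow> p \<le> B' ! l) \<and> k' = card {l. l < m' \<and> p \<le> A' ! l}"
  proof (rule hoare_loop_spec[OF rec])
    show "1 < j" by fact
    show "j \<le> length A'" using jn by (simp add: len)
    show "A' ! l < p" if "l < 1" for l using that small j1 by (simp add: nth)
    show "p \<le> A' ! l" if "j - 1 \<le> l" "l < length A'" for l
      using that j(3)[of l] j1 by (cases "l = j - 1") (auto simp: nth len less_imp_le)
    show "A' ! l \<noteq> p" if "1 \<le> l" "l < j - 1" for l
    proof -
      have "A ! l \<noteq> p" using that jn by (intro inj) auto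
      then show ?thesis using that by (simp add: nth)
    qed
  qed simp
  have mA: "mset A' = mset A"
  proof -
    have "0 < length A" "j - 1 < length A" using j1 jn by (auto simp: n_def)
    from mset_swap[OF this(2,1)] show ?thesis by (simp add: A'_def p_def)
  qed
  show mB: "mset B = mset A" using S mA eq by simp
  then have lB: "length B = n" unfolding n_def by (metis size_mset)
  show "\<And>l. l < c \<Longrightarrow> B ! l < A ! 0" using S eq p_def by auto
  show "\<And>l. c \<le> l \<Longrightarrow> l < length A \<Longrightarrow> A ! 0 \<le> B ! l" using S eq p_def len n_def by auto
  show "1 \<le> c" using S eq by auto
  show cn: "c < length A" using S eq jn n_def by auto
  have "card {l. l < length A \<and> A ! l < p} = length (filter (\<lambda>x. x < p) A)"
    by (simp add: length_filter_conv_card)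
  also have "\<dots> = length (filter (\<lambda>x. x < p) B)"
    using mB by (metis mset_filter size_mset)
  also have "\<dots> = card {l. l < n \<and> B ! l < p}"
    by (simp add: length_filter_conv_card lB)
  also have "{l. l < n \<and> B ! l < p} = {..<c}"
    using S eq len cn n_def by (auto dest: leD) (meson leD leI)
  finally show "c = card {l. l < length A \<and> A ! l < A ! 0}" by (simp add: p_def)
  have "{l. l < m' \<and> p \<le> A ! l} = insert 0 {l. l < m' \<and> p \<le> A' ! l}"
    using S small by (auto simp: nth p_def)
  moreover have "0 \<notin> {l. l < m' \<and> p \<le> A' ! l}" using small j1 by (auto simp: nth)
  ultimately show "k = card {l. l < c \<and> A ! 0 \<le> A ! l}" using S eq by (simp add: p_def)
qed

text \<open>The complementary case: both scans stop at the head, so the call only splits off the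
  minimum.\<close>

lemma hoare_partition_min:
  assumes "A \<noteq> []" "\<And>l. 0 < l \<Longrightarrow> l < length A \<Longrightarrow> A ! 0 < A ! l"
  shows "hoare_partition A = (A, 1, 0)"
proof -
  define j where "j = scan_down (A ! 0) A (length A + 1)"
  have "1 < length A + 1" using assms(1) by (cases A) auto
  then have j: "1 \<le> j" "A ! (j - 1) \<le> A ! 0"
    using scan_down_spec[of 1 "length A + 1" A "A ! 0"] unfolding j_def by auto
  have "j \<le> length A" using scan_down_le[of "A ! 0" A "length A + 1"] unfolding j_def by simp
  have "\<not> 1 < j"
  proof
    assume "1 < j"
    then have "A ! 0 < A ! (j - 1)" using \<open>j \<le> length A\<close> by (intro assms(2)) auto
    then show False using j(2) by simp
  qed
  with j have "j = 1" by simp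
  moreover have "scan_up (A ! 0) A 0 = 1"
    using assms(1) by (subst scan_up.simps) auto
  ultimately show ?thesis
    unfolding hoare_partition_def by (subst hoare_loop.simps) (simp add: Let_def j_def)
qed

section \<open>Partitioning depends only on comparisons with the pivot\<close>

lemma scan_down_cong:
  assumes "\<And>l. l < length A \<Longrightarrow> A ! l \<le> p \<longleftrightarrow> A' ! l \<le> p'" "j \<le> length A + 1"
  shows "scan_down p A j = scan_down p' A' j"
  using assms(2) by (induction j) (auto simp: assms(1))

lemma scan_up_cong:
  assumes "\<And>l. l < length A \<Longrightarrow> p \<le> A ! l \<longleftrightarrow> p' \<le> A' ! l" "length A = length A'"
  shows "scan_up p A i = scan_up p' A' i"
proof (induction "length A - i" arbitrary: i)
  case 0
  then show ?case using assms(2) by (simp add: scan_up.simps)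
next
  case (Suc d)
  then have "scan_up p A (i + 1) = scan_up p' A' (i + 1)" by simp
  then show ?case using assms Suc(2)
    by (subst (1 2) scan_up.simps) auto
qed

text \<open>For \<open>C = [0..<length A]\<close> and \<open>\<phi> = (!) A\<close> the list \<open>D\<close> is the rearrangement of positions performed
  by the partitioning of \<open>A\<close>.\<close>

lemma hoare_loop_oblivious:
  fixes lo hi :: "'i \<Rightarrow> bool" and C :: "'i list"
  assumes "j \<le> length C + 1"
  shows "\<exists>D m k. mset D = mset C \<and>
     (\<forall>(p::'a::linorder) \<phi>. (\<forall>x\<in>set C. (\<phi> x \<le> p \<longleftrightarrow> lo x) \<and> (p \<le> \<phi> x \<longleftrightarrow> hi x)) \<longrightarrow>
        hoare_loop p (map \<phi> C) i j = (map \<phi> D, m, k))"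
  using assms
proof (induction j arbitrary: C i rule: less_induct)
  case (less j)
  let ?ok = "\<lambda>p (\<phi>::'i \<Rightarrow> 'a). \<forall>x\<in>set C. (\<phi> x \<le> p \<longleftrightarrow> lo x) \<and> (p \<le> \<phi> x \<longleftrightarrow> hi x)"
  show ?case
  proof (cases "\<exists>(p::'a) \<phi>. ?ok p \<phi>")
    case False
    then show ?thesis by (intro exI[of _ C] exI[of _ 0]) blast
  next
    case True
    then obtain p0 :: 'a and \<phi>0 where ok0: "?ok p0 \<phi>0" by blast
    \<comment> \<open>All admissible pairs of pivot and labelling produce the same scan positions,
      so one reference pair determines them; without any such pair the claim is vacuous.\<close>
    define j' where "j' = scan_down p0 (map \<phi>0 C) j"
    define i' where "i' = scan_up p0 (map \<phi>0 C) i"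
    have j': "scan_down p (map \<phi> C) j = j'" if "?ok p \<phi>" for p \<phi>
      unfolding j'_def using that ok0 less(2) by (intro scan_down_cong) auto
    have i': "scan_up p (map \<phi> C) i = i'" if "?ok p \<phi>" for p \<phi>
      unfolding i'_def using that ok0 by (intro scan_up_cong) auto
    show ?thesis
    proof (cases "i' < j'")
      case False
      then have "hoare_loop p (map \<phi> C) i j = (map \<phi> C, j', 0)" if "?ok p \<phi>" for p \<phi>
        using that by (subst hoare_loop.simps) (simp add: j' i' Let_def)
      then show ?thesis by (intro exI[of _ C]) auto
    next
      case True
      have jj: "j' < j" "1 \<le> i'"
        using scan_down_le[of p0 "map \<phi>0 C" j] scan_up_gt[of i p0 "map \<phi>0 C"] True
        unfolding j'_def[symmetric] i'_def[symmetric] by auto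
      define C' where "C' = C[i' - 1 := C ! (j' - 1), j' - 1 := C ! (i' - 1)]"
      have bnd: "i' - 1 < length C" "j' - 1 < length C" using True jj less(2) by auto
      have mC: "mset C' = mset C" unfolding C'_def by (rule mset_swap) fact+
      then have sC: "set C' = set C" by (metis set_mset_mset)
      have "j' \<le> length C' + 1" using jj less(2) by (simp add: C'_def)
      from less(1)[OF jj(1) this, of i'] obtain D m k where D: "mset D = mset C'"
        "\<And>(p::'a) \<phi>. ?ok p \<phi> \<Longrightarrow> hoare_loop p (map \<phi> C') i' j' = (map \<phi> D, m, k)"
        unfolding sC by blast
      have "hoare_loop p (map \<phi> C) i j = (map \<phi> D, m, Suc k)" if "?ok p \<phi>" for p \<phi>
      proof -
        have "(map \<phi> C)[i' - 1 := map \<phi> C ! (j' - 1), j' - 1 := map \<phi> C ! (i' - 1)] = map \<phi> C'"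
          unfolding C'_def using bnd by (simp add: map_update)
        then show ?thesis using True that D(2)[OF that]
          by (subst hoare_loop.simps) (simp add: j' i' Let_def)
      qed
      then show ?thesis using D(1) mC by (intro exI[of _ D] exI[of _ m] exI[of _ "Suc k"]) auto
    qed
  qed
qed

section \<open>Random lists with a prescribed position of the minimum\<close>

definition min_at :: "'a::linorder set \<Rightarrow> nat \<Rightarrow> 'a list set" where
  "min_at S t = {A \<in> permutations_of_set S. A ! t = Min S}"

definition rank_avg :: "(real \<Rightarrow> real) \<Rightarrow> 'a::linorder list \<Rightarrow> real" where
  "rank_avg f A = (\<Sum>r=1..length A. f (real (quickselect_exchanges A r))) / real (length A)"

text \<open>The involution behind the exchangeability arguments: transposing two positions other
  than \<open>t\<close> preserves \<open>min_at S t\<close>.\<close>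

definition swap_pos :: "nat \<Rightarrow> nat \<Rightarrow> 'a list \<Rightarrow> 'a list" where
  "swap_pos a b A = A[a := A ! b, b := A ! a]"

lemma min_at_iff: "A \<in> min_at S t \<longleftrightarrow> set A = S \<and> distinct A \<and> A ! t = Min S"
  by (auto simp: min_at_def permutations_of_set_def)

lemma length_min_at: "A \<in> min_at S t \<Longrightarrow> length A = card S"
  by (auto simp: min_at_iff distinct_card)

lemma finite_min_at: "finite S \<Longrightarrow> finite (min_at S t)"
  by (simp add: min_at_def)

lemma swap_pos_nth:
  assumes "a < length A" "b < length A"
  shows "swap_pos a b A ! l = (if l = a then A ! b else if l = b then A ! a else A ! l)"
  using assms by (auto simp: swap_pos_def nth_list_update)

lemma length_swap_pos [simp]: "length (swap_pos a b A) = length A"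
  by (simp add: swap_pos_def)

lemma swap_pos_swap_pos:
  assumes "a < length A" "b < length A"
  shows "swap_pos a b (swap_pos a b A) = A"
  by (rule nth_equalityI) (use assms in \<open>auto simp: swap_pos_nth\<close>)

lemma swap_pos_min_at:
  assumes "A \<in> min_at S t" "a < card S" "b < card S" "a \<noteq> t" "b \<noteq> t"
  shows "swap_pos a b A \<in> min_at S t"
proof -
  have len: "a < length A" "b < length A" using assms by (auto simp: length_min_at)
  have m: "mset (swap_pos a b A) = mset A"
    unfolding swap_pos_def by (rule mset_swap[OF len(2,1)])
  then have "set (swap_pos a b A) = set A" "distinct (swap_pos a b A) = distinct A"
    by (metis set_mset_mset, metis mset_eq_imp_distinct_iff)
  then show ?thesis using assms len by (auto simp: min_at_iff swap_pos_nth)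
qed

lemma sum_swap_pos:
  assumes "\<And>A. A \<in> \<A> \<Longrightarrow> swap_pos a b A \<in> \<A>" "\<And>A. A \<in> \<A> \<Longrightarrow> a < length A \<and> b < length A"
  shows "(\<Sum>A\<in>\<A>. G (swap_pos a b A)) = (\<Sum>A\<in>\<A>. G A)"
  by (rule sum.reindex_bij_witness[where i = "swap_pos a b" and j = "swap_pos a b"])
     (auto simp: swap_pos_swap_pos assms)

section \<open>Uniformity of the pivot\<close>

abbreviation rank_in :: "'a::linorder set \<Rightarrow> 'a \<Rightarrow> nat" where
  "rank_in S x \<equiv> card {y \<in> S. y < x}"

lemma bij_betw_rank_in:
  assumes "finite S"
  shows "bij_betw (rank_in S) S {..<card S}"
proof -
  have mono: "rank_in S x < rank_in S y" if "x \<in> S" "x < y" for x y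
    using assms that by (intro psubset_card_mono) auto
  have inj: "inj_on (rank_in S) S"
    by (intro linorder_inj_onI') (use mono in \<open>force\<close>)
  have "rank_in S ` S \<subseteq> {..<card S}"
    using assms by (auto intro!: psubset_card_mono)
  then have "rank_in S ` S = {..<card S}"
    using inj assms by (intro card_subset_eq) (auto simp: card_image)
  then show ?thesis using inj by (simp add: bij_betw_def)
qed

lemma rank_in_Min: "finite S \<Longrightarrow> S \<noteq> {} \<Longrightarrow> rank_in S (Min S) = 0"
  by (auto simp: not_less)

lemma bij_betw_rank_in_nonmin:
  assumes "finite S" "S \<noteq> {}"
  shows "bij_betw (rank_in S) (S - {Min S}) {1..<card S}"
proof -
  have "bij_betw (rank_in S) (S - {Min S}) ({..<card S} - {0})"
  proof (rule bij_betw_DiffI[OF bij_betw_rank_in[OF assms(1)]])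
    show "bij_betw (rank_in S) {Min S} {0}"
      unfolding bij_betw_def using rank_in_Min[OF assms] by (auto simp del: Min_gr_iff)
  qed (use assms in \<open>auto simp: card_gt_0_iff\<close>)
  moreover have "{..<card S} - {0} = {1..<card S}" by auto
  ultimately show ?thesis by simp
qed

lemma head_min_at:
  assumes "A \<in> min_at S t" "finite S" "0 < t" "t < card S"
  shows "A ! 0 \<in> S - {Min S}"
proof -
  have l: "length A = card S" by (rule length_min_at[OF assms(1)])
  have d: "distinct A" "set A = S" "A ! t = Min S" using assms(1) by (auto simp: min_at_iff)
  have "A ! 0 \<in> S" using nth_mem[of 0 A] d l assms(4) by auto
  moreover have "A ! 0 \<noteq> A ! t" using d l assms(3,4) by (subst nth_eq_iff_index_eq) auto
  ultimately show ?thesis using d by auto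
qed

text \<open>Double counting: transposing positions 0 and l shows that \<open>p\<close> occurs
  equally often at each of the \<open>card S - 1\<close> positions other than \<open>t\<close>, and
  every list has it at exactly one of them.\<close>

lemma card_min_at_pivot:
  assumes "finite S" "0 < t" "t < card S" "p \<in> S - {Min S}"
  shows "real (card {A \<in> min_at S t. A ! 0 = p}) * (real (card S) - 1) = real (card (min_at S t))"
proof -
  let ?L = "min_at S t" and ?Q = "{..<card S} - {t}"
  have fin: "finite ?L" by (rule finite_min_at) fact
  have same: "(\<Sum>A\<in>?L. of_bool (A ! l = p)) = (\<Sum>A\<in>?L. of_bool (A ! 0 = p) :: real)" if "l \<in> ?Q" for l
  proof -
    have "(\<Sum>A\<in>?L. of_bool (swap_pos 0 l A ! 0 = p)) = (\<Sum>A\<in>?L. of_bool (A ! 0 = p) :: real)"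
      by (rule sum_swap_pos[where G = "\<lambda>A. of_bool (A ! 0 = p)"])
         (use that assms in \<open>auto simp: length_min_at intro!: swap_pos_min_at\<close>)
    moreover have "swap_pos 0 l A ! 0 = A ! l" if "A \<in> ?L" for A
      using that \<open>l \<in> ?Q\<close> by (subst swap_pos_nth) (auto simp: length_min_at)
    ultimately show ?thesis by simp
  qed
  have one: "(\<Sum>l\<in>?Q. of_bool (A ! l = p)) = (1::real)" if A: "A \<in> ?L" for A
  proof -
    have d: "distinct A" "set A = S" "length A = card S" "A ! t = Min S"
      using A by (auto simp: min_at_iff length_min_at)
    then obtain l where l: "l < card S" "A ! l = p"
      using assms(4) by (metis DiffD1 in_set_conv_nth)
    then have "l \<in> ?Q" using d assms(4) by auto
    have "(\<Sum>l'\<in>?Q. of_bool (A ! l' = p)) = (\<Sum>l'\<in>?Q. if l' = l then 1 else (0::real))"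
      using l d by (intro sum.cong) (auto simp: nth_eq_iff_index_eq)
    then show ?thesis using \<open>l \<in> ?Q\<close> by simp
  qed
  have "real (card ?L) = (\<Sum>A\<in>?L. \<Sum>l\<in>?Q. of_bool (A ! l = p))"
  proof -
    have "real (card ?L) = (\<Sum>A\<in>?L. 1)" by simp
    also have "\<dots> = (\<Sum>A\<in>?L. \<Sum>l\<in>?Q. of_bool (A ! l = p))" by (intro sum.cong refl one[symmetric])
    finally show ?thesis .
  qed
  also have "\<dots> = (\<Sum>l\<in>?Q. \<Sum>A\<in>?L. of_bool (A ! l = p))" by (rule sum.swap)
  also have "\<dots> = (\<Sum>l\<in>?Q. \<Sum>A\<in>?L. of_bool (A ! 0 = p))" by (intro sum.cong same refl)
  also have "(\<Sum>A\<in>?L. of_bool (A ! 0 = p)) = real (card {A \<in> ?L. A ! 0 = p})"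
    using fin by (simp add: sum.If_cases Int_def of_bool_def)
  finally show ?thesis using assms by (simp add: of_nat_diff)
qed

lemma sum_min_at_pivot_rank:
  assumes "finite S" "0 < t" "t < card S"
  shows "(\<Sum>A\<in>min_at S t. h (rank_in S (A ! 0))) =
     real (card (min_at S t)) / (real (card S) - 1) * (\<Sum>c=1..<card S. h c)"
proof -
  let ?L = "min_at S t" and ?T = "S - {Min S}"
  have fin: "finite ?L" by (rule finite_min_at) fact
  have ne: "S \<noteq> {}" using assms by auto
  have m: "real (card S) - 1 > 0" using assms by simp
  have "(\<Sum>A\<in>?L. h (rank_in S (A ! 0))) = (\<Sum>p\<in>?T. \<Sum>A\<in>{A \<in> ?L. A ! 0 = p}. h (rank_in S (A ! 0)))"
    by (rule sum.group[symmetric]) (use fin assms head_min_at in auto)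
  also have "\<dots> = (\<Sum>p\<in>?T. real (card ?L) / (real (card S) - 1) * h (rank_in S p))"
  proof (intro sum.cong refl)
    fix p assume p: "p \<in> ?T"
    have "(\<Sum>A\<in>{A \<in> ?L. A ! 0 = p}. h (rank_in S (A ! 0))) = real (card {A \<in> ?L. A ! 0 = p}) * h (rank_in S p)"
      by simp
    also have "real (card {A \<in> ?L. A ! 0 = p}) = real (card ?L) / (real (card S) - 1)"
      using card_min_at_pivot[OF assms p] m by (simp add: field_simps)
    finally show "(\<Sum>A\<in>{A \<in> ?L. A ! 0 = p}. h (rank_in S (A ! 0))) =
        real (card ?L) / (real (card S) - 1) * h (rank_in S p)" .
  qed
  also have "\<dots> = real (card ?L) / (real (card S) - 1) * (\<Sum>p\<in>?T. h (rank_in S p))"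
    by (simp add: sum_distrib_left)
  also have "(\<Sum>p\<in>?T. h (rank_in S p)) = (\<Sum>c=1..<card S. h c)"
    by (rule sum.reindex_bij_betw[OF bij_betw_rank_in_nonmin]) (use assms ne in auto)
  finally show ?thesis .
qed

section \<open>Concentration of the number of exchanges\<close>

text \<open>Exchangeability of summands with vanishing total makes all covariances nonpositive.\<close>

lemma exchangeable_second_moment:
  fixes y :: "'b \<Rightarrow> nat \<Rightarrow> real"
  assumes fin: "finite Q" "D \<subseteq> Q"
    and zero: "\<And>A. A \<in> \<A> \<Longrightarrow> (\<Sum>l\<in>Q. y A l) = 0"
    and bound: "\<And>A l. A \<in> \<A> \<Longrightarrow> l \<in> Q \<Longrightarrow> \<bar>y A l\<bar> \<le> 1"
    and exch: "\<And>a b b'. a \<in> Q \<Longrightarrow> b \<in> Q \<Longrightarrow> b' \<in> Q \<Longrightarrow> a \<noteq> b \<Longrightarrow> a \<noteq> b' \<Longrightarrow>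
       (\<Sum>A\<in>\<A>. y A a * y A b) = (\<Sum>A\<in>\<A>. y A a * y A b')"
  shows "(\<Sum>A\<in>\<A>. (\<Sum>l\<in>D. y A l)\<^sup>2) \<le> real (card D) * real (card \<A>)"
proof -
  have finD: "finite D" using fin finite_subset by blast
  have cov: "(\<Sum>A\<in>\<A>. y A a * y A b) \<le> 0" if ab: "a \<in> Q" "b \<in> Q" "a \<noteq> b" for a b
  proof -
    let ?C = "\<Sum>A\<in>\<A>. y A a * y A b"
    \<comment> \<open>By exchangeability all partners of \<open>a\<close> have the same covariance
      with it; since the total vanishes, their values add up to \<open>- y A a\<close>.\<close>
    have "real (card (Q - {a})) * ?C = (\<Sum>b'\<in>Q - {a}. \<Sum>A\<in>\<A>. y A a * y A b')"
    proof -
      have "(\<Sum>A\<in>\<A>. y A a * y A b') = ?C" if "b' \<in> Q - {a}" for b'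
        using exch[of a b' b] ab that by auto
      then show ?thesis by simp
    qed
    also have "\<dots> = (\<Sum>A\<in>\<A>. y A a * (\<Sum>b'\<in>Q - {a}. y A b'))"
      by (subst sum.swap) (simp add: sum_distrib_left)
    also have "\<dots> = (\<Sum>A\<in>\<A>. - (y A a)\<^sup>2)"
    proof (intro sum.cong refl)
      fix A assume "A \<in> \<A>"
      then have "(\<Sum>b'\<in>Q - {a}. y A b') = - y A a"
        using zero[of A] fin ab by (simp add: sum_diff1)
      then show "y A a * (\<Sum>b'\<in>Q - {a}. y A b') = - (y A a)\<^sup>2" by (simp add: power2_eq_square)
    qed
    also have "\<dots> \<le> 0" by (intro sum_nonpos) auto
    finally have "real (card (Q - {a})) * ?C \<le> 0" .
    moreover have "0 < real (card (Q - {a}))" using ab fin(1)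
      by (simp only: of_nat_0_less_iff card_gt_0_iff) auto
    ultimately show ?thesis by (simp add: mult_le_0_iff)
  qed
  have "(\<Sum>A\<in>\<A>. (\<Sum>l\<in>D. y A l)\<^sup>2) = (\<Sum>A\<in>\<A>. \<Sum>a\<in>D. \<Sum>b\<in>D. y A a * y A b)"
    by (simp add: power2_eq_square sum_product)
  also have "\<dots> = (\<Sum>a\<in>D. \<Sum>A\<in>\<A>. \<Sum>b\<in>D. y A a * y A b)" by (rule sum.swap)
  also have "\<dots> = (\<Sum>a\<in>D. \<Sum>b\<in>D. \<Sum>A\<in>\<A>. y A a * y A b)" by (intro sum.cong refl sum.swap)
  also have "\<dots> \<le> (\<Sum>a\<in>D. \<Sum>b\<in>D. if b = a then real (card \<A>) else 0)"
  proof (intro sum_mono)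
    fix a b assume ab: "a \<in> D" "b \<in> D"
    show "(\<Sum>A\<in>\<A>. y A a * y A b) \<le> (if b = a then real (card \<A>) else 0)"
    proof (cases "b = a")
      case True
      have "(\<Sum>A\<in>\<A>. y A a * y A a) \<le> (\<Sum>A\<in>\<A>. 1)"
      proof (intro sum_mono)
        fix A assume "A \<in> \<A>"
        then have "\<bar>y A a\<bar> \<le> 1" using bound ab fin by auto
        then show "y A a * y A a \<le> 1" by (simp add: abs_square_le_1 flip: power2_eq_square)
      qed
      then show ?thesis using True by simp
    next
      case False
      then show ?thesis using cov[of a b] ab fin by auto
    qed
  qed
  also have "\<dots> = real (card D) * real (card \<A>)" using finD by simp
  finally show ?thesis .
qed

text \<open>Cauchy-Schwarz in linearised form: the inequality 2 |x| s \<le> x^2 + s^2 is summed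
  pointwise.\<close>

lemma sum_abs_le_sqrt:
  fixes z :: "'b \<Rightarrow> real"
  assumes "(\<Sum>A\<in>\<A>. (z A)\<^sup>2) \<le> s\<^sup>2 * real (card \<A>)" "0 < s"
  shows "(\<Sum>A\<in>\<A>. \<bar>z A\<bar>) \<le> s * real (card \<A>)"
proof -
  have "\<bar>x\<bar> \<le> (x\<^sup>2 / s + s) / 2" for x
  proof -
    have "0 \<le> (\<bar>x\<bar> - s)\<^sup>2" by simp
    then have "2 * \<bar>x\<bar> * s \<le> x\<^sup>2 + s\<^sup>2" by (simp add: power2_diff)
    then show ?thesis using assms(2) by (simp add: field_simps power2_eq_square)
  qed
  then have "(\<Sum>A\<in>\<A>. \<bar>z A\<bar>) \<le> (\<Sum>A\<in>\<A>. ((z A)\<^sup>2 / s + s) / 2)" by (intro sum_mono)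
  also have "\<dots> = ((\<Sum>A\<in>\<A>. (z A)\<^sup>2) / s + s * real (card \<A>)) / 2"
    by (simp add: sum.distrib sum_divide_distrib[symmetric] mult.commute)
  also have "\<dots> \<le> (s\<^sup>2 * real (card \<A>) / s + s * real (card \<A>)) / 2"
    using assms by (intro divide_right_mono add_mono) auto
  also have "\<dots> = s * real (card \<A>)" using assms(2) by (simp add: power2_eq_square)
  finally show ?thesis .
qed


text \<open>By \<open>hoare_partition_spec\<close> this is the number of exchanges when the head is
  not the minimum, read off from the list before partitioning: large keys that sit where the left
  sub-list will be, the pivot included.\<close>

definition exchange_count :: "'a::linorder list \<Rightarrow> nat" where
  "exchange_count A = card {l. l < rank_in (set A) (A ! 0) \<and> A ! 0 \<le> A ! l}"

text \<open>Given the pivot, the exchanges after the first one are counted by a hypergeometric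
  variable: the q = m - 2 positions other than 0 and t hold g = m - c - 1 keys above the pivot in
  exchangeable order, and \<open>D\<close> collects those positions that belong to the left part.
  The second moment of the centred count is at most m by \<open>exchangeable_second_moment\<close>.
  The additive 4 absorbs the replacement of the mean 1 + |D| g / q by c (m - c) / m.\<close>

lemma sum_exchange_deviation:
  fixes S :: "'a::linorder set"
  assumes "finite S" "0 < t" "t < card S" "p \<in> S - {Min S}"
  defines "\<A> \<equiv> {A \<in> min_at S t. A ! 0 = p}" and "c \<equiv> rank_in S p" and "m \<equiv> card S"
  shows "(\<Sum>A\<in>\<A>. \<bar>real (exchange_count A) - real c * real (m - c) / real m\<bar>) \<le>
     (sqrt (real m) + 4) * real (card \<A>)"
proof -
  define Q where "Q = {1..<m} - {t}"
  define D where "D = {1..<c} - {t}"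
  define q where "q = m - 2"
  define g where "g = m - c - 1"
  define \<rho> where "\<rho> = real g / real q"
  define x where "x A l = (of_bool (p < A ! l) :: real)" for A :: "'a list" and l
  have m2: "2 \<le> m" using assms(2,3) by (simp add: m_def)
  have ne: "S \<noteq> {}" using assms(4) by auto
  have c: "1 \<le> c" "c < m"
    using bij_betwE[OF bij_betw_rank_in_nonmin[OF assms(1) ne]] assms(4) by (auto simp: c_def m_def)
  have finQ: "finite Q" and DQ: "D \<subseteq> Q" using c by (auto simp: Q_def D_def)
  have cardQ: "card Q = q" using assms(2,3) by (simp add: Q_def q_def m_def)
  have props: "distinct A" "set A = S" "length A = m" "A ! t = Min S" "A ! 0 = p" if "A \<in> \<A>" for A
    using that by (auto simp: \<A>_def min_at_iff m_def distinct_card)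
  have xt: "x A t = 0" if "A \<in> \<A>" for A
    using props[OF that] assms(1,4) by (auto simp: x_def not_less)
  have sumQ: "(\<Sum>l\<in>Q. x A l) = real g" if A: "A \<in> \<A>" for A
  proof -
    note P = props[OF A]
    have "(\<Sum>l\<in>Q. x A l) = (\<Sum>l<m. x A l)"
    proof (rule sum.mono_neutral_left)
      show "\<forall>l\<in>{..<m} - Q. x A l = 0"
      proof
        fix l assume "l \<in> {..<m} - Q"
        then have "l = 0 \<or> l = t" by (auto simp: Q_def)
        then show "x A l = 0" using xt[OF A] P by (auto simp: x_def)
      qed
    qed (auto simp: Q_def)
    also have "\<dots> = (\<Sum>y\<in>S. of_bool (p < y))"
    proof -
      have "bij_betw ((!) A) {..<m} S"
        using P by (intro bij_betw_nth) auto
      then show ?thesis unfolding x_def by (rule sum.reindex_bij_betw)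
    qed
    also have "\<dots> = real (card {y \<in> S. p < y})"
      using assms(1) by (simp add: Int_def)
    also have "card {y \<in> S. p < y} = g"
    proof -
      have "S = {y \<in> S. y < p} \<union> {p} \<union> {y \<in> S. p < y}" using assms(4) by auto
      moreover have "card ({y \<in> S. y < p} \<union> {p} \<union> {y \<in> S. p < y}) = c + 1 + card {y \<in> S. p < y}"
        using assms(1) by (subst card_Un_disjoint; auto simp: c_def)+
      ultimately show ?thesis by (simp add: g_def m_def)
    qed
    finally show ?thesis .
  qed
  have gq: "g \<le> q" using c m2 by (simp add: g_def q_def)
  have \<rho>: "0 \<le> \<rho>" "\<rho> \<le> 1" using gq by (auto simp: \<rho>_def divide_le_eq_1)
  have dev: "(\<Sum>A\<in>\<A>. (\<Sum>l\<in>D. x A l - \<rho>)\<^sup>2) \<le> real (card D) * real (card \<A>)"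
  proof (rule exchangeable_second_moment[OF finQ DQ])
    fix A assume A: "A \<in> \<A>"
    show "(\<Sum>l\<in>Q. x A l - \<rho>) = 0"
      using gq by (simp add: sum_subtractf sumQ[OF A] cardQ \<rho>_def)
    fix l show "\<bar>x A l - \<rho>\<bar> \<le> 1" using \<rho> by (auto simp: x_def)
  next
    fix a b b' assume Q: "a \<in> Q" "b \<in> Q" "b' \<in> Q" "a \<noteq> b" "a \<noteq> b'"
    have lt: "b < m" "b' < m" "b \<noteq> t" "b' \<noteq> t" "b \<noteq> 0" "b' \<noteq> 0" using Q by (auto simp: Q_def)
    have sw: "swap_pos b b' A ! l = (if l = b then A ! b' else if l = b' then A ! b else A ! l)"
      if "A \<in> \<A>" for A l
      using props[OF that] lt by (simp add: swap_pos_nth)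
    have "(\<Sum>A\<in>\<A>. (x (swap_pos b b' A) a - \<rho>) * (x (swap_pos b b' A) b' - \<rho>)) =
        (\<Sum>A\<in>\<A>. (x A a - \<rho>) * (x A b' - \<rho>))"
    proof (rule sum_swap_pos[where G = "\<lambda>A. (x A a - \<rho>) * (x A b' - \<rho>)"])
      fix A assume A: "A \<in> \<A>"
      show "b < length A \<and> b' < length A" using props[OF A] lt by simp
      show "swap_pos b b' A \<in> \<A>"
        using A swap_pos_min_at[of A S t b b'] lt props[OF A] sw[OF A, of 0]
        by (simp add: \<A>_def m_def)
    qed
    also have "(\<Sum>A\<in>\<A>. (x (swap_pos b b' A) a - \<rho>) * (x (swap_pos b b' A) b' - \<rho>)) =
        (\<Sum>A\<in>\<A>. (x A a - \<rho>) * (x A b - \<rho>))"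
      using Q by (intro sum.cong refl) (auto simp: x_def sw)
    finally show "(\<Sum>A\<in>\<A>. (x A a - \<rho>) * (x A b - \<rho>)) = (\<Sum>A\<in>\<A>. (x A a - \<rho>) * (x A b' - \<rho>))" .
  qed
  have cardD: "card D \<le> m" "real c - 2 \<le> real (card D)" "real (card D) \<le> real c - 1" "card D \<le> q"
  proof -
    have "card D \<le> card {1..<c}" unfolding D_def by (rule card_mono) auto
    then show "card D \<le> m" "real (card D) \<le> real c - 1" using c by auto
    have "card {1..<c} - card {t} \<le> card D"
      unfolding D_def by (rule diff_card_le_card_Diff) simp
    then show "real c - 2 \<le> real (card D)" using c by simp
    show "card D \<le> q" using card_mono[OF finQ DQ] cardQ by simp
  qed
  have "(\<Sum>A\<in>\<A>. \<bar>\<Sum>l\<in>D. x A l - \<rho>\<bar>) \<le> sqrt (real m) * real (card \<A>)"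
  proof (rule sum_abs_le_sqrt)
    show "(\<Sum>A\<in>\<A>. (\<Sum>l\<in>D. x A l - \<rho>)\<^sup>2) \<le> (sqrt (real m))\<^sup>2 * real (card \<A>)"
      using dev cardD(1) by (simp add: order_trans[OF _ mult_right_mono])
    show "0 < sqrt (real m)" using m2 by simp
  qed
  moreover have mean: "\<bar>1 + real (card D) * \<rho> - real c * real (m - c) / real m\<bar> \<le> 4"
  proof (cases "q = 0")
    \<comment> \<open>For m = 2 the ratio \<open>\<rho>\<close> is 0 by the convention for division
      by zero, and the difference is 1 - 1/2.\<close>
    case True
    then have "m = 2" using m2 by (simp add: q_def)
    moreover have "c = 1" using c \<open>m = 2\<close> by simp
    ultimately show ?thesis using True by (simp add: \<rho>_def)
  next
    case False
    define d where "d = real (card D)"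
    define M where "M = real m"
    define C where "C = real c"
    define G where "G = real g"
    have q: "real q = M - 2" "0 < M - 2" using False m2 by (auto simp: q_def M_def)
    have G: "real (m - c) = G + 1" "0 \<le> G" "G \<le> M - 2" using c m2 by (auto simp: G_def g_def M_def)
    have C: "1 \<le> C" "C \<le> M" using c by (auto simp: C_def M_def)
    have d: "C - 2 \<le> d" "d \<le> C - 1" using cardD by (auto simp: d_def C_def)
    have eq: "1 + d * (G / (M - 2)) - C * (G + 1) / M = 1 - C / M + G / (M - 2) * ((d * M - C * (M - 2)) / M)"
      using q(2) by (simp add: field_simps)
    have frac: "0 \<le> C / M" "C / M \<le> 1" "0 \<le> G / (M - 2)" "G / (M - 2) \<le> 1"
      using C G q(2) by auto
    have "(C - 2) * M \<le> d * M" "d * M \<le> (C - 1) * M" using d C by (auto intro: mult_right_mono)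
    then have "\<bar>d * M - C * (M - 2)\<bar> \<le> 2 * M" using C by (auto simp: algebra_simps abs_le_iff)
    then have x: "\<bar>(d * M - C * (M - 2)) / M\<bar> \<le> 2" using C by (simp add: abs_divide divide_le_eq)
    have "\<bar>G / (M - 2)\<bar> \<le> 1" using frac by linarith
    then have "\<bar>G / (M - 2)\<bar> * \<bar>(d * M - C * (M - 2)) / M\<bar> \<le> 1 * 2"
      by (rule mult_mono[OF _ x]) auto
    then have "\<bar>G / (M - 2) * ((d * M - C * (M - 2)) / M)\<bar> \<le> 2" by (simp add: abs_mult)
    then have "\<bar>1 + d * (G / (M - 2)) - C * (G + 1) / M\<bar> \<le> 4"
      unfolding eq using frac by linarith
    then show ?thesis
      unfolding \<rho>_def q(1) G(1) by (simp only: d_def M_def C_def G_def)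
  qed
  moreover have "\<bar>real (exchange_count A) - real c * real (m - c) / real m\<bar> \<le> \<bar>\<Sum>l\<in>D. x A l - \<rho>\<bar> + 4"
    if A: "A \<in> \<A>" for A
  proof -
    note P = props[OF A]
    have "{l. l < c \<and> p \<le> A ! l} = insert 0 {l \<in> D. p < A ! l}"
    proof (intro set_eqI iffI)
      fix l assume l: "l \<in> {l. l < c \<and> p \<le> A ! l}"
      show "l \<in> insert 0 {l \<in> D. p < A ! l}"
      proof (cases "l = 0")
        case False
        have "A ! l \<noteq> A ! 0" using P l False c by (subst nth_eq_iff_index_eq) auto
        then have "p < A ! l" using l P by auto
        moreover have "l \<noteq> t" using xt[OF A] \<open>p < A ! l\<close> by (auto simp: x_def)
        ultimately show ?thesis using l False by (auto simp: D_def)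
      qed simp
    qed (use c P in \<open>auto simp: D_def\<close>)
    then have "exchange_count A = card (insert 0 {l \<in> D. p < A ! l})"
      unfolding exchange_count_def using P by (simp add: c_def)
    also have "\<dots> = 1 + card {l \<in> D. p < A ! l}" by (subst card_insert_disjoint) (auto simp: D_def)
    finally have "real (exchange_count A) = 1 + (\<Sum>l\<in>D. x A l)"
      by (simp add: x_def D_def Int_def)
    moreover have "(\<Sum>l\<in>D. x A l - \<rho>) = (\<Sum>l\<in>D. x A l) - real (card D) * \<rho>"
      by (simp add: sum_subtractf)
    ultimately show ?thesis using mean by linarith
  qed
  then have "(\<Sum>A\<in>\<A>. \<bar>real (exchange_count A) - real c * real (m - c) / real m\<bar>) \<le>
      (\<Sum>A\<in>\<A>. \<bar>\<Sum>l\<in>D. x A l - \<rho>\<bar> + 4)"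
    by (rule sum_mono)
  ultimately show ?thesis by (simp add: sum.distrib algebra_simps)
qed

section \<open>One step of Quickselect\<close>

text \<open>A uniform rank falls into a sub-list with probability proportional to its length and is
  again uniform there; this is the source of the size bias.\<close>

lemma rank_avg_partition:
  assumes "hoare_partition A = (B, c, k)" "2 \<le> length A"
  shows "rank_avg f A =
     real c / real (length A) * rank_avg (\<lambda>y. f (real k + y)) (take c B) +
     real (length A - c) / real (length A) * rank_avg (\<lambda>y. f (real k + y)) (drop c B)"
proof -
  let ?m = "length A"
  have b: "length B = ?m" "1 \<le> c" "c < ?m" using hoare_partition_bounds[OF assms] by auto
  have rec: "quickselect_exchanges A r = k + (if r \<le> c then quickselect_exchanges (take c B) r
                   else quickselect_exchanges (drop c B) (r - c))" for r
    using assms by (subst quickselect_exchanges.simps) simp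
  have "(\<Sum>r=1..?m. f (real (quickselect_exchanges A r))) =
      (\<Sum>r=1..c. f (real (quickselect_exchanges A r))) + (\<Sum>r=c+1..?m. f (real (quickselect_exchanges A r)))"
    using b sum.ub_add_nat[of 1 c "\<lambda>r. f (real (quickselect_exchanges A r))" "?m - c"] by simp
  also have "(\<Sum>r=1..c. f (real (quickselect_exchanges A r))) =
      (\<Sum>r=1..c. f (real k + real (quickselect_exchanges (take c B) r)))"
    by (intro sum.cong refl) (simp add: rec)
  also have "(\<Sum>r=c+1..?m. f (real (quickselect_exchanges A r))) =
      (\<Sum>r=1..?m - c. f (real k + real (quickselect_exchanges (drop c B) r)))"
    by (rule sum.reindex_bij_witness[where i = "\<lambda>r. r + c" and j = "\<lambda>r. r - c"])
       (use b in \<open>auto simp: rec\<close>)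
  finally show ?thesis
    using b by (simp add: rank_avg_def add_divide_distrib)
qed

text \<open>One call makes at most as many exchanges as the shorter sub-list has keys, hence no more
  than the number of keys it discards, and these numbers add up to at most the length.\<close>

lemma quickselect_exchanges_le: "1 \<le> length A \<Longrightarrow> distinct A \<Longrightarrow> quickselect_exchanges A r \<le> length A"
proof (induction "length A" arbitrary: A r rule: less_induct)
  case less
  show ?case
  proof (cases "length A \<le> 1")
    case True
    then show ?thesis by (simp add: quickselect_exchanges.simps)
  next
    case False
    obtain B c k where h: "hoare_partition A = (B, c, k)" by (metis prod_cases3)
    have b: "length B = length A" "1 \<le> c" "c < length A"
      using hoare_partition_bounds[OF h] False by auto
    have "mset B = mset A \<and> k \<le> c \<and> k \<le> length A - c"
    proof (cases "\<exists>x\<in>set A. x < A ! 0")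
      case True
      then obtain x where x: "x \<in> set A" "x < A ! 0" by blast
      note P = hoare_partition_spec[OF h less(3) x]
      let ?n = "length A"
      have "k \<le> card {l. l < c}" unfolding P(5) by (rule card_mono) auto
      moreover have "k \<le> ?n - c"
      proof -
        have "k \<le> card {l. l < ?n \<and> A ! 0 \<le> A ! l}"
          unfolding P(5) using b by (intro card_mono) auto
        also have "{l. l < ?n \<and> A ! 0 \<le> A ! l} = {..<?n} - {l. l < ?n \<and> A ! l < A ! 0}" by auto
        also have "card \<dots> = ?n - c"
          using P(2) by (subst card_Diff_subset) auto
        finally show ?thesis .
      qed
      ultimately show ?thesis using P(1) by simp
    next
      case no: False
      have "hoare_partition A = (A, 1, 0)"
      proof (rule hoare_partition_min)
        show "A \<noteq> []" using less(2) by auto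
        fix l assume "0 < l" "l < length A"
        then have "A ! l \<noteq> A ! 0" using less(3) by (subst nth_eq_iff_index_eq) auto
        then show "A ! 0 < A ! l" using no \<open>l < length A\<close> by (metis linorder_neqE nth_mem)
      qed
      then show ?thesis using h by simp
    qed
    then have k: "k \<le> c" "k \<le> length A - c" and dB: "distinct B"
      using less(3) by (auto dest: mset_eq_imp_distinct_iff)
    have rec: "quickselect_exchanges A r = k + (if r \<le> c then quickselect_exchanges (take c B) r
                   else quickselect_exchanges (drop c B) (r - c))"
      using False h by (subst quickselect_exchanges.simps) simp
    have "quickselect_exchanges (take c B) r \<le> c"
      using less(1)[of "take c B" r] b dB by simp
    moreover have "quickselect_exchanges (drop c B) (r - c) \<le> length A - c"
      using less(1)[of "drop c B" "r - c"] b dB by simp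
    ultimately show ?thesis unfolding rec using k b by (cases "r \<le> c") simp_all
  qed
qed


text \<open>The minimum of \<open>S\<close> is moved to position \<open>t1\<close> of the left sub-list, and the pivot, which is the
  minimum of the right sub-list, to position \<open>t2\<close> of the latter.\<close>

lemma fibre_partition:
  fixes S :: "'a::linorder set"
  assumes "finite S" "0 < t" "t < card S" "A0 \<in> min_at S t"
  defines "p \<equiv> A0 ! 0" and "P \<equiv> {l. l < card S \<and> A0 ! l < A0 ! 0}"
  defines "\<F> \<equiv> {A \<in> min_at S t. A ! 0 = p \<and> {l. l < card S \<and> A ! l < A ! 0} = P}"
    and "c \<equiv> rank_in S p"
  shows "\<exists>t1 t2. t1 < c \<and> t2 < card S - c \<and>
     bij_betw (\<lambda>A. (take c (fst (hoare_partition A)), drop c (fst (hoare_partition A)))) \<F>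
       (min_at {x \<in> S. x < p} t1 \<times> min_at {x \<in> S. p \<le> x} t2)" (is "\<exists>t1 t2. _ \<and> _ \<and> bij_betw ?split _ _")
    and "\<And>A. A \<in> \<F> \<Longrightarrow> \<exists>B. hoare_partition A = (B, c, exchange_count A0)"
    and "\<And>A. A \<in> \<F> \<Longrightarrow> exchange_count A = exchange_count A0"
proof -
  define m where "m = card S"
  have m: "t < m" using assms(3) by (simp add: m_def)
  have A0F: "A0 \<in> \<F>" using assms(4) by (simp add: \<F>_def p_def P_def)
  have props: "distinct A" "set A = S" "length A = m" "A ! t = Min S" "A ! 0 = p"
    "\<And>l. l < m \<Longrightarrow> A ! l < p \<longleftrightarrow> l \<in> P" if "A \<in> \<F>" for A
    using that by (auto simp: \<F>_def min_at_iff m_def distinct_card)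
  have p: "p \<in> S" "Min S \<in> S" "Min S < p"
  proof -
    have h: "p \<in> S - {Min S}" using head_min_at[OF assms(4,1,2,3)] by (simp add: p_def)
    then show "p \<in> S" by simp
    then show "Min S \<in> S" using assms(1) by (intro Min_in) auto
    have "Min S \<le> p" using h assms(1) by auto
    then show "Min S < p" using h by auto
  qed
  have spec: "set B = set A \<and> distinct B \<and> length B = m \<and> k = c \<and> e = exchange_count A \<and>
      (\<forall>l<c. B ! l < p) \<and> (\<forall>l. c \<le> l \<longrightarrow> l < m \<longrightarrow> p \<le> B ! l) \<and> c < m"
    if A: "A \<in> \<F>" and h: "hoare_partition A = (B, k, e)" for A B k e
  proof -
    note R = props[OF A]
    have "Min S \<in> set A" "Min S < A ! 0" using p R by auto
    note H = hoare_partition_spec[OF h R(1) this]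
    have "set B = set A" "distinct B" "length B = m"
      using H(1) R by (metis set_mset_mset, metis mset_eq_imp_distinct_iff, metis size_mset)
    moreover have "k = c"
    proof -
      have "bij_betw ((!) A) {l. l < length A \<and> A ! l < p} {x \<in> S. x < p}"
        using R by (auto simp: bij_betw_def inj_on_def nth_eq_iff_index_eq in_set_conv_nth image_iff)
      then show ?thesis using H(2) R(5) unfolding c_def by (simp add: bij_betw_same_card)
    qed
    ultimately show ?thesis using H R by (simp add: exchange_count_def c_def)
  qed
  \<comment> \<open>On \<open>\<F>\<close> the outcome of each comparison with the pivot is a
    function of the position alone: smaller exactly on \<open>P\<close>, equal exactly at 0. Hence
    one rearrangement \<open>D\<close> serves the whole fibre.\<close>
  define lo hi where "lo l = (l \<in> P \<or> l = 0)" and "hi l = (l \<notin> P)" for l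
  obtain D c' k where D: "mset D = mset [0..<m]"
    "\<And>(q::'a) \<phi>. (\<forall>l\<in>set [0..<m]. (\<phi> l \<le> q \<longleftrightarrow> lo l) \<and> (q \<le> \<phi> l \<longleftrightarrow> hi l)) \<Longrightarrow>
        hoare_loop q (map \<phi> [0..<m]) 0 (m + 1) = (map \<phi> D, c', k)"
    using hoare_loop_oblivious[where ?'a = 'a, of "m + 1" "[0..<m]" lo hi 0] by auto
  have setD: "set D = {..<m}" "distinct D" "length D = m"
    using D(1) by (metis atLeast_upt set_mset_mset, metis distinct_upt mset_eq_imp_distinct_iff,
        metis length_upt minus_nat.diff_0 size_mset)
  have part: "hoare_partition A = (map ((!) A) D, c', k)" if A: "A \<in> \<F>" for A
  proof -
    note R = props[OF A]
    have "hoare_loop p (map ((!) A) [0..<m]) 0 (m + 1) = (map ((!) A) D, c', k)"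
    proof (rule D(2), intro ballI)
      fix l assume "l \<in> set [0..<m]"
      then have l: "l < m" by simp
      have "A ! l = p \<longleftrightarrow> l = 0"
        using R l m nth_eq_iff_index_eq[of A l 0] by auto
      then show "(A ! l \<le> p \<longleftrightarrow> lo l) \<and> (p \<le> A ! l \<longleftrightarrow> hi l)"
        using R(6)[OF l] by (auto simp: lo_def hi_def le_less not_less)
    qed
    moreover have "map ((!) A) [0..<m] = A" using map_nth[of A] R(3) by simp
    ultimately show ?thesis unfolding hoare_partition_def using R(3,5) by simp
  qed
  show "\<exists>B. hoare_partition A = (B, c, exchange_count A0)" if "A \<in> \<F>" for A
    using spec[OF A0F part[OF A0F]] part[OF that] by blast
  show "exchange_count A = exchange_count A0" if "A \<in> \<F>" for A
    using spec[OF A0F part[OF A0F]] spec[OF that part[OF that]] by simp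
  have cm: "c < m" using spec[OF A0F part[OF A0F]] by simp
  have DP: "D ! l \<in> P \<longleftrightarrow> l < c" if "l < m" for l
  proof -
    have "D ! l < m" using that setD by (metis lessThan_iff nth_mem)
    then have "D ! l \<in> P \<longleftrightarrow> map ((!) A0) D ! l < p"
      using props(6)[OF A0F] that setD by simp
    also have "\<dots> \<longleftrightarrow> l < c"
      using spec[OF A0F part[OF A0F]] that by (meson leD leI)
    finally show ?thesis .
  qed
  \<comment> \<open>\<open>D\<close> carries the original position \<open>t\<close> of the minimum
    to \<open>t1\<close> and, below, the position 0 of the pivot to \<open>t0\<close>. Since
    \<open>t\<close> lies in \<open>P\<close> and 0 does not, they land in different
    sub-lists.\<close>
  obtain t1 where t1: "t1 < m" "D ! t1 = t" using m setD by (metis in_set_conv_nth lessThan_iff)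
  have "A0 ! t < p" using props(4)[OF A0F] p(3) by simp
  then have "t \<in> P" using props(6)[OF A0F m] by simp
  then have t1c: "t1 < c" using DP[OF t1(1)] t1 by simp
  obtain t0 where t0: "t0 < m" "D ! t0 = 0" using m setD by (metis in_set_conv_nth lessThan_iff not_less_zero neq0_conv)
  have "0 \<notin> P" by (simp add: P_def)
  then have t0c: "c \<le> t0" using DP[OF t0(1)] t0 by simp
  define t2 where "t2 = t0 - c"
  have t2: "t2 < m - c" "c + t2 = t0" using t0 t0c by (auto simp: t2_def)
  let ?M1 = "min_at {x \<in> S. x < p} t1" and ?M2 = "min_at {x \<in> S. p \<le> x} t2"
  have Min1: "Min {x \<in> S. x < p} = Min S"
    using assms(1) p by (intro Min_eqI) auto
  have Min2: "Min {x \<in> S. p \<le> x} = p"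
    using assms(1) p by (intro Min_eqI) auto
  have fst_part: "fst (hoare_partition A) = map ((!) A) D" if "A \<in> \<F>" for A
    using part[OF that] by simp
  have "bij_betw ?split \<F> (?M1 \<times> ?M2)"
    unfolding bij_betw_def
  proof
    show "inj_on ?split \<F>"
    proof (rule inj_onI)
      fix A A' assume A: "A \<in> \<F>" "A' \<in> \<F>" "?split A = ?split A'"
      then have "map ((!) A) D = map ((!) A') D"
        by (metis Pair_inject append_take_drop_id fst_part)
      then have "A ! l = A' ! l" if "l < m" for l using that setD by auto
      then show "A = A'" using props(3)[OF A(1)] props(3)[OF A(2)] by (auto intro: nth_equalityI)
    qed
    show "?split ` \<F> = ?M1 \<times> ?M2"
    proof
      show "?split ` \<F> \<subseteq> ?M1 \<times> ?M2"
      proof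
        fix z assume "z \<in> ?split ` \<F>"
        then obtain A where A: "A \<in> \<F>" "z = ?split A" by blast
        define B where "B = map ((!) A) D"
        note R = props[OF A(1)]
        have B: "set B = S" "distinct B" "length B = m" "\<And>l. l < c \<Longrightarrow> B ! l < p"
            "\<And>l. c \<le> l \<Longrightarrow> l < m \<Longrightarrow> p \<le> B ! l"
          using spec[OF A(1) part[OF A(1)]] R(2) by (auto simp: B_def)
        have lt: "x < p" if "x \<in> set (take c B)" for x
          using that B cm by (auto simp: in_set_conv_nth)
        have ge: "p \<le> x" if "x \<in> set (drop c B)" for x
          using that B(3) B(5)[of "c + _"] by (auto simp: in_set_conv_nth)
        have un: "set (take c B) \<union> set (drop c B) = S"
          using B(1) by (metis append_take_drop_id set_append)
        have "set (take c B) = {x \<in> S. x < p}"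
          using un lt ge by fastforce
        moreover have "set (drop c B) = {x \<in> S. p \<le> x}"
          using un lt ge by fastforce
        moreover have "take c B ! t1 = Min S" using t1 t1c R setD by (simp add: B_def)
        moreover have "drop c B ! t2 = p" using t2 t0 R setD cm by (simp add: B_def)
        ultimately show "z \<in> ?M1 \<times> ?M2"
          using B(2) unfolding A(2) fst_part[OF A(1)] B_def[symmetric]
          by (simp add: min_at_iff Min1 Min2)
      qed
      show "?M1 \<times> ?M2 \<subseteq> ?split ` \<F>"
      proof
        fix z assume "z \<in> ?M1 \<times> ?M2"
        then obtain B1 B2 where z: "z = (B1, B2)" "B1 \<in> ?M1" "B2 \<in> ?M2" by blast
        have B1: "set B1 = {x \<in> S. x < p}" "distinct B1" "B1 ! t1 = Min S"
          using z(2) by (auto simp: min_at_iff Min1)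
        have B2: "set B2 = {x \<in> S. p \<le> x}" "distinct B2" "B2 ! t2 = p"
          using z(3) by (auto simp: min_at_iff Min2)
        have len1: "length B1 = c" using B1 distinct_card[of B1] by (simp add: c_def)
        have dB: "distinct (B1 @ B2)" using B1 B2 by auto
        have sB: "set (B1 @ B2) = S" using B1 B2 by auto
        have len: "length (B1 @ B2) = m" using distinct_card[OF dB] sB by (simp add: m_def)
        \<comment> \<open>Surjectivity: reading \<open>B1 @ B2\<close> through the inverse of
          \<open>D\<close> undoes the rearrangement.\<close>
        define pos where "pos = inv_into {..<m} ((!) D)"
        have bijD: "bij_betw ((!) D) {..<m} {..<m}"
          using bij_betw_nth[OF setD(2) refl refl] setD by simp
        have pos: "pos (D ! l) = l" if "l < m" for l
          unfolding pos_def using bijD that by (intro inv_into_f_f) (auto simp: bij_betw_def)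
        have posD: "pos l < m" "D ! pos l = l" if "l < m" for l
          unfolding pos_def using bijD that
          by (auto simp: bij_betw_def f_inv_into_f intro: inv_into_into[of l "(!) D" "{..<m}", simplified])
        define A where "A = map (\<lambda>l. (B1 @ B2) ! pos l) [0..<m]"
        have Al: "A ! l = (B1 @ B2) ! pos l" if "l < m" for l using that by (simp add: A_def)
        have lenA: "length A = m" by (simp add: A_def)
        have AD: "map ((!) A) D = B1 @ B2"
        proof (rule nth_equalityI)
          fix l assume "l < length (map ((!) A) D)"
          then have l: "l < m" using setD by simp
          then have "D ! l < m" using setD by (metis lessThan_iff nth_mem)
          then show "map ((!) A) D ! l = (B1 @ B2) ! l" using l setD by (simp add: Al pos)
        qed (use setD len in simp)
        have "mset (map ((!) A) D) = mset (map ((!) A) [0..<m])" using D(1) by simp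
        also have "map ((!) A) [0..<m] = A" using map_nth[of A] lenA by simp
        finally have "mset A = mset (B1 @ B2)" using AD by simp
        then have "set A = S" "distinct A"
          using sB dB by (metis set_mset_mset, metis mset_eq_imp_distinct_iff)
        moreover have "A ! t = Min S"
          using Al[OF m] pos[OF t1(1)] t1 t1c len1 B1(3) by (simp add: nth_append)
        moreover have A0p: "A ! 0 = p"
        proof -
          have "A ! 0 = (B1 @ B2) ! t0" using Al[of 0] pos[OF t0(1)] t0 m by simp
          also have "\<dots> = B2 ! t2" using t0c len1 by (simp add: nth_append t2_def)
          finally show ?thesis using B2(3) by simp
        qed
        moreover have "{l. l < card S \<and> A ! l < A ! 0} = P"
        proof -
          have "A ! l < p \<longleftrightarrow> l \<in> P" if l: "l < m" for l
          proof -
            have "A ! l < p \<longleftrightarrow> pos l < c"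
            proof (cases "pos l < c")
              case True
              then have "(B1 @ B2) ! pos l \<in> set B1" using len1 by (simp add: nth_append)
              then show ?thesis using True Al[OF l] B1(1) by auto
            next
              case False
              then have "(B1 @ B2) ! pos l \<in> set B2"
                using posD(1)[OF l] len1 len by (simp add: nth_append)
              then show ?thesis using False Al[OF l] B2(1) by auto
            qed
            also have "\<dots> \<longleftrightarrow> l \<in> P" using DP[OF posD(1)[OF l]] posD(2)[OF l] by simp
            finally show ?thesis .
          qed
          then show ?thesis unfolding A0p by (auto simp: m_def P_def)
        qed
        ultimately have "A \<in> \<F>" by (simp add: \<F>_def min_at_iff)
        moreover have "?split A = z"
          using fst_part[OF \<open>A \<in> \<F>\<close>] AD len1 z(1) by simp
        ultimately show "z \<in> ?split ` \<F>" by blast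
      qed
    qed
  qed
  then show "\<exists>t1 t2. t1 < c \<and> t2 < card S - c \<and> bij_betw ?split \<F>
      (min_at {x \<in> S. x < p} t1 \<times> min_at {x \<in> S. p \<le> x} t2)"
    using t1c t2 by (intro exI[of _ t1] exI[of _ t2]) (simp add: m_def)
qed

lemma sum_bij_Times_fst:
  assumes "bij_betw (\<lambda>A. (u A, v A)) F (M \<times> N)"
  shows "(\<Sum>A\<in>F. H (u A)) = real (card N) * (\<Sum>B\<in>M. H B)"
proof -
  have "(\<Sum>A\<in>F. H (u A)) = (\<Sum>z\<in>M \<times> N. H (fst z))"
    using sum.reindex_bij_betw[OF assms, of "\<lambda>z. H (fst z)"] by simp
  also have "\<dots> = (\<Sum>x\<in>M. \<Sum>y\<in>N. H x)"
    by (simp only: sum.cartesian_product split_beta')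
  finally show ?thesis by (simp add: sum_distrib_left)
qed

lemma sum_bij_Times_snd:
  assumes "bij_betw (\<lambda>A. (u A, v A)) F (M \<times> N)"
  shows "(\<Sum>A\<in>F. H (v A)) = real (card M) * (\<Sum>B\<in>N. H B)"
proof -
  have "(\<Sum>A\<in>F. H (v A)) = (\<Sum>z\<in>M \<times> N. H (snd z))"
    using sum.reindex_bij_betw[OF assms, of "\<lambda>z. H (snd z)"] by simp
  also have "\<dots> = (\<Sum>x\<in>M. \<Sum>y\<in>N. H y)"
    by (simp only: sum.cartesian_product split_beta')
  finally show ?thesis by (simp add: sum_distrib_left)
qed

section \<open>The recursion\<close>

text \<open>After division by \<open>card (min_at S t)\<close> this says that Wasserstein distance
  \<open>w\<close> separates the number of exchanges on random lists in \<open>min_at S t\<close>,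
  with uniform rank, from \<open>n\<close> times the limit variable. The product form avoids
  quotients of cardinalities when the fibres are added up.\<close>

definition gap_bound :: "nat \<Rightarrow> real \<Rightarrow> bool" where
  "gap_bound n w \<longleftrightarrow> (\<forall>(S::nat set) t f. finite S \<longrightarrow> card S = n \<longrightarrow> t < n \<longrightarrow> 1-lipschitz_on UNIV f \<longrightarrow>
     \<bar>(\<Sum>A\<in>min_at S t. rank_avg f A) - real (card (min_at S t)) * (\<integral>x. f (real n * x) \<partial>limit_law)\<bar>
       \<le> real (card (min_at S t)) * w)"

lemma gap_boundD:
  fixes S :: "nat set"
  assumes "gap_bound n w" "finite S" "card S = n" "t < n" "1-lipschitz_on UNIV f"
  shows "\<bar>(\<Sum>A\<in>min_at S t. rank_avg f A) - real (card (min_at S t)) * (\<integral>x. f (real n * x) \<partial>limit_law)\<bar>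
       \<le> real (card (min_at S t)) * w"
  using assms unfolding gap_bound_def by blast

lemma weighted_product_gap:
  fixes a b :: real
  assumes "0 \<le> a" "0 \<le> b" "0 \<le> N1" "0 \<le> N2" "\<bar>s1 - N1 * e1\<bar> \<le> N1 * w1" "\<bar>s2 - N2 * e2\<bar> \<le> N2 * w2"
  shows "\<bar>a * (N2 * s1) + b * (N1 * s2) - N1 * N2 * (a * e1 + b * e2)\<bar> \<le> N1 * N2 * (a * w1 + b * w2)"
proof -
  have "a * (N2 * s1) + b * (N1 * s2) - N1 * N2 * (a * e1 + b * e2) =
      a * N2 * (s1 - N1 * e1) + b * N1 * (s2 - N2 * e2)"
    by (simp add: algebra_simps)
  also have "\<bar>\<dots>\<bar> \<le> a * N2 * \<bar>s1 - N1 * e1\<bar> + b * N1 * \<bar>s2 - N2 * e2\<bar>"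
    using assms(1-4) by (intro order_trans[OF abs_triangle_ineq]) (simp add: abs_mult)
  also have "\<dots> \<le> a * N2 * (N1 * w1) + b * N1 * (N2 * w2)"
    using assms by (intro add_mono mult_left_mono) auto
  also have "\<dots> = N1 * N2 * (a * w1 + b * w2)" by (simp add: algebra_simps)
  finally show ?thesis .
qed

text \<open>On a fibre the number of exchanges is constant and becomes a shift of \<open>f\<close>.
  The pair of sub-lists runs through a full product, so each sub-list is uniform in its own set
  \<open>min_at\<close> and the hypothesis applies to both.\<close>

lemma fibre_gap:
  fixes S :: "nat set"
  assumes S: "finite S" "0 < t" "t < card S" "A0 \<in> min_at S t"
    and f: "1-lipschitz_on UNIV f"
    and gap: "\<And>n. 0 < n \<Longrightarrow> n < card S \<Longrightarrow> gap_bound n (w n)"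
  defines "\<F> \<equiv> {A \<in> min_at S t. A ! 0 = A0 ! 0 \<and>
      {l. l < card S \<and> A ! l < A ! 0} = {l. l < card S \<and> A0 ! l < A0 ! 0}}"
    and "c \<equiv> rank_in S (A0 ! 0)" and "m \<equiv> card S" and "k \<equiv> real (exchange_count A0)"
  shows "\<bar>(\<Sum>A\<in>\<F>. rank_avg f A) - real (card \<F>) *
      (real c / real m * (\<integral>x. f (k + real c * x) \<partial>limit_law) +
       real (m - c) / real m * (\<integral>x. f (k + real (m - c) * x) \<partial>limit_law))\<bar>
    \<le> real (card \<F>) * (real c / real m * w c + real (m - c) / real m * w (m - c))"
proof -
  obtain t1 t2 where t: "t1 < c" "t2 < m - c" and bij: "bij_betw
      (\<lambda>A. (take c (fst (hoare_partition A)), drop c (fst (hoare_partition A)))) \<F>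
      (min_at {x \<in> S. x < A0 ! 0} t1 \<times> min_at {x \<in> S. A0 ! 0 \<le> x} t2)"
    using fibre_partition(1)[OF S] unfolding \<F>_def c_def m_def by blast
  let ?M1 = "min_at {x \<in> S. x < A0 ! 0} t1" and ?M2 = "min_at {x \<in> S. A0 ! 0 \<le> x} t2"
  let ?f = "\<lambda>y. f (k + y)"
  let ?e1 = "\<integral>x. f (k + real c * x) \<partial>limit_law" and ?e2 = "\<integral>x. f (k + real (m - c) * x) \<partial>limit_law"
  let ?N1 = "real (card ?M1)" and ?N2 = "real (card ?M2)"
  let ?s1 = "\<Sum>B\<in>?M1. rank_avg ?f B" and ?s2 = "\<Sum>B\<in>?M2. rank_avg ?f B"
  let ?a = "real c / real m" and ?b = "real (m - c) / real m"
  have f': "1-lipschitz_on UNIV ?f" by (rule lip1_shift[OF f])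
  have m2: "2 \<le> m" using S(2,3) by (simp add: m_def)
  have c: "0 < c" "c < m" using t by auto
  have card2: "card {x \<in> S. A0 ! 0 \<le> x} = m - c"
  proof -
    have "{x \<in> S. A0 ! 0 \<le> x} = S - {x \<in> S. x < A0 ! 0}" by auto
    then show ?thesis unfolding m_def c_def using S(1) by (simp add: card_Diff_subset)
  qed
  have g1: "\<bar>?s1 - ?N1 * ?e1\<bar> \<le> ?N1 * w c"
    using gap[OF c(1)] c t S(1) f' unfolding m_def by (intro gap_boundD) (auto simp: c_def)
  have g2: "\<bar>?s2 - ?N2 * ?e2\<bar> \<le> ?N2 * w (m - c)"
    using gap[of "m - c"] c t S(1) f' card2 unfolding m_def by (intro gap_boundD) auto
  have N: "real (card \<F>) = ?N1 * ?N2"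
    using bij_betw_same_card[OF bij] by (simp add: card_cartesian_product)
  have "rank_avg f A = ?a * rank_avg ?f (take c (fst (hoare_partition A))) +
      ?b * rank_avg ?f (drop c (fst (hoare_partition A)))" if A: "A \<in> \<F>" for A
  proof -
    obtain B where B: "hoare_partition A = (B, c, exchange_count A0)"
      using fibre_partition(2)[OF S, of A] A unfolding \<F>_def c_def by blast
    have "A \<in> min_at S t" using A unfolding \<F>_def by blast
    then have "length A = m" unfolding m_def by (rule length_min_at)
    then show ?thesis using rank_avg_partition[OF B, of f] m2 B by (simp add: k_def)
  qed
  then have "(\<Sum>A\<in>\<F>. rank_avg f A) = ?a * (\<Sum>A\<in>\<F>. rank_avg ?f (take c (fst (hoare_partition A)))) +
      ?b * (\<Sum>A\<in>\<F>. rank_avg ?f (drop c (fst (hoare_partition A))))"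
    by (simp add: sum.distrib sum_distrib_left)
  also have "\<dots> = ?a * (?N2 * ?s1) + ?b * (?N1 * ?s2)"
    by (simp only: sum_bij_Times_fst[OF bij] sum_bij_Times_snd[OF bij])
  finally have total: "(\<Sum>A\<in>\<F>. rank_avg f A) = ?a * (?N2 * ?s1) + ?b * (?N1 * ?s2)" .
  show ?thesis
    unfolding total N by (rule weighted_product_gap[OF _ _ _ _ g1 g2]) auto
qed

text \<open>The reflection c -> m - c interchanges the roles of the two sub-lists. With c uniform on
  \<open>{1..<m}\<close>, a sub-list of length c therefore gets the size-biased weight 2 c / (m (m -
  1)).\<close>

lemma sum_reflect_weights:
  fixes h :: "nat \<Rightarrow> real"
  assumes "0 < m"
  shows "(\<Sum>c=1..<m. real c / real m * h c + real (m - c) / real m * h (m - c)) =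
    2 / real m * (\<Sum>c=1..<m. real c * h c)"
proof -
  have "(\<Sum>c=1..<m. real (m - c) / real m * h (m - c)) = (\<Sum>c=1..<m. real c / real m * h c)"
    by (rule sum.reindex_bij_witness[where i = "\<lambda>c. m - c" and j = "\<lambda>c. m - c"]) auto
  then show ?thesis by (simp add: sum.distrib sum_distrib_left)
qed

text \<open>The triangle inequality passes through two intermediate sums: \<open>\<Psi>\<close> puts
  the limit law in place of the sub-lists but keeps the actual number of exchanges, and
  \<open>\<Lambda>\<close> replaces this number by c (m - c) / m. The errors are the averaged
  hypothesis, sqrt m + 4 from \<open>sum_exchange_deviation\<close>, and 6 from
  \<open>limit_law_size_biased_sum\<close>.\<close>

lemma gap_step:
  fixes S :: "nat set"
  assumes S: "finite S" "0 < t" "t < card S"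
    and f: "1-lipschitz_on UNIV f"
    and gap: "\<And>n. 0 < n \<Longrightarrow> n < card S \<Longrightarrow> gap_bound n (w n)"
  defines "m \<equiv> card S" and "L \<equiv> min_at S t"
  shows "\<bar>(\<Sum>A\<in>L. rank_avg f A) - real (card L) * (\<integral>x. f (real m * x) \<partial>limit_law)\<bar> \<le>
    real (card L) * (2 / (real m * (real m - 1)) * (\<Sum>c=1..<m. real c * w c) + sqrt (real m) + 10)"
proof -
  let ?c = "\<lambda>A. rank_in S (A ! 0)"
  define \<Psi> where "\<Psi> A = real (?c A) / real m * (\<integral>x. f (real (exchange_count A) + real (?c A) * x) \<partial>limit_law) +
       real (m - ?c A) / real m * (\<integral>x. f (real (exchange_count A) + real (m - ?c A) * x) \<partial>limit_law)" for A
  define \<omega> where "\<omega> c = real c / real m * w c + real (m - c) / real m * w (m - c)" for c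
  define \<Lambda> where "\<Lambda> c = real c / real m * limit_step f m (real c / real m) +
      real (m - c) / real m * limit_step f m (real (m - c) / real m)" for c
  define N where "N = real (card L)"
  have finL: "finite L" unfolding L_def by (rule finite_min_at[OF S(1)])
  have m2: "2 \<le> m" using S(2,3) by (simp add: m_def)
  have c_bounds: "0 < ?c A" "?c A < m" if "A \<in> L" for A
  proof -
    have h: "A ! 0 \<in> S - {Min S}" using head_min_at[OF _ S] that by (simp add: L_def)
    then have "S \<noteq> {}" by auto
    have "?c A \<in> {1..<m}"
      using bij_betwE[OF bij_betw_rank_in_nonmin[OF S(1) \<open>S \<noteq> {}\<close>]] h unfolding m_def by blast
    then show "0 < ?c A" "?c A < m" unfolding atLeastLessThan_iff by linarith+
  qed
  \<comment> \<open>The level sets of this map are the fibres of \<open>fibre_gap\<close>.\<close>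
  let ?key = "\<lambda>A. (A ! 0, {l. l < m \<and> A ! l < A ! 0})"
  have group: "(\<Sum>A\<in>L. G A) = (\<Sum>\<kappa>\<in>?key ` L. \<Sum>A\<in>{A \<in> L. ?key A = \<kappa>}. G A)" for G :: "nat list \<Rightarrow> real"
    by (rule sum.image_gen[OF finL])
  have "\<bar>(\<Sum>A\<in>L. rank_avg f A) - (\<Sum>A\<in>L. \<Psi> A)\<bar> =
      \<bar>\<Sum>\<kappa>\<in>?key ` L. (\<Sum>A\<in>{A \<in> L. ?key A = \<kappa>}. rank_avg f A) - (\<Sum>A\<in>{A \<in> L. ?key A = \<kappa>}. \<Psi> A)\<bar>"
    by (simp only: group sum_subtractf)
  also have "\<dots> \<le> (\<Sum>\<kappa>\<in>?key ` L. \<Sum>A\<in>{A \<in> L. ?key A = \<kappa>}. \<omega> (?c A))"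
  proof (rule order_trans[OF sum_abs sum_mono])
    fix \<kappa> assume "\<kappa> \<in> ?key ` L"
    then obtain A0 where A0: "A0 \<in> L" "\<kappa> = ?key A0" by blast
    let ?F = "{A \<in> min_at S t. A ! 0 = A0 ! 0 \<and>
      {l. l < card S \<and> A ! l < A ! 0} = {l. l < card S \<and> A0 ! l < A0 ! 0}}"
    have F: "{A \<in> L. ?key A = \<kappa>} = ?F" unfolding A0(2) L_def m_def by (simp only: prod.inject)
    note A0' = A0(1)[unfolded L_def]
    have const: "\<Psi> A = \<Psi> A0" "\<omega> (?c A) = \<omega> (?c A0)" if "A \<in> ?F" for A
    proof -
      have "A ! 0 = A0 ! 0" using that by blast
      moreover have "exchange_count A = exchange_count A0" by (rule fibre_partition(3)[OF S A0' that])
      ultimately show "\<Psi> A = \<Psi> A0" "\<omega> (?c A) = \<omega> (?c A0)" by (simp_all only: \<Psi>_def)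
    qed
    have "(\<Sum>A\<in>?F. \<Psi> A) = (\<Sum>A\<in>?F. \<Psi> A0)" "(\<Sum>A\<in>?F. \<omega> (?c A)) = (\<Sum>A\<in>?F. \<omega> (?c A0))"
      by (intro sum.cong refl const; assumption)+
    then have "(\<Sum>A\<in>?F. \<Psi> A) = real (card ?F) * \<Psi> A0" "(\<Sum>A\<in>?F. \<omega> (?c A)) = real (card ?F) * \<omega> (?c A0)"
      by (simp_all only: sum_constant)
    then show "\<bar>(\<Sum>A\<in>{A \<in> L. ?key A = \<kappa>}. rank_avg f A) - (\<Sum>A\<in>{A \<in> L. ?key A = \<kappa>}. \<Psi> A)\<bar>
        \<le> (\<Sum>A\<in>{A \<in> L. ?key A = \<kappa>}. \<omega> (?c A))"
      unfolding F using fibre_gap[OF S A0' f gap] by (simp only: \<Psi>_def \<omega>_def m_def)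
  qed
  also have "\<dots> = (\<Sum>A\<in>L. \<omega> (?c A))" by (rule group[symmetric])
  also have "\<dots> = N / (real m - 1) * (2 / real m * (\<Sum>c=1..<m. real c * w c))"
    using sum_min_at_pivot_rank[OF S, of \<omega>] sum_reflect_weights[of m w] m2
    by (simp add: L_def m_def N_def \<omega>_def)
  finally have 1: "\<bar>(\<Sum>A\<in>L. rank_avg f A) - (\<Sum>A\<in>L. \<Psi> A)\<bar> \<le>
      N / (real m - 1) * (2 / real m * (\<Sum>c=1..<m. real c * w c))" .
  let ?dev = "\<lambda>A. \<bar>real (exchange_count A) - real (?c A) * real (m - ?c A) / real m\<bar>"
  have "\<bar>\<Psi> A - \<Lambda> (?c A)\<bar> \<le> ?dev A" if A: "A \<in> L" for A
  proof -
    define c where "c = ?c A"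
    define k where "k = real (exchange_count A)"
    define d where "d = real c * real (m - c) / real m"
    have c: "0 < c" "c < m" using c_bounds[OF A] by (auto simp: c_def)
    \<comment> \<open>Both sub-lists see the same toll, since b (m - b) / m has the same value at b
      = c and at b = m - c.\<close>
    have step: "limit_step f m (real b / real m) = (\<integral>x. f (real b * x + d) \<partial>limit_law)"
      if "b = c \<or> b = m - c" for b
      unfolding limit_step_def
    proof (rule Bochner_Integration.integral_cong[OF refl])
      fix x :: real
      have "real m * (real b / real m * x + real b / real m * (1 - real b / real m)) = real b * x + d"
        using that c m2 by (auto simp: d_def field_simps of_nat_diff)
      then show "f (real m * (real b / real m * x + real b / real m * (1 - real b / real m))) = f (real b * x + d)"
        by simp
    qed
    have diff: "\<bar>(\<integral>x. f (k + real b * x) \<partial>limit_law) - limit_step f m (real b / real m)\<bar> \<le> \<bar>k - d\<bar>"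
      if "b = c \<or> b = m - c" for b
      unfolding step[OF that] using limit_law_integral_lip1_diff[OF f, of "real b" k "real b" d]
      by (simp add: add.commute)
    have "\<Psi> A - \<Lambda> c = real c / real m * ((\<integral>x. f (k + real c * x) \<partial>limit_law) - limit_step f m (real c / real m)) +
       real (m - c) / real m * ((\<integral>x. f (k + real (m - c) * x) \<partial>limit_law) - limit_step f m (real (m - c) / real m))"
      unfolding \<Psi>_def \<Lambda>_def c_def[symmetric] k_def[symmetric] right_diff_distrib by simp
    also have "\<bar>\<dots>\<bar> \<le> real c / real m * \<bar>k - d\<bar> + real (m - c) / real m * \<bar>k - d\<bar>"
    proof (rule order_trans[OF abs_triangle_ineq add_mono])
      have scale: "\<bar>r * y\<bar> \<le> r * z" if "0 \<le> r" "\<bar>y\<bar> \<le> z" for r y z :: real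
        using that by (simp add: abs_mult mult_left_mono)
      show "\<bar>real c / real m * ((\<integral>x. f (k + real c * x) \<partial>limit_law) - limit_step f m (real c / real m))\<bar> \<le> real c / real m * \<bar>k - d\<bar>"
        and "\<bar>real (m - c) / real m * ((\<integral>x. f (k + real (m - c) * x) \<partial>limit_law) - limit_step f m (real (m - c) / real m))\<bar>
          \<le> real (m - c) / real m * \<bar>k - d\<bar>"
        by (rule scale[OF _ diff]; simp)+
    qed
    also have "\<dots> = \<bar>k - d\<bar>"
      using c by (simp add: distrib_right[symmetric] add_divide_distrib[symmetric] of_nat_diff)
    finally show ?thesis by (simp add: c_def k_def d_def)
  qed
  then have "\<bar>(\<Sum>A\<in>L. \<Psi> A) - (\<Sum>A\<in>L. \<Lambda> (?c A))\<bar> \<le> (\<Sum>A\<in>L. ?dev A)"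
    unfolding sum_subtractf[symmetric] by (intro order_trans[OF sum_abs sum_mono])
  also have "\<dots> = (\<Sum>p\<in>(\<lambda>A. A ! 0) ` L. \<Sum>A\<in>{A \<in> L. A ! 0 = p}. ?dev A)"
    by (rule sum.image_gen[OF finL])
  also have "\<dots> \<le> (\<Sum>p\<in>(\<lambda>A. A ! 0) ` L. (sqrt (real m) + 4) * real (card {A \<in> L. A ! 0 = p}))"
  proof (intro sum_mono)
    fix p assume "p \<in> (\<lambda>A. A ! 0) ` L"
    then have p: "p \<in> S - {Min S}" using head_min_at[OF _ S] by (auto simp: L_def)
    have "(\<Sum>A\<in>{A \<in> L. A ! 0 = p}. ?dev A) = (\<Sum>A\<in>{A \<in> L. A ! 0 = p}.
        \<bar>real (exchange_count A) - real (rank_in S p) * real (m - rank_in S p) / real m\<bar>)"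
      by (intro sum.cong) auto
    then show "(\<Sum>A\<in>{A \<in> L. A ! 0 = p}. ?dev A) \<le> (sqrt (real m) + 4) * real (card {A \<in> L. A ! 0 = p})"
      using sum_exchange_deviation[OF S p] by (simp add: L_def m_def)
  qed
  also have "\<dots> = (sqrt (real m) + 4) * N"
  proof -
    have "N = (\<Sum>A\<in>L. 1)" by (simp add: N_def)
    also have "\<dots> = (\<Sum>p\<in>(\<lambda>A. A ! 0) ` L. \<Sum>A\<in>{A \<in> L. A ! 0 = p}. 1)"
      by (rule sum.image_gen[OF finL])
    also have "\<dots> = (\<Sum>p\<in>(\<lambda>A. A ! 0) ` L. real (card {A \<in> L. A ! 0 = p}))" by simp
    finally show ?thesis by (simp only: sum_distrib_left)
  qed
  finally have 2: "\<bar>(\<Sum>A\<in>L. \<Psi> A) - (\<Sum>A\<in>L. \<Lambda> (?c A))\<bar> \<le> (sqrt (real m) + 4) * N" .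
  let ?E = "\<integral>x. f (real m * x) \<partial>limit_law"
  have \<Lambda>_sum: "(\<Sum>A\<in>L. \<Lambda> (?c A)) = N * (2 / (real m * (real m - 1)) * (\<Sum>c=1..<m. real c * limit_step f m (real c / real m)))"
  proof -
    have "(\<Sum>A\<in>L. \<Lambda> (?c A)) = N / (real m - 1) * (\<Sum>c=1..<m. \<Lambda> c)"
      unfolding L_def m_def N_def by (rule sum_min_at_pivot_rank[OF S])
    also have "(\<Sum>c=1..<m. \<Lambda> c) = 2 / real m * (\<Sum>c=1..<m. real c * limit_step f m (real c / real m))"
      unfolding \<Lambda>_def using m2 by (intro sum_reflect_weights) simp
    finally show ?thesis by simp
  qed
  have "\<bar>(\<Sum>A\<in>L. \<Lambda> (?c A)) - N * ?E\<bar> =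
      N * \<bar>?E - 2 / (real m * (real m - 1)) * (\<Sum>c=1..<m. real c * limit_step f m (real c / real m))\<bar>"
  proof -
    have "\<bar>N * r - N * e\<bar> = N * \<bar>e - r\<bar>" for r e
      by (simp add: N_def abs_mult abs_minus_commute flip: right_diff_distrib)
    then show ?thesis unfolding \<Lambda>_sum .
  qed
  also have "\<dots> \<le> N * 6"
    by (intro mult_left_mono limit_law_size_biased_sum[OF f m2]) (simp add: N_def)
  finally have 3: "\<bar>(\<Sum>A\<in>L. \<Lambda> (?c A)) - N * ?E\<bar> \<le> N * 6" .
  have "\<bar>(\<Sum>A\<in>L. rank_avg f A) - N * ?E\<bar> \<le>
      N / (real m - 1) * (2 / real m * (\<Sum>c=1..<m. real c * w c)) + (sqrt (real m) + 4) * N + N * 6"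
    using 1 2 3 by linarith
  also have "\<dots> = N * (2 / (real m * (real m - 1)) * (\<Sum>c=1..<m. real c * w c) + sqrt (real m) + 10)"
    by (simp add: algebra_simps)
  finally show ?thesis by (simp add: N_def)
qed

lemma rank_avg_near:
  assumes f: "1-lipschitz_on UNIV f" and A: "distinct A" "0 < length A"
  shows "\<bar>rank_avg f A - (\<integral>x. f (real (length A) * x) \<partial>limit_law)\<bar> \<le> real (length A)"
proof -
  let ?m = "length A" and ?E = "\<integral>x. f (real (length A) * x) \<partial>limit_law"
  have "rank_avg f A - ?E = (\<Sum>r=1..?m. f (real (quickselect_exchanges A r)) - ?E) / real ?m"
    using A by (simp add: rank_avg_def sum_subtractf field_simps)
  also have "\<bar>\<dots>\<bar> \<le> (\<Sum>r=1..?m. real ?m) / real ?m"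
    unfolding abs_divide abs_of_nat
  proof (intro divide_right_mono order_trans[OF sum_abs sum_mono])
    fix r
    show "\<bar>f (real (quickselect_exchanges A r)) - ?E\<bar> \<le> real ?m"
      using quickselect_exchanges_le[of A r] A by (intro limit_law_integral_lip1_near[OF f]) auto
  qed simp
  finally show ?thesis using A by simp
qed

section \<open>Minimum in first position and the square-root estimate\<close>

lemma bij_betw_drop_min_at_0:
  assumes "finite S" "S \<noteq> {}"
  shows "bij_betw (drop 1) (min_at S 0) (permutations_of_set (S - {Min S}))"
proof (rule bij_betwI[where g = "\<lambda>B. Min S # B"])
  have min: "Min S \<in> S" by (rule Min_in[OF assms])
  have cons: "\<exists>B. A = Min S # B" if "A \<in> min_at S 0" for A
    using that assms(2) by (cases A) (simp_all add: min_at_iff)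
  show "drop 1 \<in> min_at S 0 \<rightarrow> permutations_of_set (S - {Min S})"
  proof
    fix A assume A: "A \<in> min_at S 0"
    then obtain B where "A = Min S # B" using cons by blast
    with A have "insert (Min S) (set B) = S" "Min S \<notin> set B" "distinct B" "drop 1 A = B"
      by (simp_all add: min_at_iff)
    then show "drop 1 A \<in> permutations_of_set (S - {Min S})"
      unfolding permutations_of_set_def by blast
  qed
  show "(\<lambda>B. Min S # B) \<in> permutations_of_set (S - {Min S}) \<rightarrow> min_at S 0"
  proof
    fix B assume "B \<in> permutations_of_set (S - {Min S})"
    then have "set B = S - {Min S}" "distinct B" by (simp_all add: permutations_of_set_def)
    then show "Min S # B \<in> min_at S 0"
      using min by (simp add: min_at_iff insert_absorb)
  qed
  show "Min S # drop 1 A = A" if "A \<in> min_at S 0" for A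
    using cons[OF that] by auto
qed simp

lemma card_min_at_0:
  assumes "finite S" "S \<noteq> {}"
  shows "card (min_at S 0) = fact (card S - 1)"
  using bij_betw_same_card[OF bij_betw_drop_min_at_0[OF assms]] assms by simp

text \<open>A permutation starts with its minimum with probability 1/n only. The trivial bound n on
  this event costs 1 in the mean, which keeps the case t = 0 out of the hypothesis
  \<open>gap\<close>.\<close>

lemma permutations_gap:
  fixes S :: "nat set"
  assumes S: "finite S" "S \<noteq> {}" and f: "1-lipschitz_on UNIV f" and w: "0 \<le> w"
    and gap: "\<And>t. 0 < t \<Longrightarrow> t < card S \<Longrightarrow>
      \<bar>(\<Sum>A\<in>min_at S t. rank_avg f A) - real (card (min_at S t)) * (\<integral>x. f (real (card S) * x) \<partial>limit_law)\<bar>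
       \<le> real (card (min_at S t)) * w"
  shows "\<bar>(\<Sum>A\<in>permutations_of_set S. rank_avg f A) -
      fact (card S) * (\<integral>x. f (real (card S) * x) \<partial>limit_law)\<bar> \<le> fact (card S) * (w + 1)"
proof -
  define n where "n = card S"
  let ?E = "\<integral>x. f (real n * x) \<partial>limit_law"
  have n: "0 < n" using S by (simp add: n_def card_gt_0_iff)
  have U: "permutations_of_set S = (\<Union>t<n. min_at S t)"
  proof
    show "permutations_of_set S \<subseteq> (\<Union>t<n. min_at S t)"
    proof
      fix A assume A: "A \<in> permutations_of_set S"
      then have "Min S \<in> set A" "length A = n"
        using S by (auto simp: permutations_of_set_def n_def distinct_card)
      then obtain t where "t < n" "A ! t = Min S" by (auto simp: in_set_conv_nth)
      then show "A \<in> (\<Union>t<n. min_at S t)" using A by (auto simp: min_at_def)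
    qed
  qed (auto simp: min_at_def)
  have sum_U: "(\<Sum>A\<in>permutations_of_set S. G A) = (\<Sum>t<n. \<Sum>A\<in>min_at S t. G A)" for G :: "nat list \<Rightarrow> real"
    unfolding U
  proof (rule sum.UNION_disjoint)
    show "\<forall>i\<in>{..<n}. \<forall>j\<in>{..<n}. i \<noteq> j \<longrightarrow> min_at S i \<inter> min_at S j = {}"
    proof (intro ballI impI)
      fix i j assume ij: "i \<in> {..<n}" "j \<in> {..<n}" "i \<noteq> j"
      have False if "A \<in> min_at S i" "A \<in> min_at S j" for A
      proof -
        have "length A = n" "distinct A" "A ! i = A ! j"
          using that by (auto simp: length_min_at n_def min_at_iff)
        then show False using ij by (simp add: nth_eq_iff_index_eq)
      qed
      then show "min_at S i \<inter> min_at S j = {}" by blast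
    qed
  qed (use S finite_min_at in auto)
  have "real (card (permutations_of_set S)) = (\<Sum>t<n. real (card (min_at S t)))"
    using sum_U[of "\<lambda>_. 1"] by simp
  then have cards: "(\<Sum>t<n. real (card (min_at S t))) = fact n" using S by (simp add: n_def)
  have "\<bar>(\<Sum>A\<in>permutations_of_set S. rank_avg f A) - fact n * ?E\<bar> =
      \<bar>\<Sum>t<n. (\<Sum>A\<in>min_at S t. rank_avg f A) - real (card (min_at S t)) * ?E\<bar>"
    by (simp add: sum_U sum_subtractf cards[symmetric] sum_distrib_right)
  also have "\<dots> \<le> (\<Sum>t<n. real (card (min_at S t)) * w + (if t = 0 then fact n else 0))"
  proof (rule order_trans[OF sum_abs sum_mono])
    fix t assume t: "t \<in> {..<n}"
    show "\<bar>(\<Sum>A\<in>min_at S t. rank_avg f A) - real (card (min_at S t)) * ?E\<bar>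
        \<le> real (card (min_at S t)) * w + (if t = 0 then fact n else 0)"
    proof (cases "t = 0")
      case False
      then show ?thesis using gap[of t] t by (simp add: n_def)
    next
      case True
      have "\<bar>(\<Sum>A\<in>min_at S t. rank_avg f A) - real (card (min_at S t)) * ?E\<bar> =
          \<bar>\<Sum>A\<in>min_at S t. rank_avg f A - ?E\<bar>" by (simp add: sum_subtractf)
      also have "\<dots> \<le> (\<Sum>A\<in>min_at S t. real n)"
      proof (rule order_trans[OF sum_abs sum_mono])
        fix A assume "A \<in> min_at S t"
        then have "length A = n" "distinct A" by (auto simp: length_min_at n_def min_at_iff)
        then show "\<bar>rank_avg f A - ?E\<bar> \<le> real n" using rank_avg_near[OF f, of A] n by simp
      qed
      also have "\<dots> = real (fact (n - 1) * n)" using True card_min_at_0[OF S] by (simp add: n_def)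
      also have "\<dots> = fact n" using n by (simp add: fact_reduce[of n])
      also have "\<dots> \<le> real (card (min_at S t)) * w + fact n" using w by simp
      finally show ?thesis using True by simp
    qed
  qed
  also have "\<dots> = fact n * w + fact n"
    using n by (simp add: sum.distrib sum_distrib_right[symmetric] cards)
  finally show ?thesis by (simp add: n_def algebra_simps)
qed


text \<open>By concavity \<open>sqrt\<close> lies below its tangent at \<open>s\<^sup>2\<close>, and
  the size-biased mean of c is (2 m - 1) / 3. With s = a sqrt m this gives the factor a / 2 + 1 / (3
  a), smallest at a = sqrt (2/3); the rational choice a = 4/5 yields 2/5 + 5/12 = 49/60, close to
  the limiting value 4/5.\<close>

lemma sum_mult_sqrt_le:
  assumes "2 \<le> m"
  shows "2 / (real m * (real m - 1)) * (\<Sum>c=1..<m. real c * sqrt (real c)) \<le> 49 / 60 * sqrt (real m)"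
proof -
  define M where "M = real m"
  define s where "s = 4 / 5 * sqrt M"
  have M: "2 \<le> M" using assms by (simp add: M_def)
  have s: "0 < s" "s\<^sup>2 = 16 / 25 * M" using M by (auto simp: s_def power_mult_distrib power_divide)
  have sq: "sqrt (real c) \<le> (s + real c / s) / 2" for c
  proof -
    have "0 \<le> (s - sqrt (real c))\<^sup>2" by simp
    then have "2 * s * sqrt (real c) \<le> s\<^sup>2 + real c" by (simp add: power2_diff)
    then show ?thesis using s(1) by (simp add: field_simps power2_eq_square)
  qed
  have gauss: "(\<Sum>c=1..<n. real c) = real n * (real n - 1) / 2"
    "(\<Sum>c=1..<n. (real c)\<^sup>2) = real n * (real n - 1) * (2 * real n - 1) / 6" if "1 \<le> n" for n
    using that by (induction n rule: dec_induct) (auto simp: field_simps power2_eq_square)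
  have "(\<Sum>c=1..<m. real c * sqrt (real c)) \<le> (\<Sum>c=1..<m. real c * ((s + real c / s) / 2))"
    by (intro sum_mono mult_left_mono sq) simp
  also have "\<dots> = (\<Sum>c=1..<m. s / 2 * real c + (real c)\<^sup>2 / (2 * s))"
    using s(1) by (intro sum.cong refl) (simp add: field_simps power2_eq_square)
  also have "\<dots> = s / 2 * (M * (M - 1) / 2) + M * (M - 1) * (2 * M - 1) / 6 / (2 * s)"
  proof -
    have "1 \<le> m" using assms by simp
    then show ?thesis
      by (simp only: sum.distrib sum_distrib_left[symmetric] sum_divide_distrib[symmetric] gauss M_def)
  qed
  finally have "2 / (M * (M - 1)) * (\<Sum>c=1..<m. real c * sqrt (real c)) \<le>
      2 / (M * (M - 1)) * (s / 2 * (M * (M - 1) / 2) + M * (M - 1) * (2 * M - 1) / 6 / (2 * s))"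
    using M by (intro mult_left_mono) auto
  also have "\<dots> = s / 2 + (2 * M - 1) / (6 * s)"
    using M s(1) by (simp add: field_simps)
  also have "\<dots> \<le> s / 2 + M / (3 * s)"
    using s(1) by (simp add: field_simps)
  also have "M / (3 * s) = 5 / 12 * sqrt M"
    using M by (simp add: s_def field_simps)
  also have "s / 2 + 5 / 12 * sqrt M = 49 / 60 * sqrt M"
    by (simp add: s_def)
  finally show ?thesis by (simp add: M_def)
qed

text \<open>The minimum is split off without exchange and a uniformly random list remains. The loss
  3 consists of 1 for the rank hitting the minimum (probability 1/m, error at most m), 1 from
  \<open>permutations_gap\<close>, and 1 for passing from m - 1 to m in the limit term.\<close>

lemma gap_min_first:
  fixes S :: "nat set"
  assumes S: "finite S" "S \<noteq> {}" and f: "1-lipschitz_on UNIV f" and w: "0 \<le> w"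
    and gap: "\<And>(S'::nat set) t. finite S' \<Longrightarrow> card S' = card S - 1 \<Longrightarrow> 0 < t \<Longrightarrow> t < card S' \<Longrightarrow>
      \<bar>(\<Sum>A\<in>min_at S' t. rank_avg f A) - real (card (min_at S' t)) * (\<integral>x. f (real (card S') * x) \<partial>limit_law)\<bar>
       \<le> real (card (min_at S' t)) * w"
  shows "\<bar>(\<Sum>A\<in>min_at S 0. rank_avg f A) - real (card (min_at S 0)) * (\<integral>x. f (real (card S) * x) \<partial>limit_law)\<bar>
       \<le> real (card (min_at S 0)) * (w + 3)"
proof -
  define m where "m = card S"
  define N where "N = real (card (min_at S 0))"
  let ?E = "\<integral>x. f (real m * x) \<partial>limit_law" and ?E' = "\<integral>x. f (real (m - 1) * x) \<partial>limit_law"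
  have m: "1 \<le> m" using S by (simp add: m_def Suc_le_eq card_gt_0_iff)
  have N: "N = fact (m - 1)" using card_min_at_0[OF S] by (simp add: N_def m_def)
  have props: "distinct A" "length A = m" "A ! 0 = Min S" "set A = S" if "A \<in> min_at S 0" for A
    using that by (auto simp: min_at_iff m_def distinct_card)
  show ?thesis
  proof (cases "m = 1")
    case True
    have "\<bar>(\<Sum>A\<in>min_at S 0. rank_avg f A) - N * ?E\<bar> = \<bar>\<Sum>A\<in>min_at S 0. rank_avg f A - ?E\<bar>"
      by (simp add: sum_subtractf N_def)
    also have "\<dots> \<le> (\<Sum>A\<in>min_at S 0. 1)"
    proof (rule order_trans[OF sum_abs sum_mono])
      fix A assume "A \<in> min_at S 0"
      then show "\<bar>rank_avg f A - ?E\<bar> \<le> 1"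
        using rank_avg_near[OF f, of A] props[of A] True by simp
    qed
    also have "\<dots> = N * 1" by (simp add: N_def)
    also have "\<dots> \<le> N * (w + 3)" using w by (intro mult_left_mono) (auto simp: N_def)
    finally show ?thesis by (simp add: m_def N_def)
  next
    case False
    then have m2: "2 \<le> m" using m by simp
    let ?S' = "S - {Min S}"
    have S': "finite ?S'" "card ?S' = m - 1" "?S' \<noteq> {}"
    proof -
      show "finite ?S'" "card ?S' = m - 1" using S by (auto simp: m_def)
      then show "?S' \<noteq> {}" using m2 by (metis One_nat_def card.empty diff_is_0_eq not_less_eq_eq numeral_2_eq_2)
    qed
    have avg: "rank_avg f A = f 0 / real m + (real m - 1) / real m * rank_avg f (drop 1 A)"
      if A: "A \<in> min_at S 0" for A
    proof -
      note P = props[OF A]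
      have "hoare_partition A = (A, 1, 0)"
      proof (rule hoare_partition_min)
        show "A \<noteq> []" using P m by auto
        fix l assume l: "0 < l" "l < length A"
        have "A ! 0 \<le> A ! l" unfolding P(3) using l P(4) S by (metis Min_le nth_mem)
        moreover have "A ! l \<noteq> A ! 0" using l P(1) by (subst nth_eq_iff_index_eq) auto
        ultimately show "A ! 0 < A ! l" by simp
      qed
      from rank_avg_partition[OF this, of f] have "rank_avg f A =
          1 / real m * rank_avg f (take 1 A) + real (m - 1) / real m * rank_avg f (drop 1 A)"
        using P m2 by simp
      moreover have "rank_avg f (take 1 A) = f 0"
        using P m2 by (simp add: rank_avg_def quickselect_exchanges.simps)
      ultimately show ?thesis using m by (simp add: of_nat_diff)
    qed
    let ?P = "\<Sum>B\<in>permutations_of_set ?S'. rank_avg f B"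
    have "(\<Sum>A\<in>min_at S 0. rank_avg f A) =
        N * (f 0 / real m) + (real m - 1) / real m * (\<Sum>A\<in>min_at S 0. rank_avg f (drop 1 A))"
      by (simp add: avg sum.distrib sum_distrib_left N_def)
    also have "(\<Sum>A\<in>min_at S 0. rank_avg f (drop 1 A)) = ?P"
      by (rule sum.reindex_bij_betw[OF bij_betw_drop_min_at_0[OF S]])
    finally have total: "(\<Sum>A\<in>min_at S 0. rank_avg f A) = N * (f 0 / real m) + (real m - 1) / real m * ?P" .
    have 1: "\<bar>f 0 - ?E\<bar> \<le> real m"
      by (rule limit_law_integral_lip1_near[OF f]) auto
    have 2: "\<bar>?P - N * ?E'\<bar> \<le> N * (w + 1)"
      using permutations_gap[OF S'(1,3) f w] gap[OF S'(1)] S'(2) by (simp add: N m_def)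
    have 3: "\<bar>?E' - ?E\<bar> \<le> 1"
      using limit_law_integral_lip1_diff[OF f, of "real (m - 1)" 0 "real m" 0] m by (simp add: of_nat_diff)
    have "\<bar>N * ?E' - N * ?E\<bar> \<le> N * 1"
      unfolding right_diff_distrib[symmetric] abs_mult using 3 by (intro mult_mono) (auto simp: N_def)
    with 2 have 4: "\<bar>?P - N * ?E\<bar> \<le> N * (w + 2)" by (simp add: algebra_simps)
    have "(\<Sum>A\<in>min_at S 0. rank_avg f A) - N * ?E =
        N / real m * (f 0 - ?E) + (real m - 1) / real m * (?P - N * ?E)"
      unfolding total using m by (simp add: field_simps)
    also have "\<bar>\<dots>\<bar> \<le> \<bar>N / real m * (f 0 - ?E)\<bar> + \<bar>(real m - 1) / real m * (?P - N * ?E)\<bar>"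
      by (rule abs_triangle_ineq)
    also have "\<dots> \<le> N / real m * real m + 1 * (N * (w + 2))"
      unfolding abs_mult using 1 4 m w by (intro add_mono mult_mono) (auto simp: N_def)
    also have "\<dots> = N * (w + 3)" using m by (simp add: algebra_simps)
    finally show ?thesis by (simp add: m_def N_def)
  qed
qed

text \<open>The estimate is closed under the recursion because the size-biased average of \<open>sqrt c\<close>
  over \<open>c < m\<close> is at most \<open>49/60 * sqrt m\<close>, which leaves room for the errors of one step.\<close>

lemma gap_sqrt:
  fixes S :: "nat set"
  assumes "finite S" "t < card S" "1-lipschitz_on UNIV f"
  shows "\<bar>(\<Sum>A\<in>min_at S t. rank_avg f A) - real (card (min_at S t)) * (\<integral>x. f (real (card S) * x) \<partial>limit_law)\<bar>
       \<le> real (card (min_at S t)) * (80 * sqrt (real (card S)) + (if t = 0 then 3 else 0))"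
  using assms
proof (induction "card S" arbitrary: S t f rule: less_induct)
  case less
  define m where "m = card S"
  show ?case
  proof (cases "t = 0")
    case True
    let ?w = "80 * sqrt (real m)"
    have "\<bar>(\<Sum>A\<in>min_at S 0. rank_avg f A) - real (card (min_at S 0)) * (\<integral>x. f (real (card S) * x) \<partial>limit_law)\<bar>
       \<le> real (card (min_at S 0)) * (?w + 3)"
    proof (rule gap_min_first[OF less(2) _ less(4)])
      show "S \<noteq> {}" using less(3) by auto
      fix S' :: "nat set" and t assume S': "finite S'" "card S' = card S - 1" "0 < t" "t < card S'"
      have "\<bar>(\<Sum>A\<in>min_at S' t. rank_avg f A) - real (card (min_at S' t)) * (\<integral>x. f (real (card S') * x) \<partial>limit_law)\<bar>
         \<le> real (card (min_at S' t)) * (80 * sqrt (real (card S')) + (if t = 0 then 3 else 0))"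
        using S' by (intro less(1) less(4)) auto
      also have "\<dots> \<le> real (card (min_at S' t)) * ?w"
        using S' by (intro mult_left_mono) (auto simp: m_def)
      finally show "\<bar>(\<Sum>A\<in>min_at S' t. rank_avg f A) - real (card (min_at S' t)) * (\<integral>x. f (real (card S') * x) \<partial>limit_law)\<bar>
         \<le> real (card (min_at S' t)) * ?w" .
    qed simp
    then show ?thesis using True by (simp add: m_def)
  next
    case False
    \<comment> \<open>The offset 3 admits sub-lists whose minimum comes first.\<close>
    define w where "w n = 80 * sqrt (real n) + 3" for n
    have gap: "gap_bound n (w n)" if n: "0 < n" "n < card S" for n
      unfolding gap_bound_def
    proof (intro allI impI)
      fix S' :: "nat set" and t' and f' :: "real \<Rightarrow> real"
      assume S': "finite S'" "card S' = n" "t' < n" "1-lipschitz_on UNIV f'"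
      have "\<bar>(\<Sum>A\<in>min_at S' t'. rank_avg f' A) - real (card (min_at S' t')) * (\<integral>x. f' (real (card S') * x) \<partial>limit_law)\<bar>
         \<le> real (card (min_at S' t')) * (80 * sqrt (real (card S')) + (if t' = 0 then 3 else 0))"
        using S' n by (intro less(1)) auto
      also have "\<dots> \<le> real (card (min_at S' t')) * w n"
        using S' by (intro mult_left_mono) (auto simp: w_def)
      finally show "\<bar>(\<Sum>A\<in>min_at S' t'. rank_avg f' A) - real (card (min_at S' t')) * (\<integral>x. f' (real n * x) \<partial>limit_law)\<bar>
         \<le> real (card (min_at S' t')) * w n" by (simp add: S'(2))
    qed
    have m2: "2 \<le> m" using less(3) False by (simp add: m_def)
    let ?r = "2 / (real m * (real m - 1))"
    have gauss: "(\<Sum>c=1..<n. real c) = real n * (real n - 1) / 2" if "1 \<le> n" for n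
      using that by (induction n rule: dec_induct) (auto simp: field_simps)
    have "(\<Sum>c=1..<m. real c) = real m * (real m - 1) / 2" using m2 by (intro gauss) simp
    then have lin: "?r * (\<Sum>c=1..<m. real c) = 1" using m2 by (simp only:) simp
    have "(\<Sum>c=1..<m. real c * w c) = 80 * (\<Sum>c=1..<m. real c * sqrt (real c)) + 3 * (\<Sum>c=1..<m. real c)"
      by (simp add: w_def distrib_left sum.distrib sum_distrib_left mult_ac)
    then have "?r * (\<Sum>c=1..<m. real c * w c) =
        80 * (?r * (\<Sum>c=1..<m. real c * sqrt (real c))) + 3 * (?r * (\<Sum>c=1..<m. real c))"
      by (simp add: distrib_left)
    also have "\<dots> \<le> 80 * (49 / 60 * sqrt (real m)) + 3"
      using sum_mult_sqrt_le[OF m2] lin by simp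
    finally have "?r * (\<Sum>c=1..<m. real c * w c) \<le> 80 * (49 / 60 * sqrt (real m)) + 3" .
    \<comment> \<open>The contraction leaves 80 * 11/60 = 44/3 times sqrt m, which must cover sqrt m
      + 10 from \<open>gap_step\<close> and the offset 3, at most 14 sqrt m in total; this is what
      80 is chosen for.\<close>
    have "?r * (\<Sum>c=1..<m. real c * w c) + sqrt (real m) + 10 \<le> 80 * sqrt (real m)"
    proof -
      have "1 \<le> sqrt (real m)" using m2 by simp
      with \<open>?r * (\<Sum>c=1..<m. real c * w c) \<le> 80 * (49 / 60 * sqrt (real m)) + 3\<close> show ?thesis
        by linarith
    qed
    then have "real (card (min_at S t)) * (?r * (\<Sum>c=1..<m. real c * w c) + sqrt (real m) + 10) \<le>
        real (card (min_at S t)) * (80 * sqrt (real m))"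
      by (intro mult_left_mono) auto
    with gap_step[OF less(2) _ less(3,4) gap] False show ?thesis by (simp add: m_def)
  qed
qed

section \<open>Convergence for the random input\<close>

lemma quickselect_input_eq:
  assumes "1 \<le> n"
  shows "quickselect_input n = pmf_of_set (permutations_of_set {1..n} \<times> {1..n})"
proof (rule pmf_eqI)
  fix z :: "nat list \<times> nat"
  show "pmf (quickselect_input n) z = pmf (pmf_of_set (permutations_of_set {1..n} \<times> {1..n})) z"
    using assms by (cases z) (simp add: quickselect_input_def pmf_pair indicator_times
        card_cartesian_product)
qed

lemma finite_set_quickselect_input: "1 \<le> n \<Longrightarrow> finite (set_pmf (quickselect_input n))"
  by (simp add: quickselect_input_eq)

lemma quickselect_input_bounds:
  assumes "1 \<le> n" "\<omega> \<in> set_pmf (quickselect_input n)"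
  shows "0 \<le> Y \<omega>" "Y \<omega> \<le> real n"
proof -
  have "\<omega> \<in> permutations_of_set {1..n} \<times> {1..n}" using assms by (simp add: quickselect_input_eq)
  then obtain A r where \<omega>: "\<omega> = (A, r)" "set A = {1..n}" "distinct A"
    by (auto simp: permutations_of_set_def)
  then have "length A = n" using distinct_card[of A] by simp
  then show "0 \<le> Y \<omega>" "Y \<omega> \<le> real n"
    using quickselect_exchanges_le[of A r] \<omega> assms(1) by (auto simp: Y_def)
qed

lemma expectation_gap:
  assumes n: "1 \<le> n" and f: "1-lipschitz_on UNIV f"
  shows "\<bar>measure_pmf.expectation (quickselect_input n) (\<lambda>\<omega>. f (Y \<omega>)) - (\<integral>x. f (real n * x) \<partial>limit_law)\<bar>
    \<le> 80 * sqrt (real n) + 1"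
proof -
  let ?P = "permutations_of_set {1..n}" and ?E = "\<integral>x. f (real n * x) \<partial>limit_law"
  have "measure_pmf.expectation (quickselect_input n) (\<lambda>\<omega>. f (Y \<omega>)) =
      (\<Sum>z\<in>?P \<times> {1..n}. f (Y z)) / real (card (?P \<times> {1..n}))"
    unfolding quickselect_input_eq[OF n] using n by (subst integral_pmf_of_set) auto
  also have "(\<Sum>z\<in>?P \<times> {1..n}. f (Y z)) = (\<Sum>A\<in>?P. \<Sum>r=1..n. f (real (quickselect_exchanges A r)))"
    by (simp add: sum.cartesian_product Y_def split_beta')
  also have "\<dots> = (\<Sum>A\<in>?P. rank_avg f A * real n)"
  proof (intro sum.cong refl)
    fix A assume "A \<in> ?P"
    then have "length A = n" using distinct_card[of A] by (auto simp: permutations_of_set_def)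
    then show "(\<Sum>r=1..n. f (real (quickselect_exchanges A r))) = rank_avg f A * real n"
      using n by (simp add: rank_avg_def)
  qed
  also have "\<dots> = (\<Sum>A\<in>?P. rank_avg f A) * real n" by (simp add: sum_distrib_right)
  also have "\<dots> / real (card (?P \<times> {1..n})) = (\<Sum>A\<in>?P. rank_avg f A) / fact n"
    using n by (simp add: card_cartesian_product)
  finally have eq: "measure_pmf.expectation (quickselect_input n) (\<lambda>\<omega>. f (Y \<omega>)) = (\<Sum>A\<in>?P. rank_avg f A) / fact n" .
  have "\<bar>(\<Sum>A\<in>?P. rank_avg f A) - fact (card {1..n}) * (\<integral>x. f (real (card {1..n}) * x) \<partial>limit_law)\<bar> \<le>
      fact (card {1..n}) * (80 * sqrt (real n) + 1)"
  proof (rule permutations_gap[OF _ _ f])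
    fix t assume "0 < t" "t < card {1..n}"
    then show "\<bar>(\<Sum>A\<in>min_at {1..n} t. rank_avg f A) - real (card (min_at {1..n} t)) *
        (\<integral>x. f (real (card {1..n}) * x) \<partial>limit_law)\<bar> \<le> real (card (min_at {1..n} t)) * (80 * sqrt (real n))"
      using gap_sqrt[of "{1..n}" t f] f by simp
  qed (use n in auto)
  then have "\<bar>(\<Sum>A\<in>?P. rank_avg f A) - fact n * ?E\<bar> \<le> fact n * (80 * sqrt (real n) + 1)" by simp
  moreover have "\<bar>a / N - e\<bar> \<le> b" if "\<bar>a - N * e\<bar> \<le> N * b" "0 < N" for a N e b :: real
  proof -
    have "a / N - e = (a - N * e) / N" using that by (simp add: field_simps)
    then have "\<bar>a / N - e\<bar> = \<bar>a - N * e\<bar> / N" using that by simp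
    then show ?thesis using that by (simp add: pos_divide_le_eq mult.commute)
  qed
  ultimately show ?thesis unfolding eq by simp
qed

text \<open>The test function y -> n f (y / n) is again 1-Lipschitz; applying
  \<open>expectation_gap\<close> to it and dividing by n leaves an error of order 1 / sqrt
  n.\<close>

lemma expectation_tendsto:
  fixes f :: "real \<Rightarrow> real"
  assumes f: "1-lipschitz_on UNIV f"
  shows "(\<lambda>n. measure_pmf.expectation (quickselect_input n) (\<lambda>\<omega>. f (Y \<omega> / real n)))
    \<longlonglongrightarrow> (\<integral>x. f x \<partial>limit_law)"
proof (rule LIM_zero_cancel, rule Lim_null_comparison)
  have "filterlim (\<lambda>n. sqrt (real n)) at_top sequentially"
    by (rule filterlim_compose[OF sqrt_at_top filterlim_real_sequentially])
  then show "(\<lambda>n. 81 / sqrt (real n)) \<longlonglongrightarrow> 0"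
    by (intro tendsto_divide_0[OF tendsto_const] filterlim_at_top_imp_at_infinity)
  show "\<forall>\<^sub>F n in sequentially. norm (measure_pmf.expectation (quickselect_input n) (\<lambda>\<omega>. f (Y \<omega> / real n)) -
      (\<integral>x. f x \<partial>limit_law)) \<le> 81 / sqrt (real n)"
    using eventually_ge_at_top[of 1]
  proof eventually_elim
    case (elim n)
    define F where "F y = real n * f (y / real n)" for y
    have "1-lipschitz_on UNIV F"
    proof (rule lip1I)
      fix x y
      have "\<bar>F x - F y\<bar> = real n * \<bar>f (x / real n) - f (y / real n)\<bar>"
        by (simp add: F_def abs_mult flip: right_diff_distrib)
      also have "\<dots> \<le> real n * \<bar>x / real n - y / real n\<bar>"
        by (intro mult_left_mono lip1D[OF f]) simp
      also have "\<dots> = \<bar>x - y\<bar>" using elim by (simp flip: diff_divide_distrib)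
      finally show "\<bar>F x - F y\<bar> \<le> \<bar>x - y\<bar>" .
    qed
    from expectation_gap[OF elim this]
    have "\<bar>real n * (measure_pmf.expectation (quickselect_input n) (\<lambda>\<omega>. f (Y \<omega> / real n)) -
        (\<integral>x. f x \<partial>limit_law))\<bar> \<le> 80 * sqrt (real n) + 1"
      using elim by (simp add: F_def right_diff_distrib)
    also have "\<dots> \<le> 81 * sqrt (real n)" using elim by simp
    finally have "real n * \<bar>measure_pmf.expectation (quickselect_input n) (\<lambda>\<omega>. f (Y \<omega> / real n)) -
        (\<integral>x. f x \<partial>limit_law)\<bar> \<le> 81 * sqrt (real n)"
      by (simp add: abs_mult)
    then have "\<bar>measure_pmf.expectation (quickselect_input n) (\<lambda>\<omega>. f (Y \<omega> / real n)) -
        (\<integral>x. f x \<partial>limit_law)\<bar> \<le> 81 * sqrt (real n) / real n"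
      using elim by (simp add: field_simps)
    also have "81 * sqrt (real n) / real n = 81 / sqrt (real n)"
      using elim by (simp add: field_simps)
    finally show ?case by simp
  qed
qed

text \<open>It suffices to test with the piecewise linear functions \<open>cts_step a b\<close>,
  which are 1-Lipschitz functions divided by b - a.\<close>

lemma quickselect_weak_conv:
  "weak_conv_m (\<lambda>n. distr (measure_pmf (quickselect_input n)) borel (\<lambda>\<omega>. Y \<omega> / real n)) limit_law"
proof (rule integral_cts_step_conv_imp_weak_conv)
  show "real_distribution (distr (measure_pmf (quickselect_input n)) borel (\<lambda>\<omega>. Y \<omega> / real n))" for n
    by (rule prob_space.real_distribution_distr[OF measure_pmf.prob_space_axioms]) simp
  show "real_distribution limit_law" by (rule real_distribution_limit_law)
  fix a b :: real assume ab: "a < b"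
  define f where "f z = max 0 (min (b - a) (b - z))" for z
  have f: "1-lipschitz_on UNIV f" by (rule lip1I) (auto simp: f_def)
  have cts: "cts_step a b = (\<lambda>z. f z / (b - a))"
    using ab by (auto simp: cts_step_def f_def fun_eq_iff)
  note [measurable] = lip1_measurable[OF f]
  have "(\<lambda>n. measure_pmf.expectation (quickselect_input n) (\<lambda>\<omega>. f (Y \<omega> / real n)) / (b - a))
      \<longlonglongrightarrow> (\<integral>x. f x \<partial>limit_law) / (b - a)"
    using ab by (intro tendsto_divide expectation_tendsto f) auto
  moreover have "integral\<^sup>L (distr (measure_pmf (quickselect_input n)) borel (\<lambda>\<omega>. Y \<omega> / real n)) (cts_step a b) =
      measure_pmf.expectation (quickselect_input n) (\<lambda>\<omega>. f (Y \<omega> / real n)) / (b - a)" for n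
    unfolding cts by (subst integral_distr) auto
  moreover have "integral\<^sup>L limit_law (cts_step a b) = (\<integral>x. f x \<partial>limit_law) / (b - a)"
    unfolding cts by simp
  ultimately show "(\<lambda>n. integral\<^sup>L (distr (measure_pmf (quickselect_input n)) borel (\<lambda>\<omega>. Y \<omega> / real n)) (cts_step a b))
      \<longlonglongrightarrow> integral\<^sup>L limit_law (cts_step a b)"
    by (simp only:)
qed

lemma quickselect_variance:
  "(\<lambda>n. measure_pmf.variance (quickselect_input n) Y) \<sim>[at_top] (\<lambda>n. 1 / 60 * (real n)\<^sup>2)"
proof (rule asymp_equivI'_const)
  let ?E = "\<lambda>n. measure_pmf.expectation (quickselect_input n)"
  \<comment> \<open>The square is not Lipschitz on the line, but \<open>Y \<omega> / n\<close> and
    the limit variable lie in the unit interval, where half the square is 1-Lipschitz. Thus second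
    moments converge by the same estimate.\<close>
  define h where "h z = (clip z)\<^sup>2 / 2" for z
  have h: "1-lipschitz_on UNIV h"
  proof (rule lip1I)
    fix x y
    have "\<bar>h x - h y\<bar> = \<bar>clip x - clip y\<bar> * (\<bar>clip x + clip y\<bar> / 2)"
      by (simp add: h_def abs_mult[symmetric] power2_eq_square algebra_simps flip: diff_divide_distrib)
    also have "\<dots> \<le> \<bar>clip x - clip y\<bar> * 1"
      using clip_bounds[of x] clip_bounds[of y] by (intro mult_left_mono) auto
    also have "\<dots> \<le> \<bar>x - y\<bar>" by (auto simp: clip_def)
    finally show "\<bar>h x - h y\<bar> \<le> \<bar>x - y\<bar>" .
  qed
  have h_eq: "2 * h z = z\<^sup>2" if "0 \<le> z" "z \<le> 1" for z
    using that by (simp add: h_def clip_eq)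
  have id: "1-lipschitz_on UNIV (\<lambda>x::real. x)" by (rule lip1I) simp
  have m1: "(\<lambda>n. ?E n (\<lambda>\<omega>. Y \<omega> / real n)) \<longlonglongrightarrow> 1 / 2"
    using expectation_tendsto[OF id] by (simp add: limit_law_mean)
  have "2 * (\<integral>x. h x \<partial>limit_law) = (\<integral>x. x\<^sup>2 \<partial>limit_law)"
    unfolding integral_mult_right_zero[symmetric]
  proof (rule integral_cong_AE)
    show "AE x in limit_law. 2 * h x = x\<^sup>2"
      using AE_limit_law by eventually_elim (use h_eq in auto)
    interpret real_distribution limit_law by (rule real_distribution_limit_law)
    note [measurable] = lip1_measurable[OF h]
    show "(\<lambda>x. 2 * h x) \<in> borel_measurable limit_law" "(\<lambda>x. x\<^sup>2) \<in> borel_measurable limit_law" by simp_all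
  qed
  then have "(\<integral>x. h x \<partial>limit_law) = 2 / 15" by (simp add: limit_law_second_moment)
  then have m2: "(\<lambda>n. 2 * ?E n (\<lambda>\<omega>. h (Y \<omega> / real n))) \<longlonglongrightarrow> 4 / 15"
    using tendsto_mult[OF tendsto_const[of 2] expectation_tendsto[OF h]] by (simp only:) simp
  have "(\<lambda>n. 2 * ?E n (\<lambda>\<omega>. h (Y \<omega> / real n)) - (?E n (\<lambda>\<omega>. Y \<omega> / real n))\<^sup>2) \<longlonglongrightarrow> 4 / 15 - (1 / 2)\<^sup>2"
    by (intro tendsto_intros m1 m2)
  then have lim: "(\<lambda>n. 2 * ?E n (\<lambda>\<omega>. h (Y \<omega> / real n)) - (?E n (\<lambda>\<omega>. Y \<omega> / real n))\<^sup>2) \<longlonglongrightarrow> 1 / 60"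
    by (simp add: power2_eq_square)
  show "(\<lambda>n. measure_pmf.variance (quickselect_input n) Y / (real n)\<^sup>2) \<longlonglongrightarrow> 1 / 60"
  proof (rule Lim_transform_eventually[OF lim])
    show "\<forall>\<^sub>F n in sequentially. 2 * ?E n (\<lambda>\<omega>. h (Y \<omega> / real n)) - (?E n (\<lambda>\<omega>. Y \<omega> / real n))\<^sup>2 =
        measure_pmf.variance (quickselect_input n) Y / (real n)\<^sup>2"
      using eventually_ge_at_top[of 1]
    proof eventually_elim
      case (elim n)
      have int: "integrable (quickselect_input n) X" for X :: "nat list \<times> nat \<Rightarrow> real"
        by (rule integrable_measure_pmf_finite[OF finite_set_quickselect_input[OF elim]])
      have "2 * ?E n (\<lambda>\<omega>. h (Y \<omega> / real n)) = ?E n (\<lambda>\<omega>. 2 * h (Y \<omega> / real n))"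
        by simp
      also have "\<dots> = ?E n (\<lambda>\<omega>. (Y \<omega>)\<^sup>2 / (real n)\<^sup>2)"
      proof (rule integral_cong_AE)
        show "AE \<omega> in quickselect_input n. 2 * h (Y \<omega> / real n) = (Y \<omega>)\<^sup>2 / (real n)\<^sup>2"
          using quickselect_input_bounds[OF elim] elim
          by (auto simp: AE_measure_pmf_iff h_eq power_divide)
      qed simp_all
      finally have second: "2 * ?E n (\<lambda>\<omega>. h (Y \<omega> / real n)) = ?E n (\<lambda>\<omega>. (Y \<omega>)\<^sup>2) / (real n)\<^sup>2" by simp
      have "measure_pmf.variance (quickselect_input n) Y = ?E n (\<lambda>\<omega>. (Y \<omega>)\<^sup>2) - (?E n Y)\<^sup>2"
        by (rule measure_pmf.variance_eq[OF int int])
      then show ?case unfolding second by (simp add: diff_divide_distrib power_divide)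
    qed
  qed
qed simp

theorem theorem1p1:
  shows "(\<exists>\<mu>. solves_RDE \<mu> \<and> (\<forall>\<nu>. solves_RDE \<nu> \<longrightarrow> \<nu> = \<mu>) \<and>
            weak_conv_m
              (\<lambda>n. distr (measure_pmf (quickselect_input n)) borel (\<lambda>\<omega>. Y \<omega> / real n)) \<mu>) \<and>
         (\<lambda>n. measure_pmf.variance (quickselect_input n) Y) \<sim>[at_top] (\<lambda>n. 1 / 60 * (real n)\<^sup>2)"
  using solves_RDE_limit_law solves_RDE_unique quickselect_weak_conv quickselect_variance by blast

end
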